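(* Every T-link is the closure of a positive braid with at least one positive full twist. That is, for every T-link $L$ there are an integer $n\ge 1$ and a positive braid with $n$ strands, having at least one positive full twist on its $n$ strands, whose closure is $L$.
   Context: $\sigma_1,\dots,\sigma_{n-1}$ are the standard generators of the braid group $B_n$ on $n$ strands. A positive braid is a braid given by a word in the $\sigma_i$ with no inverses. T-links: for integers $2\le r_1<\dots<r_k$ and $s_1,\dots,s_k>0$ ($k\ge1$), the T-link $T((r_1,s_1),\dots,(r_k,s_k))$ is the closure of the braid on $r_k$ strands $$(\sigma_1\cdots\sigma_{r_1-1})^{s_1}(\sigma_1\cdots\sigma_{r_2-1})^{s_2}\cdots(\sigma_1\cdots\sigma_{r_k-1})^{s_k}.$$ Full twists: a positive braid with $n$ strands has at least one positive full twist if it contains $(\sigma_1\cdots\sigma_{n-1})^{n}$ as a sub-braid; equivalently (the full twist being central) it equals $(\sigma_1\cdots\sigma_{n-1})^{n}X$ in $B_n$ for some positive braid $X$ with $n$ strands. For $n=1$ the full twist is the trivial braid on one strand. *)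

theory Defs
  imports "HOL-Analysis.Analysis"
begin

section \<open>Braid words and equality in the braid group\<close>

text \<open>\<open>Gen i\<close> is the generator \<open>\<sigma>\<^sub>i\<close> and \<open>Inv i\<close> its inverse, with indices starting at 1.
  Elements of \<open>B\<^sub>n\<close> are represented by words; \<open>braid_eq n\<close> is the congruence of Artin's
  presentation, so two words are related iff they are the same element of \<open>B\<^sub>n\<close>.\<close>

datatype braid_letter = Gen nat | Inv nat

fun gen_index :: "braid_letter \<Rightarrow> nat" where
  "gen_index (Gen i) = i"
| "gen_index (Inv i) = i"

type_synonym braid_word = "braid_letter list"

definition braid_words :: "nat \<Rightarrow> braid_word set" where
  "braid_words n = {w. \<forall>a\<in>set w. 1 \<le> gen_index a \<and> gen_index a < n}"

definition positive_words :: "nat \<Rightarrow> braid_word set" where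
  "positive_words n = {w. \<forall>a\<in>set w. \<exists>i. a = Gen i \<and> 1 \<le> i \<and> i < n}"

inductive braid_eq :: "nat \<Rightarrow> braid_word \<Rightarrow> braid_word \<Rightarrow> bool" for n where
  refl: "w \<in> braid_words n \<Longrightarrow> braid_eq n w w"
| sym: "braid_eq n v w \<Longrightarrow> braid_eq n w v"
| trans: "braid_eq n u v \<Longrightarrow> braid_eq n v w \<Longrightarrow> braid_eq n u w"
| cong: "braid_eq n v v' \<Longrightarrow> u \<in> braid_words n \<Longrightarrow> w \<in> braid_words n
    \<Longrightarrow> braid_eq n (u @ v @ w) (u @ v' @ w)"
| cancel_right: "1 \<le> i \<Longrightarrow> i < n \<Longrightarrow> braid_eq n [Gen i, Inv i] []"
| cancel_left: "1 \<le> i \<Longrightarrow> i < n \<Longrightarrow> braid_eq n [Inv i, Gen i] []"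
| far: "1 \<le> i \<Longrightarrow> i + 2 \<le> j \<Longrightarrow> j < n \<Longrightarrow> braid_eq n [Gen i, Gen j] [Gen j, Gen i]"
| braid: "1 \<le> i \<Longrightarrow> i + 1 < n
    \<Longrightarrow> braid_eq n [Gen i, Gen (i + 1), Gen i] [Gen (i + 1), Gen i, Gen (i + 1)]"

definition word_power :: "braid_word \<Rightarrow> nat \<Rightarrow> braid_word" where
  "word_power w s = concat (replicate s w)"

text \<open>The word \<open>\<sigma>\<^sub>1 \<cdots> \<sigma>\<^bsub>r-1\<^esub>\<close>, which is empty for \<open>r = 1\<close>.\<close>

definition staircase :: "nat \<Rightarrow> braid_word" where
  "staircase r = map Gen [1..<r]"

definition full_twist :: "nat \<Rightarrow> braid_word" where
  "full_twist n = word_power (staircase n) n"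

definition has_positive_full_twist :: "nat \<Rightarrow> braid_word \<Rightarrow> bool" where
  "has_positive_full_twist n w \<longleftrightarrow> (\<exists>x\<in>positive_words n. braid_eq n w (full_twist n @ x))"

section \<open>Closures of braids as subsets of three-space\<close>

definition cylindrical :: "real \<Rightarrow> real \<Rightarrow> real \<Rightarrow> real^3" where
  "cylindrical r \<theta> z = vector [r * cos \<theta>, r * sin \<theta>, z]"

text \<open>
  The closed braid of a word winds around the \<open>z\<close>-axis, with increasing angle, meeting every
  half-plane \<open>\<theta> = const\<close> (with coordinates \<open>(r, z)\<close>, \<open>r > 0\<close>) in \<open>n\<close> points. A word with
  \<open>m > 0\<close> letters divides the turn into \<open>m\<close> equal sectors, and the points sit at
  \<open>(1, 0), \<dots>, (n, 0)\<close> at the ends of each sector. In the sector of \<open>\<sigma>\<^sub>i\<close> the points at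
  \<open>(i, 0)\<close> and \<open>(i + 1, 0)\<close> exchange places by a half-turn about their midpoint, the one moving
  outwards passing above the other; for \<open>\<sigma>\<^sub>i\<^sup>-\<^sup>1\<close> it passes below. With strands oriented by
  increasing angle, \<open>\<sigma>\<^sub>i\<close> is a positive (right-handed) crossing.

  \<open>strand a k t\<close> is the position \<open>(r, z)\<close> of the strand starting at \<open>(k, 0)\<close>, after the
  fraction \<open>t \<in> [0, 1]\<close> of the sector of the letter \<open>a\<close>.\<close>

fun strand_sign :: "braid_letter \<Rightarrow> real" where
  "strand_sign (Gen i) = 1"
| "strand_sign (Inv i) = -1"

definition strand :: "braid_letter \<Rightarrow> nat \<Rightarrow> real \<Rightarrow> real \<times> real" where
  "strand a k t =
    (let i = gen_index a; c = real i + 1/2 in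
     if k = i then (c - cos (pi * t) / 2, strand_sign a * sin (pi * t) / 2)
     else if k = i + 1 then (c + cos (pi * t) / 2, - strand_sign a * sin (pi * t) / 2)
     else (real k, 0))"

definition closed_braid :: "nat \<Rightarrow> braid_word \<Rightarrow> (real^3) set" where
  "closed_braid n w =
    (if w = [] then {cylindrical (real k) \<theta> 0 | k \<theta>. 1 \<le> k \<and> k \<le> n \<and> 0 \<le> \<theta> \<and> \<theta> \<le> 2 * pi}
     else {cylindrical (fst (strand (w ! j) k t)) (2 * pi * (real j + t) / real (length w))
             (snd (strand (w ! j) k t))
           | j k t. j < length w \<and> 1 \<le> k \<and> k \<le> n \<and> 0 \<le> t \<and> t \<le> 1})"

section \<open>Links up to ambient isotopy\<close>

definition ambient_isotopic :: "(real^3) set \<Rightarrow> (real^3) set \<Rightarrow> bool" where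
  "ambient_isotopic K L \<longleftrightarrow>
    (\<exists>H :: real \<times> (real^3) \<Rightarrow> real^3.
       continuous_on ({0..1} \<times> UNIV) H \<and>
       (\<forall>t\<in>{0..1}. \<exists>g. homeomorphism UNIV UNIV (\<lambda>x. H (t, x)) g) \<and>
       (\<forall>x. H (0, x) = x) \<and>
       (\<lambda>x. H (1, x)) ` K = L)"

text \<open>Links are unoriented subsets of three-space considered up to ambient isotopy, so \<open>L\<close> is
  the closure of a braid as soon as it is ambient isotopic to the model \<open>closed_braid\<close>.\<close>

definition is_closure_of :: "(real^3) set \<Rightarrow> nat \<Rightarrow> braid_word \<Rightarrow> bool" where
  "is_closure_of L n w \<longleftrightarrow> w \<in> braid_words n \<and> ambient_isotopic (closed_braid n w) L"

section \<open>T-links\<close>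

definition T_link_params :: "(nat \<times> nat) list \<Rightarrow> bool" where
  "T_link_params ps \<longleftrightarrow> ps \<noteq> [] \<and> sorted_wrt (<) (map fst ps) \<and>
     (\<forall>(r, s)\<in>set ps. 2 \<le> r \<and> 0 < s)"

definition T_link_word :: "(nat \<times> nat) list \<Rightarrow> braid_word" where
  "T_link_word ps = concat (map (\<lambda>(r, s). word_power (staircase r) s) ps)"

definition is_T_link :: "(real^3) set \<Rightarrow> bool" where
  "is_T_link L \<longleftrightarrow>
    (\<exists>ps. T_link_params ps \<and> is_closure_of L (fst (last ps)) (T_link_word ps))"

end

theory Submission
  imports Defs
begin

text \<open>
  Write \<open>\<delta>\<^sub>r\<close> for the staircase \<open>\<sigma>\<^sub>1 \<cdots> \<sigma>\<^bsub>r-1\<^esub>\<close>, so that the word of a T-link ends in \<open>\<delta>\<^sub>r\<^sup>s\<close> on \<open>r\<close>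
  strands. If \<open>s \<ge> r\<close>, a full twist is visible. If \<open>s < r\<close>, strands can be removed: in the braid
  monoid \<open>\<delta>\<^sub>r\<^sup>s = \<delta>\<^bsub>r-1\<^esub>\<^sup>s \<sigma>\<^bsub>r-1\<^esub> \<sigma>\<^bsub>r-2\<^esub> \<cdots> \<sigma>\<^bsub>r-s\<^esub>\<close>, where \<open>\<sigma>\<^bsub>r-1\<^esub>\<close> occurs once and can be destabilized, and
  the remaining letters pass through \<open>\<delta>\<^bsub>r-1\<^esub>\<^sup>s\<close> to become \<open>\<sigma>\<^bsub>s-1\<^esub> \<cdots> \<sigma>\<^sub>1\<close>. Hence \<open>\<beta> \<delta>\<^sub>r\<^sup>s\<close> has the same closure
  as \<open>\<beta> (\<sigma>\<^bsub>s-1\<^esub> \<cdots> \<sigma>\<^sub>1) \<delta>\<^bsub>r-1\<^esub>\<^sup>s\<close> whenever \<open>\<beta>\<close> is a positive braid on \<open>r - 1\<close> strands (\<open>closed_braid_reduce1\<close>). This is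
  repeated until either \<open>s\<close> strands are left, which exhibits the full twist \<open>\<delta>\<^sub>s\<^sup>s\<close>, or the number \<open>r'\<close> of
  strands of the preceding factor \<open>\<delta>\<^bsub>r'\<^esub>\<^bsup>s'\<^esup>\<close> is reached. In the second case the letters collected on the
  way involve \<open>s\<close> strands only. Moving them to the left past a staircase on \<open>r'\<close> strands raises their
  indices by one, which is possible \<open>r' - s\<close> times. If \<open>s' + s \<ge> r'\<close>, this exhibits the full twist
  \<open>\<delta>\<^bsub>r'\<^esub>\<^bsup>r'\<^esup>\<close>. Otherwise they pass the whole factor \<open>\<delta>\<^bsub>r'\<^esub>\<^bsup>s'\<^esup>\<close>, and what remains is the shorter list of
  factors with \<open>\<delta>\<^bsub>r'\<^esub>\<^bsup>s' + s\<^esup>\<close> at its end, preceded by a positive braid on \<open>s' + s\<close> strands, to which the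
  induction hypothesis applies (\<open>T_link_fully_twisted\<close>).

  All equations used are equations between positive words, so that the geometric input consists of
  four facts about the closures as subsets of space: they are unchanged, up to ambient isotopy,
  under rotation of the word (\<open>closed_braid_rotate\<close>), under the two relations of the braid monoid
  (\<open>closed_braid_far\<close>, \<open>closed_braid_braid_relation\<close>) and under destabilization
  (\<open>closed_braid_destabilize\<close>).

  Apart from rotations about the axis, the isotopies come from one principle
  (\<open>linear_homotopy_isotopic\<close>). A displacement of a subset
  of space with a small Lipschitz constant extends to all of space, and the identity plus a
  contraction is a homeomorphism. Consequently a straight-line homotopy of a set is realized by an
  ambient isotopy as soon as its velocity is Lipschitz with respect to the distance at each time.
  For strands that wind around the axis this
  yields \<open>homotopy_path_closure\<close>: a Lipschitz homotopy of closed families of paths in the half-plane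
  without collisions gives an ambient isotopy of their closures. It covers the braid relations,
  all changes of parametrization, and reversing the order of the strands, after which a
  destabilization concerns the innermost strand. The loop made by that strand bounds a disc that
  meets nothing else, so it can be pulled straight across the axis (\<open>loop_removal_isotopic\<close>).
\<close>

section \<open>Ambient isotopy is an equivalence relation\<close>

lemma ambient_isotopic_refl: "ambient_isotopic K K"
  unfolding ambient_isotopic_def
  by (rule exI[of _ snd])
     (auto intro!: continuous_intros exI[of _ "\<lambda>x. x"] simp: homeomorphism_def)

lemma ambient_isotopicE:
  assumes "ambient_isotopic K L"
  obtains H :: "real \<times> (real^3) \<Rightarrow> real^3" where "continuous_on ({0..1} \<times> UNIV) H"
    and "\<And>t. t \<in> {0..1} \<Longrightarrow> \<exists>g. homeomorphism UNIV UNIV (\<lambda>x. H (t, x)) g"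
    and "\<And>x. H (0, x) = x" and "(\<lambda>x. H (1, x)) ` K = L"
proof -
  from assms obtain H :: "real \<times> (real^3) \<Rightarrow> real^3"
    where H: "continuous_on ({0..1} \<times> UNIV) H \<and>
      (\<forall>t\<in>{0..1}. \<exists>g. homeomorphism UNIV UNIV (\<lambda>x. H (t, x)) g) \<and>
      (\<forall>x. H (0, x) = x) \<and> (\<lambda>x. H (1, x)) ` K = L"
    unfolding ambient_isotopic_def by (rule exE) (rule that)
  show ?thesis
    by (rule that[OF conjunct1[OF H] bspec[OF conjunct1[OF conjunct2[OF H]]]])
       (use H in simp_all)
qed

lemma ambient_isotopic_sym:
  assumes "ambient_isotopic K L" shows "ambient_isotopic L K"
proof -
  obtain H :: "real \<times> (real^3) \<Rightarrow> real^3" where c: "continuous_on ({0..1} \<times> UNIV) H"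
    and h: "\<And>t. t \<in> {0..1} \<Longrightarrow> \<exists>g. homeomorphism UNIV UNIV (\<lambda>x. H (t, x)) g"
    and z: "\<And>x. H (0, x) = x" and e: "(\<lambda>x. H (1, x)) ` K = L"
    by (rule ambient_isotopicE[OF assms]) (rule that)
  obtain g where g: "homeomorphism UNIV UNIV (\<lambda>x. H (1, x)) g"
    using h[of 1] by auto
  have gc: "continuous_on UNIV g" and gl: "\<And>x. H (1, g x) = x" "\<And>x. g (H (1, x)) = x"
    using g by (auto simp: homeomorphism_def)
  define H' where "H' = (\<lambda>(t::real, x). H (1 - t, g x))"
  have "continuous_on ({0..1} \<times> UNIV) (\<lambda>p::real \<times> (real^3). H (1 - fst p, g (snd p)))"
    by (rule continuous_on_compose2[OF c])
       (auto intro!: continuous_intros continuous_on_compose2[OF gc])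
  then have c': "continuous_on ({0..1} \<times> UNIV) H'"
    by (simp add: H'_def case_prod_beta)
  have h': "\<exists>k. homeomorphism UNIV UNIV (\<lambda>x. H' (t, x)) k" if t: "t \<in> {0..1}" for t
  proof -
    obtain k where "homeomorphism UNIV UNIV (\<lambda>x. H (1 - t, x)) k"
      using h[of "1 - t"] t by auto
    from homeomorphism_compose[OF homeomorphism_symD[OF g] this] show ?thesis
      by (auto simp: H'_def o_def)
  qed
  have "(\<lambda>x. H' (1, x)) ` L = K"
    unfolding e[symmetric] by (simp add: H'_def image_image gl z)
  then show ?thesis
    unfolding ambient_isotopic_def
    by (intro exI[of _ H'] conjI ballI allI c' h') (auto simp: H'_def gl)
qed

lemma ambient_isotopic_trans [trans]:
  assumes "ambient_isotopic K L" "ambient_isotopic L M" shows "ambient_isotopic K M"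
proof -
  obtain H :: "real \<times> (real^3) \<Rightarrow> real^3" where c: "continuous_on ({0..1} \<times> UNIV) H"
    and h: "\<And>t. t \<in> {0..1} \<Longrightarrow> \<exists>g. homeomorphism UNIV UNIV (\<lambda>x. H (t, x)) g"
    and z: "\<And>x. H (0, x) = x" and e: "(\<lambda>x. H (1, x)) ` K = L"
    by (rule ambient_isotopicE[OF assms(1)]) (rule that)
  obtain J :: "real \<times> (real^3) \<Rightarrow> real^3" where Jc: "continuous_on ({0..1} \<times> UNIV) J"
    and Jh: "\<And>t. t \<in> {0..1} \<Longrightarrow> \<exists>g. homeomorphism UNIV UNIV (\<lambda>x. J (t, x)) g"
    and Jz: "\<And>x. J (0, x) = x" and Je: "(\<lambda>x. J (1, x)) ` L = M"
    by (rule ambient_isotopicE[OF assms(2)]) (rule that)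
  have h1c: "continuous_on UNIV (\<lambda>x. H (1, x))"
    using h[of 1] by (auto simp: homeomorphism_def)
  define G where "G = (\<lambda>p. if fst p \<le> 1/2 then H (2 * fst p, snd p)
                          else J (2 * fst p - 1, H (1, snd p)))"
  let ?A = "{0..1/2::real} \<times> (UNIV :: (real^3) set)"
  let ?B = "{1/2..1::real} \<times> (UNIV :: (real^3) set)"
  have "continuous_on (?A \<union> ?B) G"
    unfolding G_def
  proof (rule continuous_on_cases)
    show "continuous_on ?A (\<lambda>p. H (2 * fst p, snd p))"
      by (rule continuous_on_compose2[OF c]) (auto intro!: continuous_intros)
    show "continuous_on ?B (\<lambda>p. J (2 * fst p - 1, H (1, snd p)))"
      by (rule continuous_on_compose2[OF Jc])
         (auto intro!: continuous_intros continuous_on_compose2[OF h1c])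
    have "H (2 * fst p, snd p) = J (2 * fst p - 1, H (1, snd p))" if "fst p = 1/2" for p
      by (simp add: that Jz)
    then show "\<forall>p. p \<in> ?A \<and> \<not> fst p \<le> 1/2 \<or> p \<in> ?B \<and> fst p \<le> 1/2
        \<longrightarrow> H (2 * fst p, snd p) = J (2 * fst p - 1, H (1, snd p))"
      by (metis atLeastAtMost_iff mem_Times_iff order_antisym)
  qed (auto intro: closed_Times)
  moreover have "?A \<union> ?B = {0..1} \<times> UNIV" by auto
  ultimately have c': "continuous_on ({0..1} \<times> UNIV) G" by simp
  have h': "\<exists>g. homeomorphism UNIV UNIV (\<lambda>x. G (t, x)) g" if t: "t \<in> {0..1}" for t
  proof (cases "t \<le> 1/2")
    case True then show ?thesis using h[of "2 * t"] t by (auto simp: G_def)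
  next
    case False
    obtain a b where "homeomorphism UNIV UNIV (\<lambda>x. H (1, x)) a"
      "homeomorphism UNIV UNIV (\<lambda>x. J (2 * t - 1, x)) b"
      using h[of 1] Jh[of "2 * t - 1"] t False by auto
    from homeomorphism_compose[OF this] show ?thesis
      using False by (auto simp: G_def o_def)
  qed
  have "(\<lambda>x. G (1, x)) ` K = M"
    unfolding Je[symmetric] e[symmetric] by (simp add: G_def image_image)
  then show ?thesis
    unfolding ambient_isotopic_def
    by (intro exI[of _ G] conjI ballI allI c' h') (auto simp: G_def z)
qed

section \<open>Isotopies from Lipschitz displacements\<close>

lemma norm_perturbation_lower:
  fixes E :: "'a::real_normed_vector \<Rightarrow> 'a"
  assumes "\<And>x y. norm (E x - E y) \<le> c * norm (x - y)" and t: "0 \<le> t" "t \<le> 1"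
  shows "(1 - c) * norm (x - y) \<le> norm ((x + t *\<^sub>R E x) - (y + t *\<^sub>R E y))"
proof -
  have "norm (t *\<^sub>R (E x - E y)) \<le> norm (E x - E y)"
    using t by (simp add: mult_left_le_one_le)
  also have "\<dots> \<le> c * norm (x - y)" by (rule assms)
  finally have 1: "norm (t *\<^sub>R (E x - E y)) \<le> c * norm (x - y)" .
  have "norm (x - y) - norm (t *\<^sub>R (E x - E y)) \<le> norm ((x - y) + t *\<^sub>R (E x - E y))"
    by (metis norm_diff_ineq)
  with 1 show ?thesis by (simp add: algebra_simps)
qed

text \<open>For a contraction \<open>E\<close> every \<open>x + t E x\<close> is a homeomorphism: it is onto because
  \<open>x \<mapsto> y - t E x\<close> has a fixed point, and its inverse is Lipschitz by the preceding estimate.\<close>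

lemma lipschitz_perturbation_isotopic:
  fixes E :: "real^3 \<Rightarrow> real^3"
  assumes c: "c < 1" and E: "\<And>x y. norm (E x - E y) \<le> c * norm (x - y)"
  shows "ambient_isotopic K ((\<lambda>x. x + E x) ` K)"
proof -
  define c' where "c' = max c 0"
  have c': "0 \<le> c'" "c' < 1" and E': "\<And>x y. norm (E x - E y) \<le> c' * norm (x - y)"
    using c order_trans[OF E mult_right_mono] by (auto simp: c'_def)
  have Ec: "continuous_on UNIV E"
    by (rule lipschitz_on_continuous_on[of c'])
       (use c' E' in \<open>auto simp: lipschitz_on_def dist_norm\<close>)
  have low: "(1 - c') * norm (x - y) \<le> norm ((x + t *\<^sub>R E x) - (y + t *\<^sub>R E y))"
    if "t \<in> {0..1}" for t x y
    using norm_perturbation_lower[of E c' t x y] E' that by auto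
  have ex1: "\<exists>!x. x + t *\<^sub>R E x = y" if t: "t \<in> {0..1}" for t :: real and y :: "real^3"
  proof -
    have "\<exists>!x. y - t *\<^sub>R E x = x"
    proof (rule banach_fix_type[OF c'], intro allI)
      fix x z
      have "norm (t *\<^sub>R (E x - E z)) \<le> norm (E x - E z)"
        using t by (simp add: mult_left_le_one_le)
      also have "\<dots> \<le> c' * norm (x - z)" by (rule E')
      finally show "dist (y - t *\<^sub>R E x) (y - t *\<^sub>R E z) \<le> c' * dist x z"
        by (simp add: dist_norm norm_minus_commute scaleR_diff_right algebra_simps)
    qed
    moreover have "(y - t *\<^sub>R E x = x) = (x + t *\<^sub>R E x = y)" for x :: "real^3"
      by (auto simp: algebra_simps)
    ultimately show ?thesis by simp
  qed
  have hom: "\<exists>g. homeomorphism UNIV UNIV (\<lambda>x. x + t *\<^sub>R E x) g" if t: "t \<in> {0..1}" for t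
  proof -
    define g where "g y = (THE x. x + t *\<^sub>R E x = y)" for y
    have g: "g y + t *\<^sub>R E (g y) = y" for y
      unfolding g_def by (rule theI'[OF ex1[OF t]])
    have g': "g (x + t *\<^sub>R E x) = x" for x
      unfolding g_def by (rule the1_equality[OF ex1[OF t]]) simp
    have "norm (g x - g y) \<le> 1 / (1 - c') * norm (x - y)" for x y
      using low[OF t, of "g x" "g y"] c' by (simp add: g field_simps)
    then have "continuous_on UNIV g"
      by (intro lipschitz_on_continuous_on[of "1 / (1 - c')"])
         (use c' in \<open>auto simp: lipschitz_on_def dist_norm\<close>)
    moreover have "continuous_on UNIV (\<lambda>x. x + t *\<^sub>R E x)"
      by (intro continuous_intros Ec)
    ultimately show ?thesis
      using g g' by (intro exI[of _ g] homeomorphismI) auto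
  qed
  have "continuous_on ({0..1} \<times> UNIV) (\<lambda>p::real \<times> (real^3). snd p + fst p *\<^sub>R E (snd p))"
    by (intro continuous_intros continuous_on_compose2[OF Ec]) auto
  then show ?thesis
    unfolding ambient_isotopic_def
    by (intro exI[of _ "\<lambda>p. snd p + fst p *\<^sub>R E (snd p)"] conjI ballI allI) (simp_all add: hom)
qed

text \<open>McShane's extension of a real Lipschitz function: the infimum of the cones standing on its
  graph.\<close>

lemma lipschitz_real_extension:
  fixes f :: "'a::real_normed_vector \<Rightarrow> real"
  assumes L: "0 \<le> L" and f: "\<And>x y. x \<in> K \<Longrightarrow> y \<in> K \<Longrightarrow> \<bar>f x - f y\<bar> \<le> L * norm (x - y)"
  obtains g where "\<And>x. x \<in> K \<Longrightarrow> g x = f x" "\<And>x y. \<bar>g x - g y\<bar> \<le> L * norm (x - y)"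
proof (cases "K = {}")
  case True
  then show ?thesis using L by (intro that[of "\<lambda>_. 0"]) auto
next
  case False
  then obtain k0 where k0: "k0 \<in> K" by auto
  define g where "g x = (INF y\<in>K. f y + L * norm (x - y))" for x
  have tri: "L * norm (x - y) \<le> L * norm (x - z) + L * norm (z - y)" for x y z :: 'a
    using mult_left_mono[OF norm_triangle_ineq[of "x - z" "z - y"] L]
    by (simp add: distrib_left)
  have bdd: "bdd_below ((\<lambda>y. f y + L * norm (x - y)) ` K)" for x
  proof (rule bdd_belowI2[where m = "f k0 - L * norm (k0 - x)"])
    fix y assume "y \<in> K"
    then show "f k0 - L * norm (k0 - x) \<le> f y + L * norm (x - y)"
      using f[OF k0 \<open>y \<in> K\<close>] tri[of k0 y x] by linarith
  qed
  have le: "g x \<le> f y + L * norm (x - y)" if "y \<in> K" for x y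
    unfolding g_def by (rule cINF_lower[OF bdd that])
  have ge: "m \<le> g x" if "\<And>y. y \<in> K \<Longrightarrow> m \<le> f y + L * norm (x - y)" for m x
    unfolding g_def by (rule cINF_greatest[OF False that])
  have half: "g x - L * norm (x - z) \<le> g z" for x z
  proof (rule ge)
    fix y assume y: "y \<in> K"
    show "g x - L * norm (x - z) \<le> f y + L * norm (z - y)"
      using le[OF y, of x] tri[of x y z] by linarith
  qed
  show ?thesis
  proof (rule that)
    fix x assume x: "x \<in> K"
    show "g x = f x"
    proof (rule antisym)
      show "g x \<le> f x" using le[OF x, of x] by simp
      show "f x \<le> g x"
      proof (rule ge)
        fix y assume "y \<in> K"
        then show "f x \<le> f y + L * norm (x - y)"
          using f[OF x, of y] by linarith
      qed
    qed
  next
    fix x y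
    show "\<bar>g x - g y\<bar> \<le> L * norm (x - y)"
      using half[of x y] half[of y x] by (simp add: norm_minus_commute abs_le_iff)
  qed
qed

text \<open>The three coordinates are extended separately; the extension has at most three times the
  Lipschitz constant.\<close>

lemma lipschitz_displacement_isotopic:
  fixes d :: "real^3 \<Rightarrow> real^3"
  assumes L: "0 \<le> L" "3 * L < 1"
    and d: "\<And>x y. x \<in> K \<Longrightarrow> y \<in> K \<Longrightarrow> norm (d x - d y) \<le> L * norm (x - y)"
  shows "ambient_isotopic K ((\<lambda>x. x + d x) ` K)"
proof -
  have "\<exists>g. (\<forall>x\<in>K. g x = d x $ i) \<and> (\<forall>x y. \<bar>g x - g y\<bar> \<le> L * norm (x - y))" for i
  proof -
    have "\<bar>d x $ i - d y $ i\<bar> \<le> L * norm (x - y)" if "x \<in> K" "y \<in> K" for x y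
      using order_trans[OF component_le_norm_cart[of "d x - d y" i] d[OF that]] by simp
    from lipschitz_real_extension[OF L(1) this] show ?thesis by metis
  qed
  then obtain g where g: "\<And>i x. x \<in> K \<Longrightarrow> g i x = d x $ i"
    and gl: "\<And>i x y. \<bar>g i x - g i y\<bar> \<le> L * norm (x - y)"
    by metis
  define E where "E x = (\<chi> i. g i x)" for x
  have "norm (E x - E y) \<le> (3 * L) * norm (x - y)" for x y
  proof -
    have "norm (E x - E y) \<le> (\<Sum>i\<in>UNIV. \<bar>(E x - E y) $ i\<bar>)" by (rule norm_le_l1_cart)
    also have "\<dots> \<le> (\<Sum>i\<in>(UNIV::3 set). L * norm (x - y))"
      by (rule sum_mono) (simp add: E_def gl)
    finally show ?thesis by simp
  qed
  from lipschitz_perturbation_isotopic[OF L(2) this]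
  have "ambient_isotopic K ((\<lambda>x. x + E x) ` K)" .
  moreover have "(\<lambda>x. x + E x) ` K = (\<lambda>x. x + d x) ` K"
    by (rule image_cong) (auto simp: E_def vec_eq_iff g)
  ultimately show ?thesis by simp
qed

text \<open>The hypothesis excludes collisions during the homotopy in a quantitative way. The homotopy is cut
  into so many equal steps that the displacement in each of them, as a function on the current
  image, has a Lipschitz constant below \<open>1/3\<close>.\<close>

lemma linear_homotopy_isotopic:
  fixes a b :: "'p \<Rightarrow> real^3"
  assumes ctrl: "\<And>p q t. p \<in> P \<Longrightarrow> q \<in> P \<Longrightarrow> 0 \<le> t \<Longrightarrow> t \<le> 1 \<Longrightarrow>
      norm ((b p - a p) - (b q - a q))
        \<le> C * norm ((a p + t *\<^sub>R (b p - a p)) - (a q + t *\<^sub>R (b q - a q)))"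
  shows "ambient_isotopic (a ` P) (b ` P)"
proof -
  define C' where "C' = max C 0"
  define D where "D p = b p - a p" for p
  have C': "0 \<le> C'" by (simp add: C'_def)
  have ctrl': "norm (D p - D q) \<le> C' * norm ((a p + t *\<^sub>R D p) - (a q + t *\<^sub>R D q))"
    if "p \<in> P" "q \<in> P" "0 \<le> t" "t \<le> 1" for p q t
    using order_trans[OF ctrl[OF that] mult_right_mono[of C C']] by (auto simp: C'_def D_def)
  obtain N :: nat where N: "3 * C' + 1 < real N" using reals_Archimedean2 by blast
  then have N0: "0 < real N" using C' by linarith
  define S where "S i = (\<lambda>p. a p + (real i / N) *\<^sub>R D p) ` P" for i
  have step: "ambient_isotopic (S i) (S (Suc i))" if i: "i < N" for i
  proof -
    define f where "f p = a p + (real i / N) *\<^sub>R D p" for p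
    define d where "d x = (1 / N) *\<^sub>R D (SOME p. p \<in> P \<and> f p = x)" for x
    have ctr: "norm (D p - D q) \<le> C' * norm (f p - f q)" if "p \<in> P" "q \<in> P" for p q
      unfolding f_def by (rule ctrl'[OF that]) (use i in auto)
    have d: "d (f p) = (1 / N) *\<^sub>R D p" if p: "p \<in> P" for p
    proof -
      let ?q = "SOME q. q \<in> P \<and> f q = f p"
      have "?q \<in> P \<and> f ?q = f p" by (rule someI[of _ p]) (use p in auto)
      then have "D ?q = D p" using ctr[of ?q p] p by auto
      then show ?thesis by (simp add: d_def)
    qed
    have "ambient_isotopic (f ` P) ((\<lambda>x. x + d x) ` (f ` P))"
    proof (rule lipschitz_displacement_isotopic[of "C' / N"])
      show "0 \<le> C' / N" "3 * (C' / N) < 1" using C' N N0 by (auto simp: field_simps)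
      fix x y assume "x \<in> f ` P" "y \<in> f ` P"
      then obtain p q where pq: "p \<in> P" "q \<in> P" "x = f p" "y = f q" by auto
      have "norm (d x - d y) = norm (D p - D q) / N"
        using N0 by (simp add: pq d flip: scaleR_diff_right)
      also have "\<dots> \<le> C' * norm (f p - f q) / N"
        using ctr[of p q] pq N0 by (simp add: divide_right_mono)
      finally show "norm (d x - d y) \<le> C' / N * norm (x - y)" by (simp add: pq)
    qed
    moreover have "f ` P = S i" by (simp add: f_def S_def)
    moreover have "(\<lambda>x. x + d x) ` (f ` P) = S (Suc i)"
      unfolding S_def image_image
      by (rule image_cong)
         (use N0 in \<open>auto simp: d, simp add: f_def add_divide_distrib scaleR_add_left\<close>)
    ultimately show ?thesis by simp
  qed
  have "ambient_isotopic (S 0) (S i)" if "i \<le> N" for i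
    using that
    by (induction i)
       (simp add: ambient_isotopic_refl, meson Suc_leD Suc_le_lessD ambient_isotopic_trans step)
  from this[of N] have "ambient_isotopic (S 0) (S N)" by simp
  moreover have "S 0 = a ` P" by (simp add: S_def)
  moreover have "S N = b ` P" using N0 by (auto simp: S_def D_def)
  ultimately show ?thesis by simp
qed

section \<open>Closed braids of families of paths\<close>

text \<open>The closure of a family of paths in the half-plane with coordinates \<open>(r, z)\<close>, all traversed
  while the half-plane makes one turn around the axis.\<close>

text \<open>\<open>spin p \<theta>\<close> is linear in \<open>p\<close>, so that straight-line homotopies in the half-planes are straight-line
  homotopies in space.\<close>

definition spin :: "real \<times> real \<Rightarrow> real \<Rightarrow> real^3" where
  "spin p \<theta> = cylindrical (fst p) \<theta> (snd p)"

definition path_closure :: "'k set \<Rightarrow> ('k \<Rightarrow> real \<Rightarrow> real \<times> real) \<Rightarrow> (real^3) set" where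
  "path_closure S F = {spin (F k u) (2 * pi * u) | k u. k \<in> S \<and> 0 \<le> u \<and> u \<le> 1}"

lemma path_closure_image:
  "path_closure S F = (\<lambda>(k, u). spin (F k u) (2 * pi * u)) ` (S \<times> {0..1})"
  unfolding path_closure_def by force

lemma path_closure_cong:
  "(\<And>k u. k \<in> S \<Longrightarrow> 0 \<le> u \<Longrightarrow> u \<le> 1 \<Longrightarrow> F k u = G k u) \<Longrightarrow> path_closure S F = path_closure S G"
  unfolding path_closure_image by (rule image_cong) auto

lemma spin_add: "spin (p + q) \<theta> = spin p \<theta> + spin q \<theta>"
  and spin_diff: "spin (p - q) \<theta> = spin p \<theta> - spin q \<theta>"
  and spin_scale: "spin (t *\<^sub>R p) \<theta> = t *\<^sub>R spin p \<theta>"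
  by (simp_all add: spin_def cylindrical_def vec_eq_iff forall_3 algebra_simps)

lemma spin_period: "spin p (\<theta> + 2 * pi) = spin p \<theta>"
  by (simp add: spin_def cylindrical_def)

lemma norm_spin_diff:
  "(norm (spin p \<alpha> - spin q \<beta>))\<^sup>2 = (norm (p - q))\<^sup>2 + 4 * fst p * fst q * (sin ((\<alpha> - \<beta>) / 2))\<^sup>2"
proof -
  have c: "cos \<alpha> * cos \<beta> + sin \<alpha> * sin \<beta> = 1 - 2 * (sin ((\<alpha> - \<beta>) / 2))\<^sup>2"
    by (metis cos_diff cos_double_sin field_sum_of_halves mult_2)
  have "(norm (spin p \<alpha> - spin q \<beta>))\<^sup>2
      = (fst p * cos \<alpha> - fst q * cos \<beta>)\<^sup>2 + (fst p * sin \<alpha> - fst q * sin \<beta>)\<^sup>2 + (snd p - snd q)\<^sup>2"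
    unfolding power2_norm_eq_inner
    by (simp add: spin_def cylindrical_def inner_vec_def sum_3 power2_eq_square)
  also have "\<dots> = (fst p)\<^sup>2 * ((sin \<alpha>)\<^sup>2 + (cos \<alpha>)\<^sup>2) + (fst q)\<^sup>2 * ((sin \<beta>)\<^sup>2 + (cos \<beta>)\<^sup>2)
      - 2 * fst p * fst q * (cos \<alpha> * cos \<beta> + sin \<alpha> * sin \<beta>) + (snd p - snd q)\<^sup>2"
    by algebra
  also have "\<dots> = (fst p)\<^sup>2 + (fst q)\<^sup>2
      - 2 * fst p * fst q * (1 - 2 * (sin ((\<alpha> - \<beta>) / 2))\<^sup>2) + (snd p - snd q)\<^sup>2"
    by (simp add: c)
  also have "\<dots> = (norm (p - q))\<^sup>2 + 4 * fst p * fst q * (sin ((\<alpha> - \<beta>) / 2))\<^sup>2"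
  proof -
    have "(norm (p - q))\<^sup>2 = (fst p - fst q)\<^sup>2 + (snd p - snd q)\<^sup>2"
      by (simp add: norm_prod_def)
    then show ?thesis by algebra
  qed
  finally show ?thesis .
qed

lemma norm_spin_diff_upper:
  assumes "\<bar>fst p\<bar> \<le> B" "\<bar>fst q\<bar> \<le> B"
  shows "norm (spin p \<alpha> - spin q \<beta>) \<le> norm (p - q) + B * \<bar>\<alpha> - \<beta>\<bar>"
proof (rule power2_le_imp_le)
  have B: "0 \<le> B" using assms by linarith
  have "fst p * fst q \<le> B * B"
    using mult_mono[OF assms(1,2)] B by (simp flip: abs_mult)
  then have "fst p * fst q * (sin ((\<alpha> - \<beta>) / 2))\<^sup>2 \<le> B * B * (sin ((\<alpha> - \<beta>) / 2))\<^sup>2"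
    by (rule mult_right_mono) simp
  also have "\<dots> \<le> B * B * ((\<alpha> - \<beta>) / 2)\<^sup>2"
    using abs_sin_x_le_abs_x[of "(\<alpha> - \<beta>) / 2"] by (intro mult_left_mono) (auto simp flip: abs_le_square_iff)
  finally have "(norm (spin p \<alpha> - spin q \<beta>))\<^sup>2 \<le> (norm (p - q))\<^sup>2 + (B * \<bar>\<alpha> - \<beta>\<bar>)\<^sup>2"
    unfolding norm_spin_diff by (simp add: power_mult_distrib power_divide field_simps power2_eq_square)
  also have "\<dots> \<le> (norm (p - q) + B * \<bar>\<alpha> - \<beta>\<bar>)\<^sup>2"
    using B by (simp add: power2_sum)
  finally show "(norm (spin p \<alpha> - spin q \<beta>))\<^sup>2 \<le> (norm (p - q) + B * \<bar>\<alpha> - \<beta>\<bar>)\<^sup>2" .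
  show "0 \<le> norm (p - q) + B * \<bar>\<alpha> - \<beta>\<bar>" using B by simp
qed

text \<open>Concavity of the sine on a quarter period.\<close>

lemma sin_ge_linear:
  assumes "0 \<le> d" "d \<le> 1/2" shows "2 * d \<le> sin (pi * d)"
proof -
  have "convex_on {0..pi/2} (\<lambda>x. - sin x :: real)"
    by (rule f''_ge0_imp_convex[where f' = "\<lambda>x. - cos x" and f'' = sin])
       (auto intro!: derivative_eq_intros sin_ge_zero)
  from convex_onD[OF this, of "2 * d" 0 "pi/2"] show ?thesis
    using assms by (simp add: algebra_simps)
qed

lemma norm_spin_diff_lower:
  assumes r: "\<rho> \<le> fst p" "\<rho> \<le> fst q" "0 \<le> \<rho>"
  shows "norm (p - q) \<le> norm (spin p \<alpha> - spin q \<beta>)"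
    and "\<bar>\<alpha> - \<beta>\<bar> \<le> pi \<Longrightarrow> 2 * \<rho> / pi * \<bar>\<alpha> - \<beta>\<bar> \<le> norm (spin p \<alpha> - spin q \<beta>)"
proof -
  have pq: "0 \<le> fst p" "0 \<le> fst q" "\<rho> * \<rho> \<le> fst p * fst q"
    using r by (auto intro: mult_mono)
  show "norm (p - q) \<le> norm (spin p \<alpha> - spin q \<beta>)"
    by (rule power2_le_imp_le) (use pq in \<open>auto simp: norm_spin_diff\<close>)
  assume le: "\<bar>\<alpha> - \<beta>\<bar> \<le> pi"
  let ?d = "\<bar>\<alpha> - \<beta>\<bar> / (2 * pi)"
  have "2 * ?d \<le> sin (pi * ?d)"
    by (rule sin_ge_linear) (use le in \<open>auto simp: field_simps\<close>)
  also have "pi * ?d = \<bar>(\<alpha> - \<beta>) / 2\<bar>" by simp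
  also have "sin \<bar>(\<alpha> - \<beta>) / 2\<bar> \<le> \<bar>sin ((\<alpha> - \<beta>) / 2)\<bar>"
    by (metis abs_ge_self abs_minus_cancel abs_if sin_minus)
  finally have s: "\<bar>\<alpha> - \<beta>\<bar> / pi \<le> \<bar>sin ((\<alpha> - \<beta>) / 2)\<bar>" by simp
  show "2 * \<rho> / pi * \<bar>\<alpha> - \<beta>\<bar> \<le> norm (spin p \<alpha> - spin q \<beta>)"
  proof (rule power2_le_imp_le)
    have "(2 * \<rho> / pi * \<bar>\<alpha> - \<beta>\<bar>)\<^sup>2 = 4 * (\<rho> * \<rho>) * (\<bar>\<alpha> - \<beta>\<bar> / pi)\<^sup>2"
      by (simp add: power2_eq_square)
    also have "\<dots> \<le> 4 * (fst p * fst q) * (sin ((\<alpha> - \<beta>) / 2))\<^sup>2"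
      using power_mono[OF s, of 2] pq by (intro mult_mono mult_left_mono) (auto simp: r)
    also have "\<dots> \<le> (norm (spin p \<alpha> - spin q \<beta>))\<^sup>2"
      by (simp add: norm_spin_diff)
    finally show "(2 * \<rho> / pi * \<bar>\<alpha> - \<beta>\<bar>)\<^sup>2 \<le> (norm (spin p \<alpha> - spin q \<beta>))\<^sup>2" .
  qed simp
qed


text \<open>Whether two points \<open>(k, u)\<close> and \<open>(l, v)\<close> satisfy the hypothesis of \<open>linear_homotopy_isotopic\<close> is
  decided by their angular distance \<open>e\<close> (as a fraction of a turn), which bounds their distance in
  space from below by \<open>4 \<rho> e\<close>. On one strand the difference of the displacements is at most
  proportional to \<open>e\<close>. On different strands it is bounded, and the distance is bounded from below: by
  the separation \<open>\<delta>\<close> if \<open>e\<close> is small, and by \<open>4 \<rho> e\<close> otherwise.\<close>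

lemma linear_homotopy_path_closure:
  fixes p q :: "'k \<Rightarrow> real \<Rightarrow> real \<times> real"
  assumes f: "\<And>k. k \<in> S \<Longrightarrow> f k \<in> S"
    and cp: "\<And>k. k \<in> S \<Longrightarrow> p k 1 = p (f k) 0" and cq: "\<And>k. k \<in> S \<Longrightarrow> q k 1 = q (f k) 0"
    and L: "0 \<le> L"
    and Lp: "\<And>k u v. k \<in> S \<Longrightarrow> u \<in> {0..1} \<Longrightarrow> v \<in> {0..1} \<Longrightarrow> norm (p k u - p k v) \<le> L * \<bar>u - v\<bar>"
    and Lq: "\<And>k u v. k \<in> S \<Longrightarrow> u \<in> {0..1} \<Longrightarrow> v \<in> {0..1} \<Longrightarrow> norm (q k u - q k v) \<le> L * \<bar>u - v\<bar>"
    and \<rho>: "0 < \<rho>" "\<And>k u. k \<in> S \<Longrightarrow> u \<in> {0..1} \<Longrightarrow> \<rho> \<le> fst (p k u)"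
      "\<And>k u. k \<in> S \<Longrightarrow> u \<in> {0..1} \<Longrightarrow> \<rho> \<le> fst (q k u)"
    and B: "0 \<le> B" "\<And>k u. k \<in> S \<Longrightarrow> u \<in> {0..1} \<Longrightarrow> norm (q k u - p k u) \<le> B"
    and \<delta>: "0 < \<delta>" "\<And>k l u t. k \<in> S \<Longrightarrow> l \<in> S \<Longrightarrow> k \<noteq> l \<Longrightarrow> u \<in> {0..1} \<Longrightarrow> t \<in> {0..1} \<Longrightarrow>
      \<delta> \<le> norm ((p k u + t *\<^sub>R (q k u - p k u)) - (p l u + t *\<^sub>R (q l u - p l u)))"
  shows "ambient_isotopic (path_closure S p) (path_closure S q)"
proof -
  define D where "D k u = q k u - p k u" for k u
  define I where "I t k u = p k u + t *\<^sub>R D k u" for t k u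
  have I_alt: "I t k u = (1 - t) *\<^sub>R p k u + t *\<^sub>R q k u" for t k u
    by (simp add: I_def D_def algebra_simps)
  have DL: "norm (D k u - D k v) \<le> 2 * L * \<bar>u - v\<bar>"
    if "k \<in> S" "u \<in> {0..1}" "v \<in> {0..1}" for k u v
  proof -
    have "D k u - D k v = (q k u - q k v) - (p k u - p k v)" by (simp add: D_def)
    then have "norm (D k u - D k v) \<le> norm (q k u - q k v) + norm (p k u - p k v)"
      by (metis norm_triangle_ineq4)
    then show ?thesis using Lp[OF that] Lq[OF that] by linarith
  qed
  have IL: "norm (I t k u - I t k v) \<le> L * \<bar>u - v\<bar>"
    if k: "k \<in> S" "u \<in> {0..1}" "v \<in> {0..1}" and t: "t \<in> {0..1}" for t k u v
  proof -
    have "I t k u - I t k v = (1 - t) *\<^sub>R (p k u - p k v) + t *\<^sub>R (q k u - q k v)"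
      by (simp add: I_alt algebra_simps)
    also have "norm \<dots> \<le> (1 - t) * norm (p k u - p k v) + t * norm (q k u - q k v)"
      using t by (intro order_trans[OF norm_triangle_ineq]) auto
    also have "\<dots> \<le> (1 - t) * (L * \<bar>u - v\<bar>) + t * (L * \<bar>u - v\<bar>)"
      using t Lp[OF k] Lq[OF k] by (intro add_mono mult_left_mono) auto
    finally show ?thesis by (simp add: algebra_simps)
  qed
  have I\<rho>: "\<rho> \<le> fst (I t k u)" if k: "k \<in> S" "u \<in> {0..1}" and t: "t \<in> {0..1}" for t k u
  proof -
    have "(1 - t) * \<rho> + t * \<rho> \<le> (1 - t) * fst (p k u) + t * fst (q k u)"
      using t \<rho>(2,3)[OF k] by (intro add_mono mult_left_mono) auto
    then show ?thesis by (simp add: I_alt algebra_simps)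
  qed
  have DB: "\<bar>fst (D k u)\<bar> \<le> B" "norm (D k u) \<le> B" if "k \<in> S" "u \<in> {0..1}" for k u
  proof -
    show "norm (D k u) \<le> B" using B(2)[OF that] by (simp add: D_def)
    then show "\<bar>fst (D k u)\<bar> \<le> B"
      using norm_fst_le[of "fst (D k u)" "snd (D k u)"] by simp
  qed
  have cD: "D k 1 = D (f k) 0" and cI: "I t k 1 = I t (f k) 0" if "k \<in> S" for t k
    using that by (simp_all add: D_def I_def cp cq)
  have Isep: "\<delta> \<le> norm (I t k u - I t l u)"
    if "k \<in> S" "l \<in> S" "k \<noteq> l" "u \<in> {0..1}" "t \<in> {0..1}" for k l u t
    using \<delta>(2)[OF that] by (simp add: I_def D_def)
  \<comment> \<open>\<open>\<eta>\<close> is the least possible value of \<open>max (4 \<rho> e) (\<delta> - L e)\<close>.\<close>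
  define \<eta> where "\<eta> = 4 * \<rho> * \<delta> / (L + 4 * \<rho>)"
  have \<eta>: "0 < \<eta>" using L \<rho>(1) \<delta>(1) by (simp add: \<eta>_def)
  define C1 where "C1 = (2 * L + 2 * pi * B) / (4 * \<rho>)"
  define C2 where "C2 = (2 * B + pi * B) / \<eta>"
  define C where "C = max C1 C2"
  \<comment> \<open>Two points on one strand, or on two different strands, at distance \<open>e\<close> of a turn.\<close>
  have near: "norm (spin (D k u) \<alpha> - spin (D l v) \<beta>) \<le> C * norm (spin (I t k u) \<alpha> - spin (I t l v) \<beta>)"
    if k: "k \<in> S" "l \<in> S" "u \<in> {0..1}" "v \<in> {0..1}" "t \<in> {0..1}"
      and e: "\<bar>\<alpha> - \<beta>\<bar> = 2 * pi * e" "e \<le> 1/2" and d: "norm (D k u - D l v) \<le> 2 * L * e"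
    for k l u v t \<alpha> \<beta> e
  proof -
    let ?N = "norm (spin (I t k u) \<alpha> - spin (I t l v) \<beta>)"
    have "norm (spin (D k u) \<alpha> - spin (D l v) \<beta>) \<le> norm (D k u - D l v) + B * \<bar>\<alpha> - \<beta>\<bar>"
      by (rule norm_spin_diff_upper) (use DB k in auto)
    also have "\<dots> \<le> C1 * (4 * \<rho> * e)"
    proof -
      have "C1 * (4 * \<rho> * e) = 2 * L * e + B * (2 * pi * e)"
        using \<rho>(1) by (simp add: C1_def field_simps)
      then show ?thesis using d by (simp add: e)
    qed
    also have "\<dots> \<le> C1 * ?N"
    proof (rule mult_left_mono)
      have "2 * \<rho> / pi * \<bar>\<alpha> - \<beta>\<bar> \<le> ?N"
        by (rule norm_spin_diff_lower(2)) (use I\<rho> k \<rho>(1) e in auto)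
      then show "4 * \<rho> * e \<le> ?N" by (simp add: e)
      show "0 \<le> C1" using L B(1) \<rho>(1) by (simp add: C1_def)
    qed
    also have "\<dots> \<le> C * ?N" by (rule mult_right_mono) (auto simp: C_def)
    finally show ?thesis .
  qed
  have far: "norm (spin (D k u) \<alpha> - spin (D l v) \<beta>) \<le> C * norm (spin (I t k u) \<alpha> - spin (I t l v) \<beta>)"
    if k: "k \<in> S" "l \<in> S" "u \<in> {0..1}" "v \<in> {0..1}" "t \<in> {0..1}"
      and e: "\<bar>\<alpha> - \<beta>\<bar> = 2 * pi * e" "e \<le> 1/2" and d: "\<delta> - L * e \<le> norm (I t k u - I t l v)"
    for k l u v t \<alpha> \<beta> e
  proof -
    let ?N = "norm (spin (I t k u) \<alpha> - spin (I t l v) \<beta>)"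
    have 1: "\<delta> - L * e \<le> ?N"
      using d norm_spin_diff_lower(1)[of \<rho> "I t k u" "I t l v" \<alpha> \<beta>] I\<rho> k \<rho>(1) by force
    have "2 * \<rho> / pi * \<bar>\<alpha> - \<beta>\<bar> \<le> ?N"
      by (rule norm_spin_diff_lower(2)) (use I\<rho> k \<rho>(1) e in auto)
    then have 2: "4 * \<rho> * e \<le> ?N" by (simp add: e)
    have "4 * \<rho> * (\<delta> - L * e) + L * (4 * \<rho> * e) \<le> 4 * \<rho> * ?N + L * ?N"
      using 1 2 L \<rho>(1) by (intro add_mono mult_left_mono) auto
    then have N: "\<eta> \<le> ?N" using L \<rho>(1) by (simp add: \<eta>_def field_simps)
    have "norm (spin (D k u) \<alpha> - spin (D l v) \<beta>) \<le> norm (D k u - D l v) + B * \<bar>\<alpha> - \<beta>\<bar>"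
      by (rule norm_spin_diff_upper) (use DB k in auto)
    also have "\<dots> \<le> (B + B) + B * pi"
    proof (intro add_mono mult_left_mono)
      show "norm (D k u - D l v) \<le> B + B"
        using norm_triangle_ineq4[of "D k u" "D l v"] DB(2)[of k u] DB(2)[of l v] k by linarith
      show "\<bar>\<alpha> - \<beta>\<bar> \<le> pi" using e by simp
    qed (use B in auto)
    also have "\<dots> = C2 * \<eta>" using \<eta> by (simp add: C2_def)
    also have "\<dots> \<le> C2 * ?N"
      using N B(1) \<eta> by (intro mult_left_mono) (auto simp: C2_def)
    also have "\<dots> \<le> C * ?N" by (rule mult_right_mono) (auto simp: C_def)
    finally show ?thesis .
  qed
  have half: "norm (spin (D k u) (2 * pi * u) - spin (D l v) (2 * pi * v))
      \<le> C * norm (spin (I t k u) (2 * pi * u) - spin (I t l v) (2 * pi * v))"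
    if k: "k \<in> S" "l \<in> S" "u \<in> {0..1}" "v \<in> {0..1}" "t \<in> {0..1}" and vu: "v \<le> u" for k l u v t
  proof (cases "u - v \<le> 1/2")
    case True
    have e: "\<bar>2 * pi * u - 2 * pi * v\<bar> = 2 * pi * (u - v)"
      using vu by (simp add: abs_mult flip: right_diff_distrib)
    show ?thesis
    proof (cases "k = l")
      case True
      then show ?thesis using near[OF k e \<open>u - v \<le> 1/2\<close>] DL[of k u v] k vu by simp
    next
      case False
      have "norm (I t k u - I t l u) \<le> norm (I t k u - I t l v) + norm (I t l u - I t l v)"
        by (metis norm_triangle_ineq4 norm_minus_commute diff_diff_eq2 diff_add_cancel diff_right_commute dist_norm dist_triangle2)
      then have "\<delta> - L * (u - v) \<le> norm (I t k u - I t l v)"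
        using Isep[OF k(1,2) False k(3,5)] IL[OF k(2,3,4,5)] vu by simp
      then show ?thesis by (rule far[OF k e True])
    qed
  next
    case False
    \<comment> \<open>The short way between the two points crosses the half-plane \<open>\<theta> = 0\<close>.\<close>
    let ?\<beta> = "2 * pi * v + 2 * pi"
    have e: "\<bar>2 * pi * u - ?\<beta>\<bar> = 2 * pi * (1 - u + v)" "1 - u + v \<le> 1/2"
    proof -
      have "2 * pi * u - ?\<beta> = - (2 * pi * (1 - u + v))" by (simp add: algebra_simps)
      then show "\<bar>2 * pi * u - ?\<beta>\<bar> = 2 * pi * (1 - u + v)"
        using k by (simp add: abs_mult)
    qed (use False in simp)
    have one: "(1::real) \<in> {0..1}" "(0::real) \<in> {0..1}" by auto
    note fk = f[OF k(1)]
    have "norm (spin (D k u) (2 * pi * u) - spin (D l v) ?\<beta>)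
      \<le> C * norm (spin (I t k u) (2 * pi * u) - spin (I t l v) ?\<beta>)"
    proof (cases "l = f k")
      case True
      have "norm (D k u - D l v) \<le> norm (D k u - D k 1) + norm (D l 0 - D l v)"
        using norm_triangle_ineq[of "D k u - D k 1" "D l 0 - D l v"] cD[OF k(1)] True by simp
      also have "\<dots> \<le> 2 * L * (1 - u) + 2 * L * v"
        using DL[OF k(1,3) one(1)] DL[OF k(2) one(2) k(4)] k by simp
      finally have "norm (D k u - D l v) \<le> 2 * L * (1 - u + v)" by (simp add: algebra_simps)
      then show ?thesis by (rule near[OF k e])
    next
      case False
      have eq: "I t k 1 - I t l 0 = (I t k u - I t l v) - (I t k u - I t k 1) - (I t l 0 - I t l v)"
        by simp
      have "norm (I t k 1 - I t l 0)
          \<le> norm (I t k u - I t l v) + norm (I t k u - I t k 1) + norm (I t l 0 - I t l v)"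
        unfolding eq by (meson norm_triangle_ineq4 order_trans add_right_mono)
      moreover have "\<delta> \<le> norm (I t k 1 - I t l 0)"
        using Isep[OF fk k(2) _ one(2) k(5)] False cI[OF k(1)] by auto
      moreover have "norm (I t k u - I t k 1) \<le> L * (1 - u)" "norm (I t l 0 - I t l v) \<le> L * v"
        using IL[OF k(1,3) one(1) k(5)] IL[OF k(2) one(2) k(4,5)] k by simp_all
      ultimately have "\<delta> - L * (1 - u + v) \<le> norm (I t k u - I t l v)"
        by (simp add: algebra_simps)
      then show ?thesis by (rule far[OF k e])
    qed
    then show ?thesis by (simp only: spin_period)
  qed
  have full: "norm (spin (D k u) (2 * pi * u) - spin (D l v) (2 * pi * v))
      \<le> C * norm (spin (I t k u) (2 * pi * u) - spin (I t l v) (2 * pi * v))"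
    if k: "k \<in> S" "l \<in> S" "u \<in> {0..1}" "v \<in> {0..1}" "t \<in> {0..1}" for k l u v t
  proof (cases "v \<le> u")
    case True then show ?thesis by (rule half[OF k])
  next
    case False
    then show ?thesis using half[OF k(2,1,4,3,5)] by (simp add: norm_minus_commute)
  qed
  show ?thesis
    unfolding path_closure_image
  proof (rule linear_homotopy_isotopic)
    fix x y :: "'k \<times> real" and t :: real
    assume x: "x \<in> S \<times> {0..1}" and y: "y \<in> S \<times> {0..1}" and t: "0 \<le> t" "t \<le> 1"
    obtain k u l v where xy: "x = (k, u)" "y = (l, v)" by fastforce
    have s: "spin (I t k u) \<theta> = spin (p k u) \<theta> + t *\<^sub>R (spin (q k u) \<theta> - spin (p k u) \<theta>)" for k u \<theta>
      by (simp add: I_def D_def spin_add spin_scale spin_diff)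
    show "norm ((case x of (k, u) \<Rightarrow> spin (q k u) (2 * pi * u)) - (case x of (k, u) \<Rightarrow> spin (p k u) (2 * pi * u))
        - ((case y of (k, u) \<Rightarrow> spin (q k u) (2 * pi * u)) - (case y of (k, u) \<Rightarrow> spin (p k u) (2 * pi * u))))
      \<le> C * norm ((case x of (k, u) \<Rightarrow> spin (p k u) (2 * pi * u))
          + t *\<^sub>R ((case x of (k, u) \<Rightarrow> spin (q k u) (2 * pi * u)) - (case x of (k, u) \<Rightarrow> spin (p k u) (2 * pi * u)))
          - ((case y of (k, u) \<Rightarrow> spin (p k u) (2 * pi * u))
          + t *\<^sub>R ((case y of (k, u) \<Rightarrow> spin (q k u) (2 * pi * u)) - (case y of (k, u) \<Rightarrow> spin (p k u) (2 * pi * u)))))"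
      using full[of k l u v t] x y t by (simp add: xy s) (simp add: D_def spin_diff)
  qed
qed

lemma finite_uniform_positive:
  fixes g :: "'a \<Rightarrow> 'b \<Rightarrow> real"
  assumes "finite P" "\<And>x. x \<in> P \<Longrightarrow> \<exists>e>0. \<forall>y\<in>Y. e \<le> g x y"
  shows "\<exists>e>0. \<forall>x\<in>P. \<forall>y\<in>Y. e \<le> g x y"
proof -
  obtain e where e: "\<And>x. x \<in> P \<Longrightarrow> 0 < e x \<and> (\<forall>y\<in>Y. e x \<le> g x y)" using assms(2) by metis
  let ?m = "Min (insert 1 (e ` P))"
  have "0 < ?m" using assms(1) e by auto
  moreover have "?m \<le> g x y" if "x \<in> P" "y \<in> Y" for x y
  proof -
    have "?m \<le> e x" using assms(1) that by (intro Min_le) auto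
    then show ?thesis using e[OF that(1)] that(2) by force
  qed
  ultimately show ?thesis by blast
qed

lemma compact_positive_bound:
  fixes g :: "'a::topological_space \<Rightarrow> real"
  assumes "compact Y" "continuous_on Y g" "\<And>y. y \<in> Y \<Longrightarrow> 0 < g y"
  shows "\<exists>e>0. \<forall>y\<in>Y. e \<le> g y"
proof (cases "Y = {}")
  case True then show ?thesis by (auto intro: exI[of _ 1])
next
  case False
  from continuous_attains_inf[OF assms(1) this assms(2)] show ?thesis using assms(3) by blast
qed

text \<open>By compactness the strands keep a positive distance \<open>\<delta>\<close> from each other and from the axis during the
  whole homotopy. Between two times at which all strands differ by at most \<open>\<delta>/4\<close>, the homotopy can be
  replaced by the straight-line one, which still keeps them \<open>\<delta>/2\<close> apart.\<close>

lemma homotopy_path_closure: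
  fixes F :: "real \<Rightarrow> 'k \<Rightarrow> real \<Rightarrow> real \<times> real"
  assumes fin: "finite S" and f: "\<And>k. k \<in> S \<Longrightarrow> f k \<in> S"
    and cl: "\<And>s k. s \<in> {0..1} \<Longrightarrow> k \<in> S \<Longrightarrow> F s k 1 = F s (f k) 0"
    and lip: "\<And>k. k \<in> S \<Longrightarrow> \<exists>L. L-lipschitz_on ({0..1} \<times> {0..1}) (\<lambda>p. F (fst p) k (snd p))"
    and pos: "\<And>s k u. s \<in> {0..1} \<Longrightarrow> k \<in> S \<Longrightarrow> u \<in> {0..1} \<Longrightarrow> 0 < fst (F s k u)"
    and inj: "\<And>s k l u. s \<in> {0..1} \<Longrightarrow> k \<in> S \<Longrightarrow> l \<in> S \<Longrightarrow> k \<noteq> l \<Longrightarrow> u \<in> {0..1} \<Longrightarrow> F s k u \<noteq> F s l u"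
  shows "ambient_isotopic (path_closure S (F 0)) (path_closure S (F 1))"
proof -
  let ?Y = "{0..1} \<times> {0..1} :: (real \<times> real) set"
  have Y: "compact ?Y" by (intro compact_Times) auto
  obtain Lk where Lk: "\<And>k. k \<in> S \<Longrightarrow> (Lk k)-lipschitz_on ?Y (\<lambda>p. F (fst p) k (snd p))"
    using lip by metis
  have cont: "continuous_on ?Y (\<lambda>p. F (fst p) k (snd p))" if "k \<in> S" for k
    by (rule lipschitz_on_continuous_on[OF Lk[OF that]])
  define L where "L = sum Lk S"
  have Lk0: "0 \<le> Lk k" if "k \<in> S" for k using lipschitz_on_nonneg[OF Lk[OF that]] .
  then have L: "0 \<le> L" by (auto simp: L_def intro: sum_nonneg)
  have FL: "norm (F s k u - F s' k u') \<le> L * (\<bar>s - s'\<bar> + \<bar>u - u'\<bar>)"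
    if "k \<in> S" "s \<in> {0..1}" "s' \<in> {0..1}" "u \<in> {0..1}" "u' \<in> {0..1}" for k s s' u u'
  proof -
    have "norm (F s k u - F s' k u') \<le> Lk k * dist (s, u) (s', u')"
      using lipschitz_onD[OF Lk[OF that(1)], of "(s, u)" "(s', u')"] that by (simp add: dist_norm)
    also have "\<dots> \<le> L * (\<bar>s - s'\<bar> + \<bar>u - u'\<bar>)"
    proof (rule mult_mono)
      show "Lk k \<le> L" unfolding L_def by (rule member_le_sum) (use that fin Lk0 in auto)
      show "dist (s, u) (s', u') \<le> \<bar>s - s'\<bar> + \<bar>u - u'\<bar>"
        using norm_Pair_le[of "s - s'" "u - u'"] by (simp add: dist_norm)
    qed (use L in auto)
    finally show ?thesis .
  qed
  obtain \<rho> where \<rho>: "0 < \<rho>" "\<And>k y. k \<in> S \<Longrightarrow> y \<in> ?Y \<Longrightarrow> \<rho> \<le> fst (F (fst y) k (snd y))"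
  proof -
    have "\<exists>e>0. \<forall>k\<in>S. \<forall>y\<in>?Y. e \<le> fst (F (fst y) k (snd y))"
      by (intro finite_uniform_positive[OF fin] compact_positive_bound[OF Y] continuous_intros cont pos)
        auto
    then show ?thesis using that by blast
  qed
  obtain \<delta> where \<delta>: "0 < \<delta>" "\<And>k l y. k \<in> S \<Longrightarrow> l \<in> S \<Longrightarrow> k \<noteq> l \<Longrightarrow> y \<in> ?Y \<Longrightarrow>
      \<delta> \<le> norm (F (fst y) k (snd y) - F (fst y) l (snd y))"
  proof -
    let ?P = "{x \<in> S \<times> S. fst x \<noteq> snd x}"
    have "\<exists>e>0. \<forall>x\<in>?P. \<forall>y\<in>?Y. e \<le> norm (F (fst y) (fst x) (snd y) - F (fst y) (snd x) (snd y))"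
    proof (rule finite_uniform_positive)
      show "finite ?P" using fin by auto
      fix x assume "x \<in> ?P"
      then have x: "fst x \<in> S" "snd x \<in> S" "fst x \<noteq> snd x" by auto
      show "\<exists>e>0. \<forall>y\<in>?Y. e \<le> norm (F (fst y) (fst x) (snd y) - F (fst y) (snd x) (snd y))"
        by (intro compact_positive_bound[OF Y] continuous_intros cont x)
           (use inj[OF _ x(1,2,3)] in auto)
    qed
    then show ?thesis using that by force
  qed
  obtain N :: nat where N: "4 * L / \<delta> + 1 < real N" using reals_Archimedean2 by blast
  then have N0: "0 < real N" using L \<delta>(1) by (smt (verit) divide_nonneg_pos)
  have NL: "L / N \<le> \<delta> / 4"
  proof -
    have "4 * L / \<delta> < real N" using N by linarith
    then show ?thesis using N0 \<delta>(1) by (simp add: field_simps)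
  qed
  have step: "ambient_isotopic (path_closure S (F (i / N))) (path_closure S (F (Suc i / N)))"
    if i: "i < N" for i
  proof -
    let ?s = "real i / N" and ?s' = "real (Suc i) / N"
    have s: "?s \<in> {0..1}" "?s' \<in> {0..1}" "\<bar>?s' - ?s\<bar> = 1 / N"
      using i N0 by (auto simp: field_simps)
    have close: "norm (F ?s' k u - F ?s k u) \<le> L / N" if "k \<in> S" "u \<in> {0..1}" for k u
      using FL[OF that(1) s(2,1) that(2,2)] s(3) by simp
    show ?thesis
    proof (rule linear_homotopy_path_closure[where f = f and L = L and \<rho> = \<rho> and B = "L / N" and \<delta> = "\<delta> / 2"])
      fix k l and u t :: real
      assume k: "k \<in> S" "l \<in> S" "k \<noteq> l" "u \<in> {0..1}" "t \<in> {0..1}"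
      let ?a = "F ?s' k u - F ?s k u" and ?b = "F ?s' l u - F ?s l u"
      have "norm (t *\<^sub>R (?a - ?b)) \<le> norm (?a - ?b)"
        using k(5) by (simp add: mult_left_le_one_le)
      also have "\<dots> \<le> L / N + L / N"
        using norm_triangle_ineq4[of ?a ?b] close[of k u] close[of l u] k by linarith
      also have "\<dots> \<le> \<delta> / 2" using NL by linarith
      finally have "norm (t *\<^sub>R (?a - ?b)) \<le> \<delta> / 2" .
      moreover have "\<delta> \<le> norm (F ?s k u - F ?s l u)"
        using \<delta>(2)[OF k(1-3), of "(?s, u)"] s k by simp
      moreover have eq: "F ?s k u + t *\<^sub>R ?a - (F ?s l u + t *\<^sub>R ?b)
          = (F ?s k u - F ?s l u) + t *\<^sub>R (?a - ?b)"
        by (simp add: algebra_simps)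
      ultimately show "\<delta> / 2 \<le> norm (F ?s k u + t *\<^sub>R ?a - (F ?s l u + t *\<^sub>R ?b))"
        unfolding eq using norm_diff_ineq[of "F ?s k u - F ?s l u" "t *\<^sub>R (?a - ?b)"] by linarith
    next
      fix k u v assume k: "k \<in> S" "u \<in> {0..1::real}" "v \<in> {0..1::real}"
      show "norm (F ?s k u - F ?s k v) \<le> L * \<bar>u - v\<bar>"
        using FL[OF k(1) s(1,1) k(2,3)] by simp
      show "norm (F ?s' k u - F ?s' k v) \<le> L * \<bar>u - v\<bar>"
        using FL[OF k(1) s(2,2) k(2,3)] by simp
    next
      fix k u assume k: "k \<in> S" "u \<in> {0..1::real}"
      show "\<rho> \<le> fst (F ?s k u)" using \<rho>(2)[of k "(?s, u)"] k s by simp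
      show "\<rho> \<le> fst (F ?s' k u)" using \<rho>(2)[of k "(?s', u)"] k s by simp
    qed (use f cl s L \<rho> \<delta> N0 close in auto)
  qed
  have "ambient_isotopic (path_closure S (F 0)) (path_closure S (F (i / N)))" if "i \<le> N" for i :: nat
    using that
    by (induction i)
       (simp add: ambient_isotopic_refl, meson Suc_leD Suc_le_lessD ambient_isotopic_trans step)
  from this[of N] show ?thesis using N0 by simp
qed

section \<open>Lipschitz functions without their constants\<close>

definition is_lipschitz_on :: "'a::metric_space set \<Rightarrow> ('a \<Rightarrow> 'b::metric_space) \<Rightarrow> bool" where
  "is_lipschitz_on A f \<longleftrightarrow> (\<exists>L. L-lipschitz_on A f)"

text \<open>Homotopies below are built from polynomials, trigonometric functions, maxima and minima; the
  following rules establish their Lipschitz property syntactically.\<close>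

named_theorems is_lip_intros

lemma is_lipschitz_on_const [is_lip_intros]: "is_lipschitz_on A (\<lambda>x. c)"
  unfolding is_lipschitz_on_def by (blast intro: lipschitz_on_constant)

lemma is_lipschitz_on_id [is_lip_intros]: "is_lipschitz_on A (\<lambda>x. x)"
  unfolding is_lipschitz_on_def by (blast intro: lipschitz_on_id)

lemma is_lipschitz_on_1I:
  "(\<And>x y. x \<in> A \<Longrightarrow> y \<in> A \<Longrightarrow> dist (f x) (f y) \<le> dist x y) \<Longrightarrow> is_lipschitz_on A f"
  unfolding is_lipschitz_on_def by (rule exI[of _ 1]) (auto simp: lipschitz_on_def)

lemma is_lipschitz_on_fst [is_lip_intros]: "is_lipschitz_on A fst"
  by (rule is_lipschitz_on_1I) (rule dist_fst_le)

lemma is_lipschitz_on_snd [is_lip_intros]: "is_lipschitz_on A snd"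
  by (rule is_lipschitz_on_1I) (rule dist_snd_le)

lemma is_lipschitz_on_compose:
  "is_lipschitz_on B g \<Longrightarrow> is_lipschitz_on A f \<Longrightarrow> f ` A \<subseteq> B \<Longrightarrow> is_lipschitz_on A (\<lambda>x. g (f x))"
  unfolding is_lipschitz_on_def
  by (metis lipschitz_on_compose2 lipschitz_on_subset)

lemma is_lipschitz_on_compose_UNIV:
  "is_lipschitz_on UNIV g \<Longrightarrow> is_lipschitz_on A f \<Longrightarrow> is_lipschitz_on A (\<lambda>x. g (f x))"
  by (rule is_lipschitz_on_compose) auto

lemma is_lipschitz_on_add [is_lip_intros]:
  fixes f g :: "_ \<Rightarrow> _::real_normed_vector"
  shows "is_lipschitz_on A f \<Longrightarrow> is_lipschitz_on A g \<Longrightarrow> is_lipschitz_on A (\<lambda>x. f x + g x)"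
  unfolding is_lipschitz_on_def by (blast intro: lipschitz_on_add)

lemma is_lipschitz_on_diff [is_lip_intros]:
  fixes f g :: "_ \<Rightarrow> _::real_normed_vector"
  shows "is_lipschitz_on A f \<Longrightarrow> is_lipschitz_on A g \<Longrightarrow> is_lipschitz_on A (\<lambda>x. f x - g x)"
  unfolding is_lipschitz_on_def by (blast intro: lipschitz_on_diff)

lemma is_lipschitz_on_Pair [is_lip_intros]:
  "is_lipschitz_on A f \<Longrightarrow> is_lipschitz_on A g \<Longrightarrow> is_lipschitz_on A (\<lambda>x. (f x, g x))"
  unfolding is_lipschitz_on_def by (blast intro: lipschitz_on_Pair)

lemma is_lipschitz_on_fst' [is_lip_intros]:
  "is_lipschitz_on A f \<Longrightarrow> is_lipschitz_on A (\<lambda>x. fst (f x))"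
  by (rule is_lipschitz_on_compose_UNIV[OF is_lipschitz_on_fst])

lemma is_lipschitz_on_snd' [is_lip_intros]:
  "is_lipschitz_on A f \<Longrightarrow> is_lipschitz_on A (\<lambda>x. snd (f x))"
  by (rule is_lipschitz_on_compose_UNIV[OF is_lipschitz_on_snd])

lemma is_lipschitz_on_scaleR [is_lip_intros]:
  fixes f :: "'a::metric_space \<Rightarrow> real" and g :: "'a \<Rightarrow> 'b::real_normed_vector"
  assumes A: "compact A" and "is_lipschitz_on A f" "is_lipschitz_on A g"
  shows "is_lipschitz_on A (\<lambda>x. f x *\<^sub>R g x)"
proof -
  obtain K M where K: "K-lipschitz_on A f" and M: "M-lipschitz_on A g"
    using assms by (auto simp: is_lipschitz_on_def)
  have KM: "0 \<le> K" "0 \<le> M" using K M lipschitz_on_nonneg by auto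
  have "bounded (f ` A)" "bounded (g ` A)"
    using A K M by (auto intro!: compact_imp_bounded compact_continuous_image lipschitz_on_continuous_on)
  then obtain a b where a: "0 < a" "\<And>x. x \<in> A \<Longrightarrow> \<bar>f x\<bar> \<le> a" and b: "0 < b" "\<And>x. x \<in> A \<Longrightarrow> norm (g x) \<le> b"
    unfolding bounded_pos by auto
  have "(a * M + K * b)-lipschitz_on A (\<lambda>x. f x *\<^sub>R g x)"
  proof (rule lipschitz_onI)
    fix x y assume x: "x \<in> A" "y \<in> A"
    have "f x *\<^sub>R g x - f y *\<^sub>R g y = f x *\<^sub>R (g x - g y) + (f x - f y) *\<^sub>R g y"
      by (simp add: algebra_simps)
    then have "norm (f x *\<^sub>R g x - f y *\<^sub>R g y) \<le> \<bar>f x\<bar> * norm (g x - g y) + \<bar>f x - f y\<bar> * norm (g y)"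
      by (metis norm_scaleR norm_triangle_ineq)
    also have "\<dots> \<le> a * (M * dist x y) + (K * dist x y) * b"
      using a b x KM lipschitz_onD[OF K x] lipschitz_onD[OF M x]
      by (intro add_mono mult_mono) (auto simp: dist_norm)
    finally show "dist (f x *\<^sub>R g x) (f y *\<^sub>R g y) \<le> (a * M + K * b) * dist x y"
      by (simp add: dist_norm algebra_simps)
  qed (use a b KM in auto)
  then show ?thesis by (auto simp: is_lipschitz_on_def)
qed

lemma is_lipschitz_on_mult [is_lip_intros]:
  fixes f g :: "'a::metric_space \<Rightarrow> real"
  assumes "compact A" "is_lipschitz_on A f" "is_lipschitz_on A g"
  shows "is_lipschitz_on A (\<lambda>x. f x * g x)"
  using is_lipschitz_on_scaleR[OF assms] by simp

lemma is_lipschitz_on_cmult [is_lip_intros]: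
  fixes f :: "_ \<Rightarrow> real"
  assumes "is_lipschitz_on A f" shows "is_lipschitz_on A (\<lambda>x. c * f x)"
  using assms lipschitz_on_cmult_real unfolding is_lipschitz_on_def by blast

lemma is_lipschitz_on_cdiv [is_lip_intros]:
  fixes f :: "_ \<Rightarrow> real"
  assumes "is_lipschitz_on A f" shows "is_lipschitz_on A (\<lambda>x. f x / c)"
  using is_lipschitz_on_cmult[OF assms, of "1 / c"] by simp

lemma is_lipschitz_on_uminus [is_lip_intros]:
  fixes f :: "_ \<Rightarrow> real"
  assumes "is_lipschitz_on A f" shows "is_lipschitz_on A (\<lambda>x. - f x)"
  using is_lipschitz_on_cmult[OF assms, of "-1"] by simp

lemma is_lipschitz_on_max [is_lip_intros]:
  fixes f g :: "_ \<Rightarrow> real"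
  assumes "is_lipschitz_on A f" "is_lipschitz_on A g" shows "is_lipschitz_on A (\<lambda>x. max (f x) (g x))"
proof -
  have "is_lipschitz_on UNIV (\<lambda>x::real. \<bar>x\<bar>)"
    by (rule is_lipschitz_on_1I) (auto simp: dist_real_def)
  from is_lipschitz_on_compose_UNIV[OF this is_lipschitz_on_diff[OF assms]]
  have "is_lipschitz_on A (\<lambda>x. (f x + g x + \<bar>f x - g x\<bar>) / 2)"
    by (intro is_lip_intros assms)
  moreover have "(f x + g x + \<bar>f x - g x\<bar>) / 2 = max (f x) (g x)" for x by (simp add: max_def)
  ultimately show ?thesis by simp
qed

lemma is_lipschitz_on_min [is_lip_intros]:
  fixes f g :: "_ \<Rightarrow> real"
  assumes "is_lipschitz_on A f" "is_lipschitz_on A g" shows "is_lipschitz_on A (\<lambda>x. min (f x) (g x))"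
proof -
  have "is_lipschitz_on A (\<lambda>x. - max (- f x) (- g x))"
    by (intro is_lip_intros assms)
  then show ?thesis by (simp add: minus_max_eq_min)
qed

lemma is_lipschitz_on_abs [is_lip_intros]:
  fixes f :: "_ \<Rightarrow> real"
  assumes "is_lipschitz_on A f" shows "is_lipschitz_on A (\<lambda>x. \<bar>f x\<bar>)"
  unfolding abs_real_def using is_lipschitz_on_max[OF assms is_lipschitz_on_uminus[OF assms]]
  by (simp add: max_def abs_real_def[symmetric]) (smt (verit) is_lipschitz_on_def lipschitz_on_cong)

lemma is_lipschitz_on_cos [is_lip_intros]:
  fixes f :: "_ \<Rightarrow> real"
  assumes "is_lipschitz_on A f" shows "is_lipschitz_on A (\<lambda>x. cos (f x))"
proof (rule is_lipschitz_on_compose_UNIV[OF _ assms], rule is_lipschitz_on_1I)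
  fix x y :: real
  have "\<bar>cos x - cos y\<bar> = 2 * \<bar>sin ((x + y) / 2)\<bar> * \<bar>sin ((y - x) / 2)\<bar>"
    by (simp add: cos_diff_cos abs_mult)
  also have "\<dots> \<le> 2 * 1 * \<bar>(y - x) / 2\<bar>"
    by (intro mult_mono abs_sin_x_le_abs_x) auto
  finally show "dist (cos x) (cos y) \<le> dist x y" by (simp add: dist_real_def)
qed

lemma is_lipschitz_on_sin [is_lip_intros]:
  fixes f :: "_ \<Rightarrow> real"
  assumes "is_lipschitz_on A f" shows "is_lipschitz_on A (\<lambda>x. sin (f x))"
  using is_lipschitz_on_cos[OF is_lipschitz_on_diff[OF is_lipschitz_on_const[of _ "pi/2"] assms]]
  by (simp add: cos_diff)

section \<open>Paths of the strands of a word\<close>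

fun letter_perm :: "braid_letter \<Rightarrow> nat \<Rightarrow> nat" where
  "letter_perm a k = (if k = gen_index a then gen_index a + 1
     else if k = gen_index a + 1 then gen_index a else k)"

declare letter_perm.simps [simp del]

definition unit_clamp :: "real \<Rightarrow> real" where
  "unit_clamp t = max 0 (min 1 t)"

lemma unit_clamp_simps [simp]:
  "t \<le> 0 \<Longrightarrow> unit_clamp t = 0" "1 \<le> t \<Longrightarrow> unit_clamp t = 1"
  "0 \<le> t \<Longrightarrow> t \<le> 1 \<Longrightarrow> unit_clamp t = t"
  by (auto simp: unit_clamp_def)

fun word_perm :: "braid_word \<Rightarrow> nat \<Rightarrow> nat" where
  "word_perm [] k = k"
| "word_perm (a # w) k = word_perm w (letter_perm a k)"

text \<open>\<open>word_path w k t\<close> follows one strand through all sectors of \<open>w\<close>, whereas the model of a closed braid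
  lists the sectors separately. Each sector takes one unit of time, and a strand rests before time 0
  and after the last sector. Written as a sum of clamped paths, the concatenation is visibly
  Lipschitz.\<close>

fun word_path :: "braid_word \<Rightarrow> nat \<Rightarrow> real \<Rightarrow> real \<times> real" where
  "word_path [] k t = (real k, 0)"
| "word_path (a # w) k t = strand a k (unit_clamp t)
     + (word_path w (letter_perm a k) (t - 1) - (real (letter_perm a k), 0))"

lemma strand_0 [simp]: "strand a k 0 = (real k, 0)"
  by (auto simp: strand_def Let_def)

lemma strand_1 [simp]: "strand a k 1 = (real (letter_perm a k), 0)"
  by (auto simp: strand_def Let_def letter_perm.simps)

lemma is_lipschitz_on_unit_clamp [is_lip_intros]:
  assumes "is_lipschitz_on A f" shows "is_lipschitz_on A (\<lambda>x. unit_clamp (f x))"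
  unfolding unit_clamp_def by (intro is_lip_intros assms)

lemma is_lipschitz_on_strand [is_lip_intros]:
  assumes f: "is_lipschitz_on A f" shows "is_lipschitz_on A (\<lambda>x. strand a k (f x))"
proof -
  have 1: "is_lipschitz_on A (\<lambda>x. (c - cos (pi * f x) / 2, e * sin (pi * f x) / 2))"
    and 2: "is_lipschitz_on A (\<lambda>x. (c + cos (pi * f x) / 2, - e * sin (pi * f x) / 2))" for c e :: real
    by (intro is_lip_intros f)+
  show ?thesis
    unfolding strand_def Let_def using 1 2
    by (cases "k = gen_index a"; cases "k = gen_index a + 1") (auto intro: is_lip_intros)
qed

lemma is_lipschitz_on_word_path [is_lip_intros]:
  "is_lipschitz_on A f \<Longrightarrow> is_lipschitz_on A (\<lambda>x. word_path w k (f x))"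
proof (induction w arbitrary: k f)
  case (Cons a w)
  have "is_lipschitz_on A (\<lambda>x. word_path w (letter_perm a k) (f x - 1))"
    by (rule Cons.IH) (intro is_lip_intros Cons.prems)
  then show ?case unfolding word_path.simps by (intro is_lip_intros Cons.prems)
qed (simp add: is_lipschitz_on_const)

lemma word_path_start [simp]: "t \<le> 0 \<Longrightarrow> word_path w k t = (real k, 0)"
  by (induction w arbitrary: k t) auto

lemma word_path_end [simp]: "real (length w) \<le> t \<Longrightarrow> word_path w k t = (real (word_perm w k), 0)"
  by (induction w arbitrary: k t) auto

lemma word_path_Cons:
  "t \<le> 1 \<Longrightarrow> word_path (a # w) k t = strand a k (unit_clamp t)"
  "1 \<le> t \<Longrightarrow> word_path (a # w) k t = word_path w (letter_perm a k) (t - 1)"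
  by simp_all

lemma word_path_append:
  "word_path (u @ v) k t = word_path u k t
     + (word_path v (word_perm u k) (t - real (length u)) - (real (word_perm u k), 0))"
proof (induction u arbitrary: k t)
  case (Cons a u)
  have "t - real (length (a # u)) = t - 1 - real (length u)" by simp
  then show ?case by (simp only: append.simps word_path.simps word_perm.simps Cons.IH) simp
qed simp

lemma strand_inj:
  assumes "strand a k t = strand a l t" shows "k = l"
proof -
  have sc: "(sin (pi * t))\<^sup>2 + (cos (pi * t))\<^sup>2 = 1" by simp
  have e: "strand_sign a \<noteq> 0" by (cases a) auto
  have "cos (pi * t) = 1 \<or> cos (pi * t) = -1" if "sin (pi * t) = 0"
    using sc that by (simp add: power2_eq_1_iff)
  then show ?thesis
    using assms e sc
    by (auto simp: strand_def Let_def field_simps split: if_splits)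
qed

lemma strand_fst_range:
  assumes "k = gen_index a \<or> k = gen_index a + 1"
  shows "real (gen_index a) \<le> fst (strand a k t)" "fst (strand a k t) \<le> real (gen_index a) + 1"
proof -
  define c where "c = cos (pi * t)"
  have "- 1 \<le> c" "c \<le> 1" by (simp_all add: c_def)
  then show "real (gen_index a) \<le> fst (strand a k t)" "fst (strand a k t) \<le> real (gen_index a) + 1"
    using assms by (auto simp: strand_def Let_def simp flip: c_def)
qed

lemma strand_other:
  "k \<noteq> gen_index a \<Longrightarrow> k \<noteq> gen_index a + 1 \<Longrightarrow> strand a k t = (real k, 0)"
  by (simp add: strand_def Let_def)

lemma word_path_inj: "word_path w k t = word_path w l t \<Longrightarrow> k = l"
proof (induction w arbitrary: k l t)
  case (Cons a w)
  show ?case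
  proof (cases "t \<le> 1")
    case True
    then show ?thesis using Cons.prems strand_inj by (auto simp only: word_path_Cons)
  next
    case False
    then have "letter_perm a k = letter_perm a l"
      using Cons.prems by (intro Cons.IH[of _ "t - 1"]) (auto simp only: word_path_Cons)
    then show ?thesis by (auto simp: letter_perm.simps split: if_splits)
  qed
qed simp

lemma strand_fst_ge:
  "m \<le> k \<Longrightarrow> m \<le> gen_index a \<Longrightarrow> real m \<le> fst (strand a k t)"
  using strand_fst_range(1)[of k a t] strand_other[of k a t] by fastforce

lemma word_path_fst_ge:
  "m \<le> k \<Longrightarrow> (\<And>a. a \<in> set w \<Longrightarrow> m \<le> gen_index a) \<Longrightarrow> real m \<le> fst (word_path w k t)"
proof (induction w arbitrary: k t)
  case (Cons a w)
  show ?case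
  proof (cases "t \<le> 1")
    case True
    then show ?thesis using Cons.prems strand_fst_ge by (auto simp only: word_path_Cons) simp
  next
    case False
    have "m \<le> letter_perm a k" using Cons.prems by (auto simp: letter_perm.simps)
    then show ?thesis using False Cons.prems Cons.IH[of "letter_perm a k" "t - 1"]
      by (auto simp only: word_path_Cons) simp
  qed
qed simp

lemma letter_perm_in:
  "1 \<le> gen_index a \<Longrightarrow> gen_index a < n \<Longrightarrow> letter_perm a k \<in> {1..n} \<longleftrightarrow> k \<in> {1..n}"
  by (auto simp: letter_perm.simps)

lemma letter_perm_involutive: "letter_perm a (letter_perm a k) = k"
  by (auto simp: letter_perm.simps)

lemma braid_words_Nil [simp]: "[] \<in> braid_words n"
  and braid_words_Cons: "a # w \<in> braid_words n \<longleftrightarrow> 1 \<le> gen_index a \<and> gen_index a < n \<and> w \<in> braid_words n"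
  and braid_words_append: "u @ w \<in> braid_words n \<longleftrightarrow> u \<in> braid_words n \<and> w \<in> braid_words n"
  by (auto simp: braid_words_def)

lemma word_perm_in: "w \<in> braid_words n \<Longrightarrow> word_perm w k \<in> {1..n} \<longleftrightarrow> k \<in> {1..n}"
proof (induction w arbitrary: k)
  case (Cons a w)
  then have a: "1 \<le> gen_index a" "gen_index a < n" and w: "w \<in> braid_words n"
    by (simp_all add: braid_words_Cons)
  show ?case unfolding word_perm.simps Cons.IH[OF w] by (rule letter_perm_in[OF a])
qed simp

lemma word_perm_inj: "word_perm w k = word_perm w l \<Longrightarrow> k = l"
  using word_path_inj[of w k "real (length w)" l] by simp

lemma word_perm_surj: "\<exists>k. word_perm w k = l"
proof (induction w arbitrary: l)
  case (Cons a w)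
  then obtain k where "word_perm w k = l" by blast
  then show ?case by (auto intro!: exI[of _ "letter_perm a k"] simp: letter_perm_involutive)
qed simp

lemma word_path_sector:
  "j < length w \<Longrightarrow> 0 \<le> t \<Longrightarrow> t \<le> 1 \<Longrightarrow>
    word_path w k (real j + t) = strand (w ! j) (word_perm (take j w) k) t"
proof (induction w arbitrary: j k)
  case (Cons a w)
  show ?case
  proof (cases j)
    case 0 then show ?thesis using Cons.prems by (simp add: word_path_Cons del: word_path.simps)
  next
    case (Suc i)
    then show ?thesis using Cons.prems Cons.IH[of i "letter_perm a k"]
      by (simp add: word_path_Cons del: word_path.simps)
  qed
qed simp

text \<open>In each sector the strands are named by their position at its beginning; since \<open>word_perm\<close> permutes
  the positions, every such piece lies on a strand followed from the start.\<close>

lemma closed_braid_path_closure: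
  assumes w: "w \<in> braid_words n"
  shows "closed_braid n w = path_closure {1..n} (\<lambda>k u. word_path w k (real (length w) * u))"
proof (cases "w = []")
  case True
  have "(\<exists>k \<theta>. x = cylindrical (real k) \<theta> 0 \<and> 1 \<le> k \<and> k \<le> n \<and> 0 \<le> \<theta> \<and> \<theta> \<le> 2 * pi)
      \<longleftrightarrow> (\<exists>k u. x = cylindrical (real k) (2 * pi * u) 0 \<and> 1 \<le> k \<and> k \<le> n \<and> 0 \<le> u \<and> u \<le> 1)" for x
  proof safe
    fix k \<theta> assume "1 \<le> k" "k \<le> n" "0 \<le> \<theta>" "\<theta> \<le> 2 * pi"
    then show "\<exists>k' u. cylindrical (real k) \<theta> 0 = cylindrical (real k') (2 * pi * u) 0
        \<and> 1 \<le> k' \<and> k' \<le> n \<and> 0 \<le> u \<and> u \<le> 1"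
      by (intro exI[of _ k] exI[of _ "\<theta> / (2 * pi)"]) auto
  next
    fix k u assume "1 \<le> k" "k \<le> n" "0 \<le> u" "u \<le> (1::real)"
    then show "\<exists>k' \<theta>. cylindrical (real k) (2 * pi * u) 0 = cylindrical (real k') \<theta> 0
        \<and> 1 \<le> k' \<and> k' \<le> n \<and> 0 \<le> \<theta> \<and> \<theta> \<le> 2 * pi"
      by (intro exI[of _ k] exI[of _ "2 * pi * u"]) auto
  qed
  then show ?thesis using True by (auto simp: closed_braid_def path_closure_def spin_def)
next
  case False
  let ?m = "real (length w)"
  have m: "0 < ?m" using False by simp
  have "x \<in> closed_braid n w \<longleftrightarrow> x \<in> path_closure {1..n} (\<lambda>k u. word_path w k (?m * u))" for x
  proof
    assume "x \<in> closed_braid n w"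
    then obtain j k t where x: "x = spin (strand (w ! j) k t) (2 * pi * (real j + t) / ?m)"
      and j: "j < length w" and k: "k \<in> {1..n}" and t: "0 \<le> t" "t \<le> 1"
      using False by (auto simp: closed_braid_def spin_def)
    obtain l where l: "word_perm (take j w) l = k" using word_perm_surj by blast
    have tw: "take j w \<in> braid_words n" using w by (auto simp: braid_words_def dest: in_set_takeD)
    have "l \<in> {1..n}" using word_perm_in[OF tw] l k by blast
    moreover have "real j + t \<le> ?m" using j t by linarith
    moreover have "word_path w l (?m * ((real j + t) / ?m)) = strand (w ! j) k t"
      using word_path_sector[OF j t, of l] m l by simp
    ultimately show "x \<in> path_closure {1..n} (\<lambda>k u. word_path w k (?m * u))"
      unfolding path_closure_def using x m t
      by (auto intro!: exI[of _ l] exI[of _ "(real j + t) / ?m"])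
  next
    assume "x \<in> path_closure {1..n} (\<lambda>k u. word_path w k (?m * u))"
    then obtain k u where x: "x = spin (word_path w k (?m * u)) (2 * pi * u)" and k: "k \<in> {1..n}"
      and u: "0 \<le> u" "u \<le> 1" by (auto simp: path_closure_def)
    obtain j t where j: "j < length w" "0 \<le> t" "t \<le> 1" "?m * u = real j + t"
    proof (cases "u = 1")
      case True
      then show ?thesis using m that[of "length w - 1" 1] by (simp add: of_nat_diff Suc_le_eq)
    next
      case False
      then have "?m * u < ?m" using u m by simp
      then have "nat \<lfloor>?m * u\<rfloor> < length w" using u m by (simp add: nat_less_iff floor_less_iff)
      moreover have "real (nat \<lfloor>?m * u\<rfloor>) = of_int \<lfloor>?m * u\<rfloor>" using u m by simp
      ultimately show ?thesis using that[of "nat \<lfloor>?m * u\<rfloor>" "frac (?m * u)"]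
        by (simp add: frac_def) (smt (verit) frac_def frac_ge_0 frac_lt_1)
    qed
    have tw: "take j w \<in> braid_words n" using w by (auto simp: braid_words_def dest: in_set_takeD)
    have "word_perm (take j w) k \<in> {1..n}" using word_perm_in[OF tw] k by blast
    moreover have "x = spin (strand (w ! j) (word_perm (take j w) k) t) (2 * pi * (real j + t) / ?m)"
    proof -
      have "2 * pi * (real j + t) / ?m = 2 * pi * u" using m by (simp flip: j(4))
      then show ?thesis using word_path_sector[OF j(1-3), of k] x j(4) by simp
    qed
    ultimately show "x \<in> closed_braid n w"
      using False j by (auto simp: closed_braid_def spin_def)
  qed
  then show ?thesis by blast
qed

section \<open>Cyclic rotation of a word\<close>

definition axis_rotation :: "real \<Rightarrow> real^3 \<Rightarrow> real^3" where
  "axis_rotation \<alpha> x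
    = vector [cos \<alpha> * x $ 1 - sin \<alpha> * x $ 2, sin \<alpha> * x $ 1 + cos \<alpha> * x $ 2, x $ 3]"

lemma axis_rotation_spin: "axis_rotation \<alpha> (spin p \<theta>) = spin p (\<theta> + \<alpha>)"
  by (simp add: axis_rotation_def spin_def cylindrical_def vec_eq_iff forall_3 cos_add sin_add algebra_simps)

lemma axis_rotation_inverse: "axis_rotation (- \<alpha>) (axis_rotation \<alpha> x) = x"
proof -
  have "cos \<alpha> * (cos \<alpha> * a) + sin \<alpha> * (sin \<alpha> * a) = a" for a
    using sin_cos_squared_add3[of \<alpha>] by (metis distrib_right mult.assoc mult_1)
  then have "cos \<alpha> * (cos \<alpha> * a - sin \<alpha> * b) + sin \<alpha> * (sin \<alpha> * a + cos \<alpha> * b) = a"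
    "cos \<alpha> * (sin \<alpha> * a + cos \<alpha> * b) - sin \<alpha> * (cos \<alpha> * a - sin \<alpha> * b) = b" for a b
    by (simp_all add: right_diff_distrib distrib_left add.commute)
  then show ?thesis
    by (simp add: axis_rotation_def vec_eq_iff forall_3)
qed

lemma continuous_on_axis_rotation:
  fixes f :: "'a::t2_space \<Rightarrow> real"
  assumes "continuous_on A f" "continuous_on A g"
  shows "continuous_on A (\<lambda>x. axis_rotation (f x) (g x))"
proof -
  have eq: "axis_rotation \<alpha> x = (cos \<alpha> * x $ 1 - sin \<alpha> * x $ 2) *\<^sub>R axis 1 1
      + (sin \<alpha> * x $ 1 + cos \<alpha> * x $ 2) *\<^sub>R axis 2 1 + x $ 3 *\<^sub>R axis 3 1" for \<alpha> x
    by (simp add: axis_rotation_def vec_eq_iff forall_3 axis_def)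
  show ?thesis unfolding eq by (intro continuous_intros continuous_on_cos continuous_on_sin assms)
qed

lemma axis_rotation_isotopic: "ambient_isotopic K (axis_rotation \<alpha> ` K)"
  unfolding ambient_isotopic_def
proof (intro exI[of _ "\<lambda>p. axis_rotation (fst p * \<alpha>) (snd p)"] conjI ballI allI)
  show "continuous_on ({0..1} \<times> UNIV) (\<lambda>p. axis_rotation (fst p * \<alpha>) (snd p))"
    by (intro continuous_on_axis_rotation continuous_intros)
  fix t
  have "homeomorphism UNIV UNIV (axis_rotation (t * \<alpha>)) (axis_rotation (- (t * \<alpha>)))"
    using axis_rotation_inverse[of "- (t * \<alpha>)"]
    by (intro homeomorphismI continuous_on_axis_rotation continuous_intros)
       (auto simp: axis_rotation_inverse)
  then show "\<exists>g. homeomorphism UNIV UNIV (\<lambda>x. axis_rotation (fst (t, x) * \<alpha>) (snd (t, x))) g"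
    by auto
qed (auto simp: axis_rotation_def vec_eq_iff forall_3)

definition sector_arcs :: "nat \<Rightarrow> braid_letter \<Rightarrow> real \<Rightarrow> real \<Rightarrow> (real^3) set" where
  "sector_arcs n a j m = (\<lambda>(k, t). spin (strand a k t) (2 * pi * (j + t) / m)) ` ({1..n} \<times> {0..1})"

lemma mem_sector_arcs:
  "x \<in> sector_arcs n a j m
    \<longleftrightarrow> (\<exists>k t. x = spin (strand a k t) (2 * pi * (j + t) / m) \<and> 1 \<le> k \<and> k \<le> n \<and> 0 \<le> t \<and> t \<le> 1)"
  by (simp add: sector_arcs_def image_iff Bex_def) blast

lemma closed_braid_sectors:
  assumes "w \<noteq> []"
  shows "closed_braid n w = (\<Union>j<length w. sector_arcs n (w ! j) (real j) (real (length w)))"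
proof (rule set_eqI)
  fix x
  have "x \<in> closed_braid n w \<longleftrightarrow>
      (\<exists>j k t. x = spin (strand (w ! j) k t) (2 * pi * (real j + t) / real (length w))
        \<and> j < length w \<and> 1 \<le> k \<and> k \<le> n \<and> 0 \<le> t \<and> t \<le> 1)"
    using assms by (simp add: closed_braid_def spin_def)
  also have "\<dots> \<longleftrightarrow> (\<exists>j<length w. x \<in> sector_arcs n (w ! j) (real j) (real (length w)))"
    unfolding mem_sector_arcs by blast
  finally show "x \<in> closed_braid n w
      \<longleftrightarrow> x \<in> (\<Union>j<length w. sector_arcs n (w ! j) (real j) (real (length w)))"
    by (simp add: Bex_def)
qed

lemma axis_rotation_sector_arcs:
  "0 < m \<Longrightarrow> axis_rotation (2 * pi * i / m) ` sector_arcs n a j m = sector_arcs n a (j + i) m"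
  unfolding sector_arcs_def image_image
proof (rule image_cong)
  have "2 * pi * (j + t) / m + 2 * pi * i / m = 2 * pi * (j + i + t) / m" for t
    by (simp add: algebra_simps flip: add_divide_distrib)
  then show "axis_rotation (2 * pi * i / m) (case x of (k, t) \<Rightarrow> spin (strand a k t) (2 * pi * (j + t) / m))
      = (case x of (k, t) \<Rightarrow> spin (strand a k t) (2 * pi * (j + i + t) / m))" for x
    by (simp add: axis_rotation_spin split: prod.split)
qed simp

text \<open>Turning space about the axis by one sector.\<close>

lemma closed_braid_rotate1:
  "ambient_isotopic (closed_braid n (a # w)) (closed_braid n (w @ [a]))"
proof -
  let ?m = "real (length (a # w))"
  have m: "0 < ?m" by simp
  have per: "sector_arcs n a (-1) ?m = sector_arcs n a (real (length w)) ?m"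
  proof -
    have "2 * pi * (real (length w) + t) / ?m = 2 * pi * (- 1 + t) / ?m + 2 * pi" for t
      by (simp add: field_simps)
    then show ?thesis unfolding sector_arcs_def by (simp only: spin_period)
  qed
  have "axis_rotation (2 * pi * (-1) / ?m) ` closed_braid n (a # w)
      = (\<Union>j<Suc (length w). sector_arcs n ((a # w) ! j) (real j + (-1)) ?m)"
    unfolding closed_braid_sectors[OF list.distinct(2)] image_UN axis_rotation_sector_arcs[OF m]
    by simp
  also have "\<dots> = sector_arcs n a (-1) ?m \<union> (\<Union>j<length w. sector_arcs n (w ! j) (real j) ?m)"
    by (simp only: lessThan_Suc_eq_insert_0 UN_insert image_image UN_simps) simp
  also have "\<dots> = closed_braid n (w @ [a])"
    unfolding per by (auto simp: closed_braid_sectors nth_append lessThan_Suc split: if_splits)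
  finally show ?thesis using axis_rotation_isotopic by metis
qed

lemma closed_braid_rotate: "ambient_isotopic (closed_braid n (u @ v)) (closed_braid n (v @ u))"
proof (induction u arbitrary: v)
  case (Cons a u)
  have "ambient_isotopic (closed_braid n (a # (u @ v))) (closed_braid n (u @ (v @ [a])))"
    using closed_braid_rotate1[of n a "u @ v"] by simp
  then show ?case using Cons.IH[of "v @ [a]"] ambient_isotopic_trans by auto
qed (simp add: ambient_isotopic_refl)

section \<open>The relations of the positive braid monoid as isotopies\<close>

definition prefixed :: "nat \<Rightarrow> (nat \<Rightarrow> nat) \<Rightarrow> (nat \<Rightarrow> real \<Rightarrow> real \<times> real) \<Rightarrow> braid_word
    \<Rightarrow> nat \<Rightarrow> real \<Rightarrow> real \<times> real" where
  "prefixed d f P w k t = P k t + (word_path w (f k) (t - real d) - (real (f k), 0))"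

lemma word_path_append_prefixed:
  "word_path (v @ w) = prefixed (length v) (word_perm v) (word_path v) w"
  by (intro ext) (simp add: prefixed_def word_path_append)

lemma word_path_fst_pos: "w \<in> braid_words n \<Longrightarrow> 1 \<le> k \<Longrightarrow> 0 < fst (word_path w k t)"
  using word_path_fst_ge[of 1 k w t] by (force simp: braid_words_def)

text \<open>A homotopy with fixed end points of the first part of a closed braid. Rotating words reduces
  relations applied in the middle of a word to this situation.\<close>

lemma prefix_homotopy:
  fixes G :: "real \<Rightarrow> nat \<Rightarrow> real \<Rightarrow> real \<times> real"
  assumes w: "w \<in> braid_words n"
    and f: "\<And>k. k \<in> {1..n} \<Longrightarrow> f k \<in> {1..n}" "inj_on f {1..n}"
    and start: "\<And>s k. s \<in> {0..1} \<Longrightarrow> k \<in> {1..n} \<Longrightarrow> G s k 0 = (real k, 0)"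
    and stop: "\<And>s k t. s \<in> {0..1} \<Longrightarrow> k \<in> {1..n} \<Longrightarrow> real d \<le> t \<Longrightarrow> G s k t = (real (f k), 0)"
    and lip: "\<And>k. k \<in> {1..n} \<Longrightarrow> is_lipschitz_on ({0..1} \<times> {0..1})
        (\<lambda>p. G (fst p) k (real (d + length w) * snd p))"
    and pos: "\<And>s k t. s \<in> {0..1} \<Longrightarrow> k \<in> {1..n} \<Longrightarrow> 0 \<le> t \<Longrightarrow> t \<le> real d \<Longrightarrow> 0 < fst (G s k t)"
    and inj: "\<And>s k l t. s \<in> {0..1} \<Longrightarrow> k \<in> {1..n} \<Longrightarrow> l \<in> {1..n} \<Longrightarrow> 0 \<le> t \<Longrightarrow> t \<le> real d \<Longrightarrow>
        G s k t = G s l t \<Longrightarrow> k = l"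
  shows "ambient_isotopic
    (path_closure {1..n} (\<lambda>k u. prefixed d f (G 0) w k (real (d + length w) * u)))
    (path_closure {1..n} (\<lambda>k u. prefixed d f (G 1) w k (real (d + length w) * u)))"
proof (rule homotopy_path_closure[where F = "\<lambda>s k u. prefixed d f (G s) w k (real (d + length w) * u)"
      and f = "\<lambda>k. word_perm w (f k)"])
  let ?m = "real (d + length w)"
  have early: "prefixed d f (G s) w k t = G s k t" if "t \<le> real d" for s k t
    using that by (simp add: prefixed_def)
  have late: "prefixed d f (G s) w k t = word_path w (f k) (t - d)"
    if "real d \<le> t" "s \<in> {0..1}" "k \<in> {1..n}" for s k t
    using that stop by (simp add: prefixed_def)
  show "\<And>k. k \<in> {1..n} \<Longrightarrow> word_perm w (f k) \<in> {1..n}"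
    using word_perm_in[OF w] f by blast
  fix s :: real and k assume s: "s \<in> {0..1}" and k: "k \<in> {1..n}"
  have "word_perm w (f k) \<in> {1..n}" using word_perm_in[OF w] f k by blast
  then show "prefixed d f (G s) w k (?m * 1) = prefixed d f (G s) w (word_perm w (f k)) (?m * 0)"
    using early[where t = 0 and s = s] late[where t = ?m and s = s and k = k] s k start by simp
  fix u :: real assume u: "u \<in> {0..1}"
  have t: "0 \<le> ?m * u" using u by simp
  show "0 < fst (prefixed d f (G s) w k (?m * u))"
  proof (cases "?m * u \<le> d")
    case True show ?thesis unfolding early[OF True] by (rule pos[OF s k t True])
  next
    case False then show ?thesis using late[where t = "?m * u" and s = s and k = k] s k word_path_fst_pos[OF w] f(1)[OF k] by simp
  qed
  fix l assume l: "l \<in> {1..n}" "k \<noteq> l"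
  show "prefixed d f (G s) w k (?m * u) \<noteq> prefixed d f (G s) w l (?m * u)"
  proof (cases "?m * u \<le> d")
    case True then show ?thesis unfolding early[OF True] using inj[OF s k l(1) t True] l(2) by blast
  next
    case False
    then show ?thesis using late[where t = "?m * u" and s = s] s k l word_path_inj inj_onD[OF f(2)] by auto
  qed
next
  fix k assume k: "k \<in> {1..n}"
  show "\<exists>L. L-lipschitz_on ({0..1} \<times> {0..1})
      (\<lambda>p. prefixed d f (G (fst p)) w k (real (d + length w) * snd p))"
    unfolding is_lipschitz_on_def[symmetric] prefixed_def
    by (intro is_lip_intros lip k)
qed simp

lemma closed_braid_far:
  assumes i: "1 \<le> i" "i + 2 \<le> j" "j < n" and w: "w \<in> braid_words n"
  shows "ambient_isotopic (closed_braid n ([Gen i, Gen j] @ w)) (closed_braid n ([Gen j, Gen i] @ w))"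
proof -
  \<comment> \<open>The first exchange is delayed by \<open>s\<close> and the second one advanced by \<open>s\<close>.\<close>
  define G where "G s k t = (if k = i \<or> k = i + 1 then strand (Gen i) k (unit_clamp (t - s))
      else strand (Gen j) k (unit_clamp (t - 1 + s)))" for s :: real and k t
  let ?f = "word_perm [Gen i, Gen j]"
  have f: "?f k = (if k = i \<or> k = i + 1 then letter_perm (Gen i) k else letter_perm (Gen j) k)" for k
    using i by (auto simp: letter_perm.simps)
  have f': "word_perm [Gen j, Gen i] = ?f"
    using i by (intro ext) (auto simp: letter_perm.simps)
  have G0: "G 0 = word_path [Gen i, Gen j]"
    using i by (intro ext) (auto simp: G_def strand_other letter_perm.simps)
  have G1: "G 1 = word_path [Gen j, Gen i]"
    using i by (intro ext) (auto simp: G_def strand_other letter_perm.simps)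
  have vw: "[Gen i, Gen j] @ w \<in> braid_words n" "[Gen j, Gen i] @ w \<in> braid_words n"
    using i w by (auto simp: braid_words_Cons)
  have v: "[Gen i, Gen j] \<in> braid_words n" using i by (auto simp: braid_words_Cons)
  have "ambient_isotopic
      (path_closure {1..n} (\<lambda>k u. prefixed 2 ?f (G 0) w k (real (2 + length w) * u)))
      (path_closure {1..n} (\<lambda>k u. prefixed 2 ?f (G 1) w k (real (2 + length w) * u)))"
  proof (rule prefix_homotopy[OF w])
    show "\<And>k. k \<in> {1..n} \<Longrightarrow> ?f k \<in> {1..n}" using word_perm_in[OF v] by blast
    show "inj_on ?f {1..n}" by (meson inj_onI word_perm_inj)
    fix k
    show "is_lipschitz_on ({0..1} \<times> {0..1}) (\<lambda>p. G (fst p) k (real (2 + length w) * snd p))"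
      unfolding G_def by (cases "k = i \<or> k = i + 1") (auto intro!: is_lip_intros)
    fix s t :: real and l
    assume s: "s \<in> {0..1}" and k: "k \<in> {1..n}"
    show "G s k 0 = (real k, 0)" using s by (simp add: G_def)
    show "0 < fst (G s k t)"
      using strand_fst_ge[of 1 k "Gen i"] strand_fst_ge[of 1 k "Gen j"] i k
      by (force simp: G_def intro: less_le_trans[OF zero_less_one])
    show "real 2 \<le> t \<Longrightarrow> G s k t = (real (?f k), 0)" using s by (simp add: G_def f del: word_perm.simps)
    assume "l \<in> {1..n}" and e: "G s k t = G s l t"
    have apart: "strand (Gen i) a x \<noteq> strand (Gen j) b y"
      if a: "a = i \<or> a = i + 1" and b: "\<not> (b = i \<or> b = i + 1)" for a b x y
    proof -
      have 1: "real i \<le> fst (strand (Gen i) a x)" "fst (strand (Gen i) a x) \<le> real i + 1"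
        using strand_fst_range[of a "Gen i" x] a by auto
      have "fst (strand (Gen j) b y) < real i \<or> real i + 1 < fst (strand (Gen j) b y)"
      proof (cases "b = j \<or> b = j + 1")
        case True then show ?thesis using strand_fst_range[of b "Gen j" y] i by auto
      next
        case False
        then have "strand (Gen j) b y = (real b, 0)" by (intro strand_other) auto
        then show ?thesis using b by auto
      qed
      with 1 show ?thesis by auto
    qed
    show "k = l"
      using e apart[of k l] apart[of l k] strand_inj
      by (auto simp: G_def split: if_splits) metis+
  qed
  then show ?thesis
    unfolding closed_braid_path_closure[OF vw(1)] closed_braid_path_closure[OF vw(2)]
      word_path_append_prefixed f' G0 G1 by (simp add: numeral_2_eq_2)
qed

text \<open>Rigid half turn of the three strands \<open>i, i + 1, i + 2\<close> about the middle one, in three units of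
  time. Both sides of the braid relation are deformed into it, along straight lines.\<close>

definition half_turn :: "nat \<Rightarrow> nat \<Rightarrow> real \<Rightarrow> real \<times> real" where
  "half_turn i k t = (if i \<le> k \<and> k \<le> i + 2
     then (real (i + 1) + (real k - real (i + 1)) * cos (pi * unit_clamp (t / 3)),
           - (real k - real (i + 1)) * sin (pi * unit_clamp (t / 3)))
     else (real k, 0))"

definition reversal3 :: "nat \<Rightarrow> nat \<Rightarrow> nat" where
  "reversal3 i k = (if i \<le> k \<and> k \<le> i + 2 then 2 * i + 2 - k else k)"

text \<open>On the straight line from the motion of \<open>v\<close> to the rigid half turn, strands \<open>k < l\<close> collide only if
  their difference vectors in the two motions are opposite to each other. In the half turn the
  vector from \<open>l\<close> to \<open>k\<close> starts in the direction \<open>(-1, 0)\<close>, goes through the upper half-plane, and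
  its first coordinate is negative during the first third and positive during the last third. The
  condition \<open>side\<close> thus prevents opposite directions.\<close>

lemma closed_braid_half_turn:
  assumes i: "1 \<le> i" "i + 1 < n" and w: "w \<in> braid_words n"
    and v: "v \<in> braid_words n" "set v \<subseteq> {Gen i, Gen (i + 1)}" "length v = 3"
    and perm: "word_perm v = reversal3 i"
    and side: "\<And>k l t. i \<le> k \<Longrightarrow> k < l \<Longrightarrow> l \<le> i + 2 \<Longrightarrow> 0 \<le> t \<Longrightarrow> t \<le> 3 \<Longrightarrow>
      snd (word_path v l t) \<le> snd (word_path v k t)
      \<or> fst (word_path v k t) < fst (word_path v l t) \<and> t \<le> 1
      \<or> fst (word_path v l t) < fst (word_path v k t) \<and> 2 \<le> t"
  shows "ambient_isotopic (closed_braid n (v @ w)) (path_closure {1..n}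
    (\<lambda>k u. prefixed 3 (reversal3 i) (half_turn i) w k (real (3 + length w) * u)))"
proof -
  define G where "G s k t = (1 - s) *\<^sub>R word_path v k t + s *\<^sub>R half_turn i k t" for s :: real and k t
  have other: "word_path v k t = (real k, 0)" if "\<not> (i \<le> k \<and> k \<le> i + 2)" for k t
  proof -
    have "word_path u k t = (real k, 0)" if "set u \<subseteq> {Gen i, Gen (i + 1)}" for u t
      using that \<open>\<not> (i \<le> k \<and> k \<le> i + 2)\<close>
      by (induction u arbitrary: t) (auto simp: strand_other letter_perm.simps)
    then show ?thesis using v by blast
  qed
  have triple_perm: "i \<le> word_perm u k \<and> word_perm u k \<le> i + 2 \<and> real i \<le> fst (word_path u k t)
      \<and> fst (word_path u k t) \<le> real i + 2"
    if "i \<le> k \<and> k \<le> i + 2" "set u \<subseteq> {Gen i, Gen (i + 1)}" for k u t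
    using that
  proof (induction u arbitrary: k t)
    case (Cons a u)
    have k': "i \<le> letter_perm a k \<and> letter_perm a k \<le> i + 2"
      using Cons.prems by (auto simp: letter_perm.simps)
    show ?case
    proof (cases "t \<le> 1")
      case True
      have "real i \<le> fst (strand a k x) \<and> fst (strand a k x) \<le> real i + 2" for x
        using Cons.prems strand_fst_range[of k a x] strand_other[of k a x]
        by (cases "k = gen_index a \<or> k = gen_index a + 1") auto
      then show ?thesis using True Cons.IH[OF k'] Cons.prems by (simp add: word_path_Cons del: word_path.simps)
    next
      case False
      then show ?thesis using Cons.IH[OF k'] Cons.prems by (simp add: word_path_Cons del: word_path.simps)
    qed
  qed auto
  have turn_range: "real i \<le> fst (half_turn i k t) \<and> fst (half_turn i k t) \<le> real i + 2"
    if "i \<le> k \<and> k \<le> i + 2" for k t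
  proof -
    define c where "c = cos (pi * unit_clamp (t / 3))"
    have c: "- 1 \<le> c" "c \<le> 1" by (simp_all add: c_def)
    have "k = i \<or> k = i + 1 \<or> k = i + 2" using that by auto
    then show ?thesis using c by (auto simp: half_turn_def simp flip: c_def)
  qed
  have mid: "real i \<le> fst (G s k t) \<and> fst (G s k t) \<le> real i + 2"
    if k: "i \<le> k \<and> k \<le> i + 2" and s: "s \<in> {0..1}" for s k t
  proof -
    have "(1 - s) * real i + s * real i \<le> fst (G s k t)"
      unfolding G_def using turn_range[OF k] triple_perm[OF k v(2)] s
      by (auto intro!: add_mono mult_left_mono)
    moreover have "fst (G s k t) \<le> (1 - s) * (real i + 2) + s * (real i + 2)"
      unfolding G_def using turn_range[OF k] triple_perm[OF k v(2)] s
      by (auto intro!: add_mono mult_left_mono)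
    ultimately show ?thesis by (simp add: algebra_simps)
  qed
  have out: "G s k t = (real k, 0)" if "\<not> (i \<le> k \<and> k \<le> i + 2)" for s k t
    using other[OF that] that by (auto simp: G_def half_turn_def algebra_simps)
  have ends: "G s k 0 = (real k, 0)" "3 \<le> t \<Longrightarrow> G s k t = (real (reversal3 i k), 0)" for s k t
  proof -
    have h0: "half_turn i k 0 = (real k, 0)" by (simp add: half_turn_def)
    show "G s k 0 = (real k, 0)" by (simp add: G_def h0 algebra_simps)
    assume t: "3 \<le> t"
    have h1: "half_turn i k t = (real (reversal3 i k), 0)"
      using t by (auto simp: half_turn_def reversal3_def of_nat_diff)
    show "G s k t = (real (reversal3 i k), 0)" using t v(3) by (simp add: G_def h1 perm algebra_simps)
  qed
  have sep: "G s k t \<noteq> G s l t"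
    if kl: "i \<le> k" "k < l" "l \<le> i + 2" and t: "0 \<le> t" "t \<le> 3" and s: "s \<in> {0..1}" for s k l t
  proof (cases "t = 0 \<or> t = 3")
    case True
    have "reversal3 i k \<noteq> reversal3 i l" using kl by (auto simp: reversal3_def)
    then show ?thesis using True ends kl by auto
  next
    case False
    let ?\<phi> = "pi * unit_clamp (t / 3)"
    have \<phi>: "?\<phi> = pi * (t / 3)" "0 < ?\<phi>" "?\<phi> < pi" using t False by auto
    then have sp: "0 < sin ?\<phi>" by (intro sin_gt_zero)
    have gap: "0 < real l - real k" using kl by simp
    have Dz: "snd (half_turn i k t) - snd (half_turn i l t) = (real l - real k) * sin ?\<phi>"
      and Dx: "fst (half_turn i k t) - fst (half_turn i l t) = - (real l - real k) * cos ?\<phi>"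
      using kl by (auto simp: half_turn_def algebra_simps)
    have pick: "(1 - s) * a + s * b > 0" if "a > 0" "b > 0" for a b :: real
      using that s by (cases "s = 0") (auto intro: add_nonneg_pos)
    show ?thesis
    proof
      assume e: "G s k t = G s l t"
      then have ex: "(1 - s) * (fst (word_path v k t) - fst (word_path v l t))
            + s * (fst (half_turn i k t) - fst (half_turn i l t)) = 0"
        and ez: "(1 - s) * (snd (word_path v k t) - snd (word_path v l t))
            + s * (snd (half_turn i k t) - snd (half_turn i l t)) = 0"
        by (auto simp: G_def prod_eq_iff algebra_simps)
      from side[OF kl t] show False
      proof (elim disjE conjE)
        assume a: "snd (word_path v l t) \<le> snd (word_path v k t)"
        show False
        proof (cases "s = 0")
          case True then show False using e word_path_inj[of v k t l] kl by (simp add: G_def)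
        next
          case False
          then have "0 < s * ((real l - real k) * sin ?\<phi>)" using s gap sp by simp
          moreover have "0 \<le> (1 - s) * (snd (word_path v k t) - snd (word_path v l t))" using a s by simp
          ultimately show False using ez unfolding Dz by linarith
        qed
      next
        assume a: "fst (word_path v k t) < fst (word_path v l t)" "t \<le> 1"
        have "0 < cos ?\<phi>" using a t \<phi> by (intro cos_gt_zero) auto
        then have "0 < (1 - s) * (fst (word_path v l t) - fst (word_path v k t))
            + s * ((real l - real k) * cos ?\<phi>)" using gap a by (intro pick) auto
        then show False using ex Dx by (simp add: algebra_simps)
      next
        assume a: "fst (word_path v l t) < fst (word_path v k t)" "2 \<le> t"
        have "0 < cos (pi - ?\<phi>)" using a t \<phi> by (intro cos_gt_zero) (auto simp: field_simps)
        then have "0 < (1 - s) * (fst (word_path v k t) - fst (word_path v l t))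
            + s * ((real l - real k) * - cos ?\<phi>)" using gap a by (intro pick) (auto simp: mult_less_0_iff)
        then show False using ex Dx by (simp add: algebra_simps)
      qed
    qed
  qed
  have "ambient_isotopic
      (path_closure {1..n} (\<lambda>k u. prefixed 3 (reversal3 i) (G 0) w k (real (3 + length w) * u)))
      (path_closure {1..n} (\<lambda>k u. prefixed 3 (reversal3 i) (G 1) w k (real (3 + length w) * u)))"
  proof (rule prefix_homotopy[OF w])
    show "\<And>k. k \<in> {1..n} \<Longrightarrow> reversal3 i k \<in> {1..n}" using i by (auto simp: reversal3_def)
    show "inj_on (reversal3 i) {1..n}" unfolding perm[symmetric] by (meson inj_onI word_perm_inj)
    fix k
    show "is_lipschitz_on ({0..1} \<times> {0..1}) (\<lambda>p. G (fst p) k (real (3 + length w) * snd p))"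
      unfolding G_def half_turn_def
      by (cases "i \<le> k \<and> k \<le> i + 2") (auto intro!: is_lip_intros compact_Times)
    fix s t :: real and l
    assume s: "s \<in> {0..1}" and k: "k \<in> {1..n}"
    show "G s k 0 = (real k, 0)" by (rule ends)
    show "real 3 \<le> t \<Longrightarrow> G s k t = (real (reversal3 i k), 0)" by (rule ends) simp
    show "0 < fst (G s k t)"
      using mid[OF _ s, of k t] out[of k s t] i k by (cases "i \<le> k \<and> k \<le> i + 2") auto
    assume l: "l \<in> {1..n}" and t: "0 \<le> t" "t \<le> real 3" and e: "G s k t = G s l t"
    show "k = l"
    proof (cases "(i \<le> k \<and> k \<le> i + 2) \<and> (i \<le> l \<and> l \<le> i + 2)")
      case True
      then show ?thesis
        using sep[of k l t s] sep[of l k t s] t s e by (cases k l rule: linorder_cases) auto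
    next
      case False
      have where': "(i \<le> m \<and> m \<le> i + 2) \<and> real i \<le> fst (G s m t) \<and> fst (G s m t) \<le> real (i + 2)
          \<or> (m < i \<or> i + 2 < m) \<and> fst (G s m t) = real m" for m
        using mid[OF _ s, of m t] out[of m s t] by (cases "i \<le> m \<and> m \<le> i + 2") auto
      have "fst (G s k t) = fst (G s l t)" using e by simp
      with where'[of k] where'[of l] False show ?thesis by linarith
    qed
  qed
  moreover have "G 0 = word_path v" "G 1 = half_turn i" by (intro ext; simp add: G_def)+
  moreover have "v @ w \<in> braid_words n" using v w by (simp add: braid_words_append)
  ultimately show ?thesis
    by (simp add: closed_braid_path_closure word_path_append_prefixed v(3) perm)
qed

lemma word_path_3:
  "0 \<le> t \<Longrightarrow> t \<le> 1 \<Longrightarrow> word_path [a, b, c] k t = strand a k t"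
  "1 \<le> t \<Longrightarrow> t \<le> 2 \<Longrightarrow> word_path [a, b, c] k t = strand b (letter_perm a k) (t - 1)"
  "2 \<le> t \<Longrightarrow> t \<le> 3 \<Longrightarrow> word_path [a, b, c] k t = strand c (letter_perm b (letter_perm a k)) (t - 2)"
  by (simp_all add: word_path_Cons del: word_path.simps)

lemma closed_braid_half_turn_word:
  assumes i: "1 \<le> i" "i + 1 < n" and w: "w \<in> braid_words n"
    and pq: "p = i \<and> q = i + 1 \<or> p = i + 1 \<and> q = i"
  shows "ambient_isotopic (closed_braid n ([Gen p, Gen q, Gen p] @ w)) (path_closure {1..n}
    (\<lambda>k u. prefixed 3 (reversal3 i) (half_turn i) w k (real (3 + length w) * u)))"
proof (rule closed_braid_half_turn[OF i w])
  have sn: "0 \<le> sin (pi * x)" if "0 \<le> x" "x \<le> 1" for x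
    using that by (intro sin_ge_zero) auto
  have cs: "- 2 < cos (pi * x) \<and> cos (pi * x) < 2" for x
    using cos_ge_minus_one[of "pi * x"] cos_le_one[of "pi * x"] by linarith
  show "[Gen p, Gen q, Gen p] \<in> braid_words n" using i pq by (auto simp: braid_words_Cons)
  show "word_perm [Gen p, Gen q, Gen p] = reversal3 i"
    using pq by (intro ext) (auto simp: letter_perm.simps reversal3_def)
  let ?P = "word_path [Gen p, Gen q, Gen p]"
  fix k l t assume kl: "i \<le> k" "k < l" "l \<le> i + 2" and t: "0 \<le> t" "t \<le> (3::real)"
  have c: "k = i \<and> l = i + 1 \<or> k = i \<and> l = i + 2 \<or> k = i + 1 \<and> l = i + 2" using kl by auto
  consider "t \<le> 1" | "1 \<le> t" "t \<le> 2" | "2 \<le> t" by linarith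
  then show "snd (?P l t) \<le> snd (?P k t) \<or> fst (?P k t) < fst (?P l t) \<and> t \<le> 1
      \<or> fst (?P l t) < fst (?P k t) \<and> 2 \<le> t"
  proof cases
    case 1
    show ?thesis using pq
      by (rule disjE) (use c t 1 cs[of t] sn[of t] in
        \<open>auto simp: word_path_3(1)[OF t(1) 1] strand_def Let_def simp del: word_path.simps\<close>)
  next
    case 2
    show ?thesis using pq
      by (rule disjE) (use c t 2 cs[of "t - 1"] sn[of "t - 1"] in
        \<open>auto simp: word_path_3(2)[OF 2] strand_def Let_def letter_perm.simps simp del: word_path.simps\<close>)
  next
    case 3
    show ?thesis using pq
      by (rule disjE) (use c t 3 cs[of "t - 2"] sn[of "t - 2"] in
        \<open>auto simp: word_path_3(3)[OF 3 t(2)] strand_def Let_def letter_perm.simps simp del: word_path.simps\<close>)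
  qed
qed (use pq in auto)

lemma closed_braid_braid_relation:
  assumes "1 \<le> i" "i + 1 < n" "w \<in> braid_words n"
  shows "ambient_isotopic (closed_braid n ([Gen i, Gen (i + 1), Gen i] @ w))
    (closed_braid n ([Gen (i + 1), Gen i, Gen (i + 1)] @ w))"
  using closed_braid_half_turn_word[OF assms, of i "i + 1"] closed_braid_half_turn_word[OF assms, of "i + 1" i]
  by (blast intro: ambient_isotopic_sym ambient_isotopic_trans)

text \<open>The congruence of the positive braid monoid: the relations of the braid group that do not mention
  inverses.\<close>

inductive positive_eq :: "nat \<Rightarrow> braid_word \<Rightarrow> braid_word \<Rightarrow> bool" for n where
  refl: "w \<in> braid_words n \<Longrightarrow> positive_eq n w w"
| sym: "positive_eq n v w \<Longrightarrow> positive_eq n w v"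
| trans: "positive_eq n u v \<Longrightarrow> positive_eq n v w \<Longrightarrow> positive_eq n u w"
| cong: "positive_eq n v v' \<Longrightarrow> u \<in> braid_words n \<Longrightarrow> w \<in> braid_words n
    \<Longrightarrow> positive_eq n (u @ v @ w) (u @ v' @ w)"
| far: "1 \<le> i \<Longrightarrow> i + 2 \<le> j \<Longrightarrow> j < n \<Longrightarrow> positive_eq n [Gen i, Gen j] [Gen j, Gen i]"
| braid: "1 \<le> i \<Longrightarrow> i + 1 < n
    \<Longrightarrow> positive_eq n [Gen i, Gen (i + 1), Gen i] [Gen (i + 1), Gen i, Gen (i + 1)]"

lemma positive_eq_context_isotopic:
  assumes "positive_eq n v v'" "u \<in> braid_words n" "w \<in> braid_words n"
  shows "ambient_isotopic (closed_braid n (u @ v @ w)) (closed_braid n (u @ v' @ w))"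
  using assms
proof (induction arbitrary: u w)
  case (refl v) show ?case by (rule ambient_isotopic_refl)
next
  case (sym v v') then show ?case by (blast intro: ambient_isotopic_sym)
next
  case (trans v v' v'') then show ?case by (blast intro: ambient_isotopic_trans)
next
  case (cong v v' a b)
  then show ?case using cong.IH[of "u @ a" "b @ w"] by (simp add: braid_words_append)
next
  case (far i j)
  have "ambient_isotopic (closed_braid n ([Gen i, Gen j] @ (w @ u))) (closed_braid n ([Gen j, Gen i] @ (w @ u)))"
    using far by (intro closed_braid_far) (simp_all add: braid_words_append)
  then show ?case
    using closed_braid_rotate[of n u "[Gen i, Gen j] @ w"] closed_braid_rotate[of n "[Gen j, Gen i] @ w" u]
    by (simp, meson ambient_isotopic_trans)
next
  case (braid i)
  have "ambient_isotopic (closed_braid n ([Gen i, Gen (i + 1), Gen i] @ (w @ u)))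
      (closed_braid n ([Gen (i + 1), Gen i, Gen (i + 1)] @ (w @ u)))"
    using braid by (intro closed_braid_braid_relation) (simp_all add: braid_words_append)
  then show ?case
    using closed_braid_rotate[of n u "[Gen i, Gen (i + 1), Gen i] @ w"]
      closed_braid_rotate[of n "[Gen (i + 1), Gen i, Gen (i + 1)] @ w" u]
    by (simp, meson ambient_isotopic_trans)
qed

lemma positive_eq_isotopic:
  "positive_eq n v v' \<Longrightarrow> ambient_isotopic (closed_braid n v) (closed_braid n v')"
  using positive_eq_context_isotopic[of n v v' "[]" "[]"] by simp

section \<open>Reversing the order of the strands\<close>

lemma path_closure_UN:
  "path_closure S F = (\<Union>k\<in>S. (\<lambda>u. spin (F k u) (2 * pi * u)) ` {0..1})"
  unfolding path_closure_image by force

lemma path_closure_reindex: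
  assumes "\<And>k u. k \<in> S \<Longrightarrow> 0 \<le> u \<Longrightarrow> u \<le> 1 \<Longrightarrow> F k u = G (h k) u"
  shows "path_closure S F = path_closure (h ` S) G"
proof -
  have "path_closure S F = (\<Union>k\<in>S. (\<lambda>u. spin (G (h k) u) (2 * pi * u)) ` {0..1})"
    unfolding path_closure_UN
    by (intro SUP_cong image_cong) (auto simp: assms)
  also have "\<dots> = path_closure (h ` S) G"
    by (simp add: path_closure_UN)
  finally show ?thesis .
qed

fun map_index :: "(nat \<Rightarrow> nat) \<Rightarrow> braid_letter \<Rightarrow> braid_letter" where
  "map_index h (Gen i) = Gen (h i)"
| "map_index h (Inv i) = Inv (h i)"

lemma map_index_simps [simp]:
  "gen_index (map_index h a) = h (gen_index a)" "strand_sign (map_index h a) = strand_sign a"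
  by (cases a; simp)+

lemma map_index_map_index: "map_index g (map_index h a) = map_index (\<lambda>i. g (h i)) a"
  by (cases a) auto

definition flip_word :: "nat \<Rightarrow> braid_word \<Rightarrow> braid_word" where
  "flip_word n w = map (map_index (\<lambda>i. n - i)) w"

text \<open>Half a turn of the half-plane about the midpoint of the strands exchanges positions \<open>k\<close> and
  \<open>n + 1 - k\<close>, and it preserves the sense in which two strands rotate about each other.\<close>

lemma strand_flip:
  assumes "1 \<le> gen_index a" "gen_index a < n" "k \<in> {1..n}"
  shows "strand (map_index (\<lambda>i. n - i) a) (Suc n - k) t
    = (real (Suc n) - fst (strand a k t), - snd (strand a k t))"
    "letter_perm (map_index (\<lambda>i. n - i) a) (Suc n - k) = Suc n - letter_perm a k"
  using assms by (auto simp: strand_def Let_def letter_perm.simps of_nat_diff field_simps)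

lemma word_path_flip:
  assumes "w \<in> braid_words n" "k \<in> {1..n}"
  shows "word_path (flip_word n w) (Suc n - k) t
    = (real (Suc n) - fst (word_path w k t), - snd (word_path w k t))"
  using assms
proof (induction w arbitrary: k t)
  case (Cons a w)
  then have a: "1 \<le> gen_index a" "gen_index a < n" and w: "w \<in> braid_words n"
    by (simp_all add: braid_words_Cons)
  have k': "letter_perm a k \<in> {1..n}" using letter_perm_in[OF a] Cons.prems by blast
  have "flip_word n (a # w) = map_index (\<lambda>i. n - i) a # flip_word n w" by (simp add: flip_word_def)
  then show ?case using Cons.IH[OF w k'] strand_flip[OF a Cons.prems(2)] k'
    by (simp add: of_nat_diff)
qed (simp add: flip_word_def of_nat_diff)

text \<open>Every exchange takes place in a disc of radius \<open>1/2\<close> inside the disc that has the segment from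
  \<open>(1, 0)\<close> to \<open>(n, 0)\<close> as a diameter. The larger disc is disjoint from the axis.\<close>

lemma norm_Pair_0: "norm ((a, 0) :: real \<times> real) = \<bar>a\<bar>"
  by (simp add: norm_prod_def)

lemma word_path_disc:
  assumes "w \<in> braid_words n" "k \<in> {1..n}"
  shows "norm (word_path w k t - ((real n + 1) / 2, 0)) \<le> (real n - 1) / 2"
  using assms
proof (induction w arbitrary: k t)
  case Nil
  then show ?case by (auto simp: norm_Pair_0 abs_le_iff field_simps)
next
  case (Cons a w)
  let ?c = "((real n + 1) / 2, 0) :: real \<times> real"
  have a: "1 \<le> gen_index a" "gen_index a < n" and w: "w \<in> braid_words n"
    using Cons.prems by (simp_all add: braid_words_Cons)
  have k': "letter_perm a k \<in> {1..n}" using letter_perm_in[OF a] Cons.prems by blast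
  show ?case
  proof (cases "1 \<le> t")
    case True
    then show ?thesis using Cons.IH[OF w k'] by (simp add: word_path_Cons del: word_path.simps)
  next
    case False
    have "norm (strand a k x - ?c) \<le> (real n - 1) / 2" for x
    proof (cases "k = gen_index a \<or> k = gen_index a + 1")
      case True
      let ?i = "(real (gen_index a) + 1 / 2, 0) :: real \<times> real"
      have cases4: "strand a k x - ?i = (cos (pi * x) / 2, sin (pi * x) / 2)
          \<or> strand a k x - ?i = (cos (pi * x) / 2, - sin (pi * x) / 2)
          \<or> strand a k x - ?i = (- cos (pi * x) / 2, sin (pi * x) / 2)
          \<or> strand a k x - ?i = (- cos (pi * x) / 2, - sin (pi * x) / 2)"
        using True by (cases a) (auto simp: strand_def Let_def)
      have half: "norm (x, y) = 1 / 2" if "x\<^sup>2 + y\<^sup>2 = 1 / 4" for x y :: real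
        by (simp add: norm_prod_def that real_sqrt_divide)
      have "norm (strand a k x - ?i) = 1 / 2"
        by (rule disjE[OF cases4]; (elim disjE)?; simp only:; rule half;
            simp add: power_divide flip: add_divide_distrib)
      moreover have "norm (?i - ?c) \<le> real n / 2 - 1"
        using a by (auto simp: norm_Pair_0 abs_le_iff field_simps)
      moreover have "norm (strand a k x - ?c) \<le> norm (strand a k x - ?i) + norm (?i - ?c)"
        by (metis dist_norm dist_triangle)
      ultimately show ?thesis by simp
    next
      case False
      then have "strand a k x = (real k, 0)" by (intro strand_other) auto
      then show ?thesis using Cons.prems by (auto simp: norm_Pair_0 abs_le_iff field_simps)
    qed
    then show ?thesis using False by (simp add: word_path_Cons del: word_path.simps)
  qed
qed

definition turn :: "real \<Rightarrow> real \<times> real \<Rightarrow> real \<times> real" where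
  "turn \<alpha> p = (cos \<alpha> * fst p - sin \<alpha> * snd p, sin \<alpha> * fst p + cos \<alpha> * snd p)"

lemma norm_turn: "norm (turn \<alpha> p) = norm p"
proof -
  have "(cos \<alpha> * fst p - sin \<alpha> * snd p)\<^sup>2 + (sin \<alpha> * fst p + cos \<alpha> * snd p)\<^sup>2
      = ((sin \<alpha>)\<^sup>2 + (cos \<alpha>)\<^sup>2) * ((fst p)\<^sup>2 + (snd p)\<^sup>2)"
    by algebra
  then show ?thesis by (simp add: turn_def norm_prod_def)
qed

lemma turn_diff: "turn \<alpha> (p - q) = turn \<alpha> p - turn \<alpha> q"
  by (simp add: turn_def algebra_simps)

lemma is_lipschitz_on_turn:
  "compact A \<Longrightarrow> is_lipschitz_on A f \<Longrightarrow> is_lipschitz_on A g \<Longrightarrow> is_lipschitz_on A (\<lambda>x. turn (f x) (g x))"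
  unfolding turn_def by (intro is_lip_intros)

text \<open>All half-planes are turned simultaneously by the angle \<open>\<pi>\<close> about the midpoint of the strands; by
  \<open>word_path_disc\<close> the strands do not meet the axis meanwhile.\<close>

lemma closed_braid_flip:
  assumes w: "w \<in> braid_words n"
  shows "ambient_isotopic (closed_braid n w) (closed_braid n (flip_word n w))"
proof -
  let ?m = "real (length w)" and ?c = "((real n + 1) / 2, 0) :: real \<times> real"
  define F where "F s k u = ?c + turn (pi * s) (word_path w k (?m * u) - ?c)" for s :: real and k u
  have "ambient_isotopic (path_closure {1..n} (F 0)) (path_closure {1..n} (F 1))"
  proof (rule homotopy_path_closure[where f = "word_perm w"])
    show "\<And>k. k \<in> {1..n} \<Longrightarrow> word_perm w k \<in> {1..n}" using word_perm_in[OF w] by blast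
    fix k assume k: "k \<in> {1..n}"
    show "\<exists>L. L-lipschitz_on ({0..1} \<times> {0..1}) (\<lambda>p. F (fst p) k (snd p))"
      unfolding is_lipschitz_on_def[symmetric] F_def
      by (intro is_lip_intros is_lipschitz_on_turn compact_Times compact_Icc)
    fix s u l
    show "F s k 1 = F s (word_perm w k) 0" by (simp add: F_def)
    have fl: "\<bar>fst p\<bar> \<le> norm p" for p :: "real \<times> real"
      using norm_fst_le[of "fst p" "snd p"] by simp
    have "\<bar>fst (turn (pi * s) (word_path w k (?m * u) - ?c))\<bar> \<le> (real n - 1) / 2"
      using word_path_disc[OF w k, of "?m * u"] norm_turn[of "pi * s" "word_path w k (?m * u) - ?c"]
        fl[of "turn (pi * s) (word_path w k (?m * u) - ?c)"]
      by simp
    then show "0 < fst (F s k u)" by (simp add: F_def abs_le_iff field_simps)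
    assume "k \<noteq> l"
    then have "word_path w k (?m * u) - word_path w l (?m * u) \<noteq> 0" using word_path_inj by auto
    then have "turn (pi * s) (word_path w k (?m * u) - word_path w l (?m * u)) \<noteq> 0"
      by (metis norm_eq_zero norm_turn)
    moreover have "F s k u - F s l u = turn (pi * s) (word_path w k (?m * u) - word_path w l (?m * u))"
      unfolding F_def by (simp add: turn_diff)
    ultimately show "F s k u \<noteq> F s l u" by auto
  qed simp
  moreover have "path_closure {1..n} (F 0) = closed_braid n w"
  proof -
    have "F 0 = (\<lambda>k u. word_path w k (?m * u))"
      by (intro ext) (simp add: F_def turn_def prod_eq_iff)
    then show ?thesis by (simp only: closed_braid_path_closure[OF w])
  qed
  moreover have "path_closure {1..n} (F 1) = closed_braid n (flip_word n w)"
  proof -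
    have fw: "flip_word n w \<in> braid_words n" using w by (auto simp: braid_words_def flip_word_def)
    have "path_closure {1..n} (F 1) = path_closure ((\<lambda>k. Suc n - k) ` {1..n})
        (\<lambda>k u. word_path (flip_word n w) k (?m * u))"
      by (rule path_closure_reindex)
         (simp add: word_path_flip[OF w] F_def turn_def prod_eq_iff add_divide_distrib)
    also have "(\<lambda>k. Suc n - k) ` {1..n} = {1..n}"
    proof (intro equalityI subsetI)
      fix x assume "x \<in> {1..n}"
      then show "x \<in> (\<lambda>k. Suc n - k) ` {1..n}" by (intro image_eqI[of _ _ "Suc n - x"]) auto
    qed auto
    finally show ?thesis
      by (simp add: closed_braid_path_closure[OF fw]) (simp add: flip_word_def)
  qed
  ultimately show ?thesis by simp
qed

section \<open>Destabilization\<close>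

lemma linear_path_homotopy:
  fixes p q :: "'k \<Rightarrow> real \<Rightarrow> real \<times> real"
  assumes S: "finite S" "\<And>k. k \<in> S \<Longrightarrow> f k \<in> S"
    and cl: "\<And>k. k \<in> S \<Longrightarrow> p k 1 = p (f k) 0" "\<And>k. k \<in> S \<Longrightarrow> q k 1 = q (f k) 0"
    and lip: "\<And>k. k \<in> S \<Longrightarrow> is_lipschitz_on {0..1} (p k)" "\<And>k. k \<in> S \<Longrightarrow> is_lipschitz_on {0..1} (q k)"
    and pos: "\<And>k u. k \<in> S \<Longrightarrow> u \<in> {0..1} \<Longrightarrow> 0 < fst (p k u) \<and> 0 < fst (q k u)"
    and inj: "\<And>s k l u. 0 \<le> s \<Longrightarrow> s \<le> 1 \<Longrightarrow> k \<in> S \<Longrightarrow> l \<in> S \<Longrightarrow> k \<noteq> l \<Longrightarrow> u \<in> {0..1} \<Longrightarrow>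
      (1 - s) *\<^sub>R p k u + s *\<^sub>R q k u \<noteq> (1 - s) *\<^sub>R p l u + s *\<^sub>R q l u"
  shows "ambient_isotopic (path_closure S p) (path_closure S q)"
proof -
  define F where "F s k u = (1 - s) *\<^sub>R p k u + s *\<^sub>R q k u" for s :: real and k u
  have "ambient_isotopic (path_closure S (F 0)) (path_closure S (F 1))"
  proof (rule homotopy_path_closure[where f = f])
    fix k assume k: "k \<in> S"
    have "is_lipschitz_on ({0..1} \<times> {0..1}) (\<lambda>x::real \<times> real. p k (snd x))"
      "is_lipschitz_on ({0..1} \<times> {0..1}) (\<lambda>x::real \<times> real. q k (snd x))"
      by (rule is_lipschitz_on_compose[OF lip(1)[OF k]] is_lipschitz_on_compose[OF lip(2)[OF k]],
          auto intro: is_lip_intros)+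
    then show "\<exists>L. L-lipschitz_on ({0..1} \<times> {0..1}) (\<lambda>x. F (fst x) k (snd x))"
      unfolding is_lipschitz_on_def[symmetric] F_def
      by (intro is_lip_intros compact_Times compact_Icc)
    fix s u :: real assume s: "s \<in> {0..1}" and u: "u \<in> {0..1}"
    show "0 < fst (F s k u)"
      using pos[OF k u] s by (cases "s = 0") (auto simp: F_def intro: add_nonneg_pos)
  qed (use S cl inj in \<open>auto simp: F_def\<close>)
  moreover have "F 0 = p" "F 1 = q" by (intro ext; simp add: F_def)+
  ultimately show ?thesis by simp
qed

text \<open>Intermediate times give intermediate positions on the same strands, so nothing collides. The
  shift by \<open>c\<close> towards the axis serves to renumber the strands when the innermost one has
  disappeared.\<close>

lemma word_path_reparametrization:
  assumes S: "finite S" "\<And>k. k \<in> S \<Longrightarrow> word_perm w k \<in> S"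
    and c: "0 \<le> c" "\<And>k t. k \<in> S \<Longrightarrow> c < fst (word_path w k t)"
    and T: "is_lipschitz_on {0..1} T" "T 0 \<le> 0" "real (length w) \<le> T 1"
    and T': "is_lipschitz_on {0..1} T'" "T' 0 \<le> 0" "real (length w) \<le> T' 1"
  shows "ambient_isotopic (path_closure S (\<lambda>k u. word_path w k (T u)))
    (path_closure S (\<lambda>k u. word_path w k (T' u) - (c, 0)))"
proof -
  define F where "F s k u = word_path w k ((1 - s) * T u + s * T' u) - (s * c, 0)" for s k u
  have "ambient_isotopic (path_closure S (F 0)) (path_closure S (F 1))"
  proof (rule homotopy_path_closure[where f = "word_perm w"])
    fix k assume k: "k \<in> S"
    have "is_lipschitz_on ({0..1} \<times> {0..1}) (\<lambda>x::real \<times> real. T (snd x))"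
      "is_lipschitz_on ({0..1} \<times> {0..1}) (\<lambda>x::real \<times> real. T' (snd x))"
      by (rule is_lipschitz_on_compose[OF T(1)] is_lipschitz_on_compose[OF T'(1)],
          auto intro: is_lip_intros)+
    then show "\<exists>L. L-lipschitz_on ({0..1} \<times> {0..1}) (\<lambda>x. F (fst x) k (snd x))"
      unfolding is_lipschitz_on_def[symmetric] F_def
      by (intro is_lip_intros compact_Times compact_Icc)
    fix s u :: real and l assume s: "s \<in> {0..1}" and u: "u \<in> {0..1}"
    have "(1 - s) * T 0 + s * T' 0 \<le> (1 - s) * 0 + s * 0"
      using s T T' by (intro add_mono mult_left_mono) auto
    moreover have "(1 - s) * real (length w) + s * real (length w) \<le> (1 - s) * T 1 + s * T' 1"
      using s T T' by (intro add_mono mult_left_mono) auto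
    ultimately show "F s k 1 = F s (word_perm w k) 0" by (simp add: F_def algebra_simps)
    have "s * c \<le> c" using s c(1) by (simp add: mult_left_le_one_le)
    then show "0 < fst (F s k u)" using c(2)[OF k, of "(1 - s) * T u + s * T' u"] by (simp add: F_def)
    assume "k \<noteq> l"
    then show "F s k u \<noteq> F s l u" using word_path_inj by (auto simp: F_def)
  qed (use S in auto)
  moreover have "F 0 = (\<lambda>k u. word_path w k (T u))" "F 1 = (\<lambda>k u. word_path w k (T' u) - (c, 0))"
    by (intro ext; simp add: F_def flip: zero_prod_def)+
  ultimately show ?thesis by simp
qed


text \<open>The move that removes the innermost strand. The strand that \<open>\<sigma>\<^sub>1\<close> moves from position 2 to position 1
  rests there for the remaining sectors and is moved back by \<open>\<sigma>\<^sub>1\<close> in the next turn. If \<open>\<sigma>\<^sub>1\<close> takes the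
  first half of the turn, this piece can be deformed into the following path, which starts at
  \<open>(2, 0)\<close>, runs once around the axis (\<open>0 \<le> v \<le> 1\<close>) and comes back to \<open>(2, 0)\<close> at \<open>v = 3/2\<close>. In terms of
  \<open>\<tau> = 8/5 (v - 3/4)\<close>, which ranges over \<open>[-6/5, 6/5]\<close>, the height is \<open>\<tau>\<close> itself for \<open>\<bar>\<tau>\<bar> \<le> 1\<close> and
  returns to 0 at both ends. The part with \<open>\<bar>\<tau>\<bar> \<le> 1\<close> is the one that will be straightened; it makes
  more than a full turn, so that after straightening it still progresses around the axis.\<close>

definition loop_height :: "real \<Rightarrow> real" where
  "loop_height \<tau> = \<tau> - 6 * max 0 (\<tau> - 1) + 6 * max 0 (- 1 - \<tau>)"

definition loop_path :: "real \<Rightarrow> real \<times> real" where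
  "loop_path v = (1 + 4 / 3 * \<bar>v - 3 / 4\<bar>, loop_height (8 / 5 * (v - 3 / 4)))"

lemma loop_path_ends: "loop_path 0 = (2, 0)" "loop_path (3 / 2) = (2, 0)"
  by (simp_all add: loop_path_def loop_height_def max_def)

lemma is_lipschitz_on_loop_path:
  "is_lipschitz_on A f \<Longrightarrow> is_lipschitz_on A (\<lambda>x. loop_path (f x))"
  unfolding loop_path_def loop_height_def by (intro is_lip_intros)

lemma loop_path_mid:
  assumes "\<bar>\<tau>\<bar> \<le> 1"
  shows "loop_path (3 / 4 + 5 / 8 * \<tau>) = (1 + 5 / 6 * \<bar>\<tau>\<bar>, \<tau>)"
  using assms by (auto simp: loop_path_def loop_height_def abs_mult)

text \<open>The two passages of the loop through a half-plane lie above each other in the same order as the two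
  strands exchanged by \<open>\<sigma>\<^sub>1\<close>.\<close>

lemma loop_path_height_less:
  assumes "0 \<le> u" "u \<le> 1 / 2"
  shows "snd (loop_path u) < snd (loop_path (1 + u))"
  using assms by (auto simp: loop_path_def loop_height_def max_def field_simps)

lemma is_lipschitz_on_concat:
  fixes f g :: "real \<Rightarrow> 'a::metric_space"
  assumes "is_lipschitz_on {a..b} f" "is_lipschitz_on {b..c} g" "f b = g b" "a \<le> b" "b \<le> c"
  shows "is_lipschitz_on {a..c} (\<lambda>x. if x \<le> b then f x else g x)"
  using assms lipschitz_on_concat_max[of _ a b f _ c g] unfolding is_lipschitz_on_def by blast

lemma arc_exchange_isotopic:
  fixes c d :: "'a \<Rightarrow> real^3"
  assumes inside: "\<And>x y t. x \<in> T \<Longrightarrow> y \<in> T \<Longrightarrow> 0 \<le> t \<Longrightarrow> t \<le> 1 \<Longrightarrow>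
      norm ((d x - c x) - (d y - c y)) \<le> C * norm ((c x + t *\<^sub>R (d x - c x)) - (c y + t *\<^sub>R (d y - c y)))"
    and outside: "\<And>x a t. x \<in> T \<Longrightarrow> a \<in> A \<Longrightarrow> 0 \<le> t \<Longrightarrow> t \<le> 1 \<Longrightarrow>
      norm (d x - c x) \<le> C * norm ((c x + t *\<^sub>R (d x - c x)) - a)"
    and C: "0 \<le> C"
  shows "ambient_isotopic (A \<union> c ` T) (A \<union> d ` T)"
proof -
  let ?P = "Inl ` A \<union> Inr ` T"
  have "ambient_isotopic (case_sum (\<lambda>x. x) c ` ?P) (case_sum (\<lambda>x. x) d ` ?P)"
  proof (rule linear_homotopy_isotopic[where C = C])
    fix p q :: "real^3 + 'a" and t :: real
    assume "p \<in> ?P" "q \<in> ?P" "0 \<le> t" "t \<le> 1"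
    then show "norm ((case_sum (\<lambda>x. x) d p - case_sum (\<lambda>x. x) c p) - (case_sum (\<lambda>x. x) d q - case_sum (\<lambda>x. x) c q))
      \<le> C * norm ((case_sum (\<lambda>x. x) c p + t *\<^sub>R (case_sum (\<lambda>x. x) d p - case_sum (\<lambda>x. x) c p))
        - (case_sum (\<lambda>x. x) c q + t *\<^sub>R (case_sum (\<lambda>x. x) d q - case_sum (\<lambda>x. x) c q)))"
      using inside outside C by (auto simp: norm_minus_commute)
  qed
  then show ?thesis by (simp add: image_Un image_image)
qed

definition horizontal :: "real^3 \<Rightarrow> real \<times> real" where
  "horizontal x = (x $ 1, x $ 2)"

lemma norm_horizontal_spin: "norm (horizontal (spin p \<theta>)) = \<bar>fst p\<bar>"
proof -
  have "(fst p * cos \<theta>)\<^sup>2 + (fst p * sin \<theta>)\<^sup>2 = (fst p)\<^sup>2 * ((sin \<theta>)\<^sup>2 + (cos \<theta>)\<^sup>2)" by algebra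
  then show ?thesis by (simp add: horizontal_def spin_def cylindrical_def norm_prod_def)
qed

lemma norm_horizontal_le: "norm (horizontal x) \<le> norm x"
  by (simp add: horizontal_def norm_prod_def norm_vec_def L2_set_def sum_3)

lemma horizontal_linear:
  "horizontal (x + y) = horizontal x + horizontal y" "horizontal (x - y) = horizontal x - horizontal y"
  "horizontal (t *\<^sub>R x) = t *\<^sub>R horizontal x"
  by (simp_all add: horizontal_def)

text \<open>Inside the cylinder of radius \<open>11/6\<close> the loop is the arc \<open>c\<close> below, which makes more than one
  turn. The arc \<open>d\<close> has the same end points and makes a quarter turn. At equal parameters both are
  at the same height, which is the parameter, so that the segments joining them stay disjoint, and
  by convexity these segments stay inside the cylinder.\<close>

lemma loop_removal_isotopic:
  fixes A :: "(real^3) set"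
  assumes A: "\<And>a. a \<in> A \<Longrightarrow> 11 / 6 \<le> norm (horizontal a)"
  shows "ambient_isotopic
    (A \<union> (\<lambda>\<tau>. spin (1 + 5 / 6 * \<bar>\<tau>\<bar>, \<tau>) (3 / 2 * pi + 5 / 4 * pi * \<tau>)) ` {-1..1})
    (A \<union> (\<lambda>\<tau>. spin (1 + 5 / 6 * \<bar>\<tau>\<bar>, \<tau>) (1 / 2 * pi + 1 / 4 * pi * \<tau>)) ` {-1..1})"
proof -
  define r where "r \<tau> = (1 + 5 / 6 * \<bar>\<tau>\<bar>, \<tau>)" for \<tau> :: real
  define c where "c \<tau> = spin (r \<tau>) (3 / 2 * pi + 5 / 4 * pi * \<tau>)" for \<tau>
  define d where "d \<tau> = spin (r \<tau>) (1 / 2 * pi + 1 / 4 * pi * \<tau>)" for \<tau>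
  define D where "D \<tau> = d \<tau> - c \<tau>" for \<tau>
  have arcL: "norm (spin (r x) (a + b * x) - spin (r y) (a + b * y)) \<le> (2 + 2 * \<bar>b\<bar>) * \<bar>x - y\<bar>"
    if "x \<in> {-1..1}" "y \<in> {-1..1}" for a b x y :: real
  proof -
    have "norm (spin (r x) (a + b * x) - spin (r y) (a + b * y))
        \<le> norm (r x - r y) + 2 * \<bar>(a + b * x) - (a + b * y)\<bar>"
      by (rule norm_spin_diff_upper) (use that in \<open>auto simp: r_def\<close>)
    moreover have "norm (r x - r y) \<le> \<bar>5 / 6 * \<bar>x\<bar> - 5 / 6 * \<bar>y\<bar>\<bar> + \<bar>x - y\<bar>"
      using norm_Pair_le[of "5 / 6 * \<bar>x\<bar> - 5 / 6 * \<bar>y\<bar>" "x - y"] by (simp add: r_def)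
    moreover have "\<bar>5 / 6 * \<bar>x\<bar> - 5 / 6 * \<bar>y\<bar>\<bar> \<le> \<bar>x - y\<bar>" by linarith
    moreover have "\<bar>(a + b * x) - (a + b * y)\<bar> = \<bar>b\<bar> * \<bar>x - y\<bar>"
      by (simp add: abs_mult flip: right_diff_distrib)
    ultimately show ?thesis by (simp add: algebra_simps)
  qed
  define K where "K = 4 + 3 * pi"
  have K: "0 \<le> K" by (simp add: K_def)
  have DL: "norm (D x - D y) \<le> K * \<bar>x - y\<bar>" if "x \<in> {-1..1}" "y \<in> {-1..1}" for x y
  proof -
    have "D x - D y = (d x - d y) - (c x - c y)" by (simp add: D_def)
    then have "norm (D x - D y) \<le> norm (d x - d y) + norm (c x - c y)" by (metis norm_triangle_ineq4)
    then show ?thesis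
      using arcL[OF that, of "1 / 2 * pi" "1 / 4 * pi"] arcL[OF that, of "3 / 2 * pi" "5 / 4 * pi"]
      by (simp add: c_def d_def K_def algebra_simps)
  qed
  have ends: "D 1 = 0" "D (-1) = 0"
  proof -
    have "3 / 2 * pi + 5 / 4 * pi = (1 / 2 * pi + 1 / 4 * pi) + 2 * pi"
      "3 / 2 * pi - 5 / 4 * pi = 1 / 2 * pi - 1 / 4 * pi" by simp_all
    then show "D 1 = 0" "D (-1) = 0"
      using spin_period[of "r 1" "1 / 2 * pi + 1 / 4 * pi"] by (simp_all add: D_def c_def d_def)
  qed
  have Dend: "norm (D x) \<le> K * (1 - \<bar>x\<bar>)" if x: "x \<in> {-1..1}" for x
  proof (cases "0 \<le> x")
    case True then show ?thesis using DL[OF x, of 1] ends x by simp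
  next
    case False then show ?thesis using DL[OF x, of "-1"] ends x by (simp add: add.commute)
  qed
  have third: "(c x + t *\<^sub>R (d x - c x)) $ 3 = x" for x t
    by (simp add: c_def d_def r_def spin_def cylindrical_def)
  have radius: "norm (horizontal (c x + t *\<^sub>R (d x - c x))) \<le> 1 + 5 / 6 * \<bar>x\<bar>"
    if "0 \<le> t" "t \<le> 1" for x t
  proof -
    have "horizontal (c x + t *\<^sub>R (d x - c x)) = (1 - t) *\<^sub>R horizontal (c x) + t *\<^sub>R horizontal (d x)"
      by (simp add: horizontal_linear algebra_simps)
    also have "norm \<dots> \<le> (1 - t) * norm (horizontal (c x)) + t * norm (horizontal (d x))"
      using that by (intro order_trans[OF norm_triangle_ineq]) auto
    also have "\<dots> = 1 + 5 / 6 * \<bar>x\<bar>"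
    proof -
      have "norm (horizontal (c x)) = 1 + 5 / 6 * \<bar>x\<bar>" "norm (horizontal (d x)) = 1 + 5 / 6 * \<bar>x\<bar>"
        by (simp_all add: c_def d_def norm_horizontal_spin r_def)
      then show ?thesis by (simp add: left_diff_distrib)
    qed
    finally show ?thesis .
  qed
  have "ambient_isotopic (A \<union> c ` {-1..1}) (A \<union> d ` {-1..1})"
  proof (rule arc_exchange_isotopic[where C = "6 / 5 * K"])
    fix x y t :: real assume x: "x \<in> {-1..1}" and y: "y \<in> {-1..1}" and t: "0 \<le> t" "t \<le> 1"
    let ?N = "norm ((c x + t *\<^sub>R (d x - c x)) - (c y + t *\<^sub>R (d y - c y)))"
    have "\<bar>x - y\<bar> \<le> ?N"
      using component_le_norm_cart[of "(c x + t *\<^sub>R (d x - c x)) - (c y + t *\<^sub>R (d y - c y))" 3]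
      by (simp only: vector_minus_component third)
    then have "K * \<bar>x - y\<bar> \<le> K * ?N" by (rule mult_left_mono[OF _ K])
    moreover have "0 \<le> K * ?N" using K by simp
    ultimately have "K * \<bar>x - y\<bar> \<le> 6 / 5 * (K * ?N)" by linarith
    then show "norm ((d x - c x) - (d y - c y)) \<le> 6 / 5 * K * ?N"
      using DL[OF x y] by (simp add: D_def)
  next
    fix x t :: real and a assume x: "x \<in> {-1..1}" and a: "a \<in> A" and t: "0 \<le> t" "t \<le> 1"
    let ?p = "c x + t *\<^sub>R (d x - c x)"
    have "norm (horizontal a) - norm (horizontal ?p) \<le> norm (horizontal (?p - a))"
      by (simp add: horizontal_linear(2) norm_minus_commute norm_triangle_ineq2)
    also have "\<dots> \<le> norm (?p - a)" by (rule norm_horizontal_le)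
    finally have "5 / 6 * (1 - \<bar>x\<bar>) \<le> norm (?p - a)"
      using A[OF a] radius[OF t, of x] by (simp add: algebra_simps)
    then have "6 / 5 * K * (5 / 6 * (1 - \<bar>x\<bar>)) \<le> 6 / 5 * K * norm (?p - a)"
      using K by (intro mult_left_mono) auto
    moreover have "6 / 5 * K * (5 / 6 * (1 - \<bar>x\<bar>)) = K * (1 - \<bar>x\<bar>)" by simp
    ultimately show "norm (d x - c x) \<le> 6 / 5 * K * norm (?p - a)"
      using Dend[OF x] unfolding D_def by linarith
  qed (use K in simp)
  then show ?thesis by (simp add: c_def d_def r_def)
qed

lemma word_path_idle:
  "(\<And>a. a \<in> set w \<Longrightarrow> k < gen_index a) \<Longrightarrow> word_path w k t = (real k, 0)"
  "(\<And>a. a \<in> set w \<Longrightarrow> k < gen_index a) \<Longrightarrow> word_perm w k = k"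
proof (induction w arbitrary: t)
  case (Cons a w)
  have step: "letter_perm a k = k \<and> strand a k x = (real k, 0)"
    if "\<And>b. b \<in> set (a # w) \<Longrightarrow> k < gen_index b" for x
  proof -
    have "k < gen_index a" using that by simp
    then show ?thesis by (auto simp: strand_other letter_perm.simps)
  qed
  { case 1
    then show ?case using Cons.IH(1) step[OF 1] by simp
  next
    case 2
    then show ?case using Cons.IH(2) step[OF 2] by simp }
qed simp_all

lemma word_perm_ge:
  "(\<And>a. a \<in> set w \<Longrightarrow> m \<le> gen_index a) \<Longrightarrow> m \<le> k \<Longrightarrow> m \<le> word_perm w k"
  by (induction w arbitrary: k) (auto simp: letter_perm.simps)

lemma strand_shift:
  "1 \<le> gen_index a \<Longrightarrow> 1 \<le> k \<Longrightarrow>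
    strand (map_index (\<lambda>i. i - 1) a) (k - 1) t = strand a k t - (1, 0)"
  "1 \<le> gen_index a \<Longrightarrow> 1 \<le> k \<Longrightarrow> letter_perm (map_index (\<lambda>i. i - 1) a) (k - 1) = letter_perm a k - 1"
  by (auto simp: strand_def Let_def letter_perm.simps of_nat_diff)

lemma word_path_shift:
  assumes "\<And>a. a \<in> set w \<Longrightarrow> 1 \<le> gen_index a" "1 \<le> k"
  shows "word_path (map (map_index (\<lambda>i. i - 1)) w) (k - 1) t = word_path w k t - (1, 0)"
  using assms
proof (induction w arbitrary: k t)
  case (Cons a w)
  have "1 \<le> letter_perm a k" using Cons.prems by (auto simp: letter_perm.simps)
  then show ?case using Cons.IH[of "letter_perm a k"] Cons.prems strand_shift[of a k]
    by (simp add: of_nat_diff)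
qed (simp add: of_nat_diff)

text \<open>The word \<open>w\<close> is first compressed into the second half of the turn (\<open>F0\<close>). The path of the innermost
  strand is then deformed into the loop (\<open>F1\<close>), the loop is replaced by a short arc (\<open>F2\<close>), and this
  arc is finally deformed into a strand at rest (\<open>R\<close>).\<close>

lemma closed_braid_loop:
  assumes w: "w \<in> braid_words (Suc n)" and low: "\<And>a. a \<in> set w \<Longrightarrow> 2 \<le> gen_index a" and n: "1 \<le> n"
  shows "ambient_isotopic (closed_braid (Suc n) (Gen 1 # w))
    (path_closure {2..Suc n} (\<lambda>k u. word_path w k (real (length w) * (2 * u - 1))))"
proof -
  let ?m = "real (length w)" and ?S = "{1..Suc n}"
  define T where "T u = min 1 (2 * u) + ?m * max 0 (2 * u - 1)" for u :: real
  define F0 where "F0 k u = word_path (Gen 1 # w) k (T u)" for k u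
  define R where "R k u = word_path w k (?m * (2 * u - 1))" for k u
  define F1 where "F1 k u = (if k = 2 then loop_path u
      else if k = 1 then loop_path (1 + min u (1 / 2)) + (R 2 u - (2, 0)) else R k u)" for k u
  define mid where "mid u = (1 + 5 / 6 * \<bar>8 * u - 2\<bar>, 8 * u - 2)" for u :: real
  define F2 where "F2 k u = (if k = 2 then if u \<le> 1 / 8 then F1 2 u
      else if u \<le> 3 / 8 then mid u else F1 1 u else F1 k u)" for k u
  have vw: "Gen 1 # w \<in> braid_words (Suc n)" using w n by (simp add: braid_words_Cons)
  have perm: "\<And>k. k \<in> ?S \<Longrightarrow> word_perm (Gen 1 # w) k \<in> ?S" using word_perm_in[OF vw] by blast
  have Rge: "2 \<le> fst (R k u)" if "2 \<le> k" for k u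
    using word_path_fst_ge[of 2 k w] low that by (simp add: R_def)
  have Rinj: "R k u = R l u \<Longrightarrow> k = l" for k l u unfolding R_def by (rule word_path_inj)
  have Rstart: "R k u = (real k, 0)" if "u \<le> 1 / 2" for k u
    using that by (simp add: R_def mult_nonneg_nonpos)
  have R1: "R 1 u = (1, 0)" for u
    using word_path_idle(1)[of w 1] low by (force simp: R_def)
  have Rend: "R k 1 = (real (word_perm w k), 0)" for k by (simp add: R_def)
  have perm1: "word_perm w 1 = 1" using word_path_idle(2)[of w 1] low by force
  have perm2: "2 \<le> word_perm w k" if "2 \<le> k" for k using word_perm_ge[of w 2 k] low that by blast
  have Rlip: "is_lipschitz_on {0..1} (R k)" for k
    unfolding R_def by (intro is_lip_intros)
  have F0_early: "F0 k u = strand (Gen 1) k (2 * u)" if "0 \<le> u" "u \<le> 1 / 2" for k u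
    using that by (simp add: F0_def T_def word_path_Cons del: word_path.simps)
  have F0_late: "F0 k u = R (letter_perm (Gen 1) k) u" if "1 / 2 \<le> u" for k u
    using that by (simp add: F0_def T_def R_def word_path_Cons del: word_path.simps)
  have F0_inj: "F0 k u = F0 l u \<Longrightarrow> k = l" for k l u unfolding F0_def by (rule word_path_inj)
  have F01: "F1 k u = F0 k u" if "1 / 2 \<le> u" "k \<noteq> 2" for k u
    using that by (auto simp: F1_def F0_late letter_perm.simps loop_path_ends numeral_2_eq_2)
  have F1_early: "F1 1 u = loop_path (1 + u)" if "u \<le> 1 / 2" for u
    using that Rstart[OF that, of 2] by (simp add: F1_def min_def)
  have F1_2: "F1 2 u = loop_path u" for u by (simp add: F1_def)
  have F1_late: "F1 1 u = R 2 u" if "1 / 2 \<le> u" for u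
  proof -
    have "min u (1 / 2) = 1 / 2" using that by simp
    then show ?thesis by (simp add: F1_def loop_path_ends flip: zero_prod_def)
  qed
  have F1_other: "F1 k u = R k u" if "3 \<le> k" for k u using that by (simp add: F1_def)
  have loop_fst: "1 \<le> fst (loop_path v)" "0 \<le> v \<Longrightarrow> v \<le> 3 / 2 \<Longrightarrow> fst (loop_path v) \<le> 2"
    "1 / 2 \<le> v \<Longrightarrow> v \<le> 1 \<Longrightarrow> fst (loop_path v) \<le> 4 / 3"
    "v \<le> 1 / 8 \<Longrightarrow> 11 / 6 \<le> fst (loop_path v)" "11 / 8 \<le> v \<Longrightarrow> 11 / 6 \<le> fst (loop_path v)" for v
    by (auto simp: loop_path_def abs_if)
  \<comment> \<open>The strand starting at position 2 runs along the loop during the first turn, the one starting at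
    position 1 during the next half turn, after which it has arrived at position 2.\<close>
  have three: "k = 1 \<or> k = 2 \<or> 3 \<le> k" if "1 \<le> k" for k :: nat using that by auto
  have F1_ge: "1 \<le> fst (F1 k u)" if ku: "k \<in> ?S" "u \<in> {0..1}" for k u
  proof -
    consider "k = 2" | "k = 1" "u \<le> 1 / 2" | "k = 1" "1 / 2 \<le> u" | "3 \<le> k"
      using three[of k] linear[of u "1/2"] ku by auto
    then show ?thesis
      by cases (use loop_fst(1) F1_2 F1_early F1_late F1_other Rge[of _ u] in
        \<open>auto intro: order_trans[of 1 "2::real"]\<close>)
  qed
  have F1_lip: "is_lipschitz_on {0..1} (F1 k)" for k
    unfolding F1_def
    by (cases "k = 2"; cases "k = 1") (auto intro!: is_lip_intros is_lipschitz_on_loop_path Rlip)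
  have a: "ambient_isotopic (closed_braid (Suc n) (Gen 1 # w)) (path_closure ?S F0)"
  proof -
    have "ambient_isotopic
        (path_closure ?S (\<lambda>k u. word_path (Gen 1 # w) k (real (length (Gen 1 # w)) * u)))
        (path_closure ?S (\<lambda>k u. word_path (Gen 1 # w) k (T u) - (0, 0)))"
    proof (rule word_path_reparametrization[OF _ perm])
      show "is_lipschitz_on {0..1} T" unfolding T_def by (intro is_lip_intros)
      show "is_lipschitz_on {0..1} (\<lambda>u. real (length (Gen 1 # w)) * u)" by (intro is_lip_intros)
      fix k t assume "k \<in> ?S"
      then show "0 < fst (word_path (Gen 1 # w) k t)" using word_path_fst_pos[OF vw, of k t] by auto
    qed (auto simp: T_def)
    moreover have "F0 = (\<lambda>k u. word_path (Gen 1 # w) k (T u) - (0, 0))"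
      by (intro ext) (simp add: F0_def del: word_path.simps flip: zero_prod_def)
    ultimately show ?thesis by (simp only: closed_braid_path_closure[OF vw])
  qed
  have b: "ambient_isotopic (path_closure ?S F0) (path_closure ?S F1)"
  proof (rule linear_path_homotopy[where f = "word_perm (Gen 1 # w)"])
    fix k assume k: "k \<in> ?S"
    show "word_perm (Gen 1 # w) k \<in> ?S" by (rule perm[OF k])
    have s1: "F0 j 0 = (real j, 0)" for j using F0_early[of 0] by simp
    have e0: "F0 k 1 = (real (word_perm (Gen 1 # w) k), 0)" by (simp add: F0_late Rend)
    then show "F0 k 1 = F0 (word_perm (Gen 1 # w) k) 0" by (simp add: s1 del: word_perm.simps)
    show "F1 k 1 = F1 (word_perm (Gen 1 # w) k) 0"
    proof (cases "k = 2")
      case True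
      have "word_perm (Gen 1 # w) 2 = 1" using perm1 by (simp add: letter_perm.simps)
      then show ?thesis using True F1_early[of 0] F1_2[of 1] by simp
    next
      case False
      have "2 \<le> word_perm (Gen 1 # w) k"
        using False k perm2 by (auto simp: letter_perm.simps)
      then have "F1 (word_perm (Gen 1 # w) k) 0 = (real (word_perm (Gen 1 # w) k), 0)"
        by (auto simp: F1_def loop_path_ends Rstart simp del: word_perm.simps)
      then show ?thesis using F01[of 1 k] False e0 by simp
    qed
    show "is_lipschitz_on {0..1} (F0 k)"
      unfolding F0_def T_def by (intro is_lip_intros)
    show "is_lipschitz_on {0..1} (F1 k)" by (rule F1_lip)
    fix u :: real assume u: "u \<in> {0..1}"
    show "0 < fst (F0 k u) \<and> 0 < fst (F1 k u)"
      using F1_ge[OF k u] word_path_fst_pos[OF vw, of k "T u"] k by (auto simp: F0_def simp del: word_path.simps)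
    fix s :: real and l assume s: "0 \<le> s" "s \<le> 1" and l: "l \<in> ?S" "k \<noteq> l"
    let ?G = "\<lambda>k. (1 - s) *\<^sub>R F0 k u + s *\<^sub>R F1 k u"
    have fstG: "fst (?G k) = (1 - s) * fst (F0 k u) + s * fst (F1 k u)" for k by simp
    have below: "fst (?G k) \<le> x" if "fst (F0 k u) \<le> x" "fst (F1 k u) \<le> x" for k x
      unfolding fstG by (rule convex_bound_le) (use that s in auto)
    have above: "x \<le> fst (?G k)" if "x \<le> fst (F0 k u)" "x \<le> fst (F1 k u)" for k x
    proof -
      have "(1 - s) * x + s * x \<le> fst (?G k)"
        unfolding fstG using that s by (intro add_mono mult_left_mono) auto
      then show ?thesis by (simp add: algebra_simps)
    qed
    have ne: "?G i \<noteq> ?G j" if ij: "i \<in> ?S" "j \<in> ?S" "i < j" for i j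
    proof (cases "u \<le> 1 / 2")
      case early: True
      have F0_le: "fst (F0 i u) \<le> 2" if "i = 1 \<or> i = 2" for i
        using strand_fst_range(2)[of i "Gen 1" "2 * u"] that F0_early[OF _ early] u by auto
      have F1_le: "fst (F1 i u) \<le> 2" if "i = 1 \<or> i = 2" for i
        using that F1_early[OF early] F1_2 loop_fst(2)[of u] loop_fst(2)[of "1 + u"] u early by auto
      have big: "?G j = (real j, 0)" if "3 \<le> j" for j
        using that early u by (simp add: F0_early strand_other F1_other Rstart algebra_simps)
      consider "i = 1" "j = 2" | "i = 1 \<or> i = 2" "3 \<le> j" | "3 \<le> i" "3 \<le> j"
        using three[of i] three[of j] ij by auto
      then show ?thesis
      proof cases
        case 1
        show ?thesis
        proof (cases "s = 0")
          case True then show ?thesis using F0_inj[of i u j] ij by auto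
        next
          case False
          have "snd (F0 1 u) - snd (F0 2 u) = sin (pi * (2 * u))"
            using early u by (simp add: F0_early strand_def Let_def)
          moreover have "0 \<le> sin (pi * (2 * u))" using early u by (intro sin_ge_zero) auto
          moreover have "snd (F1 2 u) < snd (F1 1 u)"
            using loop_path_height_less[of u] F1_early[OF early] F1_2 early u by simp
          ultimately have "0 \<le> (1 - s) * (snd (F0 1 u) - snd (F0 2 u))"
            "0 < s * (snd (F1 1 u) - snd (F1 2 u))" using s False by auto
          then have "snd (?G 2) < snd (?G 1)" by (simp add: algebra_simps)
          then show ?thesis unfolding 1 by (metis less_irrefl)
        qed
      next
        case 2
        then have "fst (?G i) \<le> 2" using F0_le F1_le by (intro below) auto
        moreover have "fst (?G j) = real j" by (simp only: big[OF 2(2)] fst_conv)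
        ultimately have "fst (?G i) < fst (?G j)" using 2(2) by linarith
        then show ?thesis by (metis less_irrefl)
      next
        case 3 then show ?thesis using big[of i] big[of j] ij by simp
      qed
    next
      case False
      then have late: "1 / 2 \<le> u" by simp
      have same: "?G k = F0 k u" if "k \<noteq> 2" for k
        using F01[OF late that] by (simp flip: scaleR_left_distrib)
      have G2: "fst (?G 2) \<le> 4 / 3"
        using F0_late[OF late, of 2] R1 F1_2 loop_fst(3)[OF late] u
        by (intro below) (auto simp: letter_perm.simps)
      have G': "2 \<le> fst (?G k)" if "k \<in> ?S" "k \<noteq> 2" for k
        using that same[OF that(2)] F0_late[OF late, of k] Rge[of "letter_perm (Gen 1) k" u]
        by (auto simp: letter_perm.simps split: if_splits)
      show ?thesis
      proof (cases "i = 2 \<or> j = 2")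
        case True
        then have "fst (?G i) < fst (?G j) \<or> fst (?G j) < fst (?G i)"
          using G2 G'[OF ij(1)] G'[OF ij(2)] ij(3) by force
        then show ?thesis by (metis less_irrefl)
      next
        case False
        then show ?thesis using same[of i] same[of j] F0_inj[of i u j] ij by auto
      qed
    qed
    show "?G k \<noteq> ?G l"
      using ne[OF k l(1)] ne[OF l(1) k] l(2) by (cases k l rule: linorder_cases) auto
  qed simp
  have c: "ambient_isotopic (path_closure ?S F1) (path_closure {2..Suc n} F2)"
  proof -
    \<comment> \<open>The points of the closure that belong to the arc to be exchanged.\<close>
    define M where "M k u \<longleftrightarrow> k = 2 \<and> 1 / 8 \<le> u \<or> k = 1 \<and> u \<le> 3 / 8" for k :: nat and u :: real
    define A where "A = {spin (F1 k u) (2 * pi * u) | k u. k \<in> ?S \<and> 0 \<le> u \<and> u \<le> 1 \<and> \<not> M k u}"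
    define c where "c \<tau> = spin (1 + 5 / 6 * \<bar>\<tau>\<bar>, \<tau>) (3 / 2 * pi + 5 / 4 * pi * \<tau>)" for \<tau> :: real
    define d where "d \<tau> = spin (1 + 5 / 6 * \<bar>\<tau>\<bar>, \<tau>) (1 / 2 * pi + 1 / 4 * pi * \<tau>)" for \<tau> :: real
    have "ambient_isotopic (A \<union> c ` {-1..1}) (A \<union> d ` {-1..1})"
      unfolding c_def d_def
    proof (rule loop_removal_isotopic)
      fix a assume "a \<in> A"
      then obtain k u where a: "a = spin (F1 k u) (2 * pi * u)" and k: "k \<in> ?S" "0 \<le> u" "u \<le> 1" "\<not> M k u"
        by (auto simp: A_def)
      consider "k = 2" "u \<le> 1 / 8" | "k = 1" "3 / 8 \<le> u" "u \<le> 1 / 2" | "k = 1" "1 / 2 \<le> u" | "3 \<le> k"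
        using three[of k] linear[of u "1/2"] k by (auto simp: M_def)
      then have "11 / 6 \<le> fst (F1 k u)"
      proof cases
        case 1 then show ?thesis using loop_fst(4)[of u] F1_2 by simp
      next
        case 2 then show ?thesis using loop_fst(5)[of "1 + u"] F1_early by simp
      next
        case 3 then show ?thesis using Rge[of 2 u] F1_late by simp
      next
        case 4 then show ?thesis using Rge[of k u] F1_other by simp
      qed
      then show "11 / 6 \<le> norm (horizontal a)" by (simp add: a norm_horizontal_spin)
    qed
    moreover have "A \<union> c ` {-1..1} = path_closure ?S F1"
    proof -
      have cv: "c (8 / 5 * (v - 3 / 4)) = spin (loop_path v) (2 * pi * v)" if "1 / 8 \<le> v" "v \<le> 11 / 8" for v
      proof -
        have "\<bar>8 / 5 * (v - 3 / 4)\<bar> \<le> 1" using that by (auto simp: abs_le_iff)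
        note loop_path_mid[OF this]
        moreover have "3 / 4 + 5 / 8 * (8 / 5 * (v - 3 / 4)) = v" by (simp add: field_simps)
        moreover have "3 / 2 * pi + 5 / 4 * pi * (8 / 5 * (v - 3 / 4)) = 2 * pi * v"
          by (simp add: field_simps)
        ultimately show ?thesis unfolding c_def by metis
      qed
      have 1: "x \<in> path_closure ?S F1" if xc: "x \<in> c ` {-1..1}" for x
      proof -
        obtain \<tau> where \<tau>: "\<tau> \<in> {-1..1}" "x = c \<tau>" using xc by auto
        define v where "v = 3 / 4 + 5 / 8 * \<tau>"
        have v: "1 / 8 \<le> v" "v \<le> 11 / 8" "\<tau> = 8 / 5 * (v - 3 / 4)" using \<tau> by (auto simp: v_def)
        have x: "x = spin (loop_path v) (2 * pi * v)" by (metis cv[OF v(1,2)] v(3) \<tau>(2))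
        show ?thesis
        proof (cases "v \<le> 1")
          case True
          then show ?thesis unfolding path_closure_def using x v F1_2 n
            by (intro CollectI exI[of _ 2] exI[of _ v]) auto
        next
          case False
          have "x = spin (F1 1 (v - 1)) (2 * pi * (v - 1))"
            using spin_period[of "loop_path v" "2 * pi * (v - 1)"] F1_early[of "v - 1"] v x
            by (simp add: algebra_simps)
          then show ?thesis unfolding path_closure_def using v False
            by (intro CollectI exI[of _ 1] exI[of _ "v - 1"]) auto
        qed
      qed
      have 2: "spin (F1 k u) (2 * pi * u) \<in> c ` {-1..1}" if ku: "M k u" "0 \<le> u" "u \<le> 1" for k u
      proof -
        obtain v where v: "1 / 8 \<le> v" "v \<le> 11 / 8" "spin (F1 k u) (2 * pi * u) = spin (loop_path v) (2 * pi * v)"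
        proof (cases "k = 2")
          case True
          then show ?thesis using ku F1_2 by (intro that[of u]) (auto simp: M_def)
        next
          case False
          then have "k = 1" "u \<le> 3 / 8" using ku by (auto simp: M_def)
          then show ?thesis
            using ku(2) spin_period[of "loop_path (1 + u)" "2 * pi * u"] F1_early[of u]
            by (intro that[of "1 + u"]) (auto simp: algebra_simps)
        qed
        then show ?thesis using cv[OF v(1,2)] by (intro image_eqI[of _ _ "8 / 5 * (v - 3 / 4)"]) auto
      qed
      show ?thesis
      proof (intro equalityI subsetI)
        fix x assume "x \<in> A \<union> c ` {-1..1}"
        then show "x \<in> path_closure ?S F1" using 1 by (auto simp: A_def path_closure_def)
      next
        fix x assume "x \<in> path_closure ?S F1"
        then obtain k u where "x = spin (F1 k u) (2 * pi * u)" "k \<in> ?S" "0 \<le> u" "u \<le> 1"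
          by (auto simp: path_closure_def)
        then show "x \<in> A \<union> c ` {-1..1}" using 2[of k u] by (cases "M k u") (auto simp: A_def)
      qed
    qed
    moreover have "A \<union> d ` {-1..1} = path_closure {2..Suc n} F2"
    proof -
      have dv: "d (8 * u - 2) = spin (mid u) (2 * pi * u)" for u
        by (simp add: d_def mid_def algebra_simps)
      have mid_eq: "F2 2 u = mid u" if "1 / 8 \<le> u" "u \<le> 3 / 8" for u
      proof (cases "u = 1 / 8")
        case True
        show ?thesis
          unfolding True by (simp add: F2_def mid_def F1_2 loop_path_def loop_height_def max_def)
      qed (use that in \<open>simp add: F2_def\<close>)
      show ?thesis
      proof (intro equalityI subsetI)
        fix x assume "x \<in> A \<union> d ` {-1..1}"
        then show "x \<in> path_closure {2..Suc n} F2"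
        proof
          assume "x \<in> A"
          then obtain k u where x: "x = spin (F1 k u) (2 * pi * u)" and k: "k \<in> ?S" "0 \<le> u" "u \<le> 1" "\<not> M k u"
            by (auto simp: A_def)
          have "F1 k u = F2 (max 2 k) u" using three[of k] k by (auto simp: F2_def M_def max_def)
          then show ?thesis unfolding path_closure_def using x k n
            by (intro CollectI exI[of _ "max 2 k"] exI[of _ u]) auto
        next
          assume "x \<in> d ` {-1..1}"
          then obtain \<tau> where \<tau>: "\<tau> \<in> {-1..1}" "x = d \<tau>" by auto
          define u where "u = (\<tau> + 2) / 8"
          have u: "1 / 8 \<le> u" "u \<le> 3 / 8" "\<tau> = 8 * u - 2" using \<tau> by (auto simp: u_def field_simps)
          then have "x = spin (F2 2 u) (2 * pi * u)" using \<tau>(2) dv[of u] mid_eq[of u] by metis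
          then show ?thesis unfolding path_closure_def using u n
            by (intro CollectI exI[of _ 2] exI[of _ u]) auto
        qed
      next
        fix x assume "x \<in> path_closure {2..Suc n} F2"
        then obtain k u where x: "x = spin (F2 k u) (2 * pi * u)" and k: "k \<in> {2..Suc n}" "0 \<le> u" "u \<le> 1"
          by (auto simp: path_closure_def)
        consider "k = 2" "1 / 8 \<le> u" "u \<le> 3 / 8" | "k = 2" "u < 1 / 8" | "k = 2" "3 / 8 < u" | "3 \<le> k"
          using three[of k] linear[of "1/8" u] linear[of u "3/8"] k by fastforce
        then show "x \<in> A \<union> d ` {-1..1}"
        proof cases
          case 1
          then have "x = d (8 * u - 2)" using x dv mid_eq by simp
          then show ?thesis using 1 by auto
        next
          case 2
          then have "x = spin (F1 2 u) (2 * pi * u)" "\<not> M 2 u" using x by (auto simp: F2_def M_def)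
          then show ?thesis using k 2 unfolding A_def by auto
        next
          case 3
          then have "x = spin (F1 1 u) (2 * pi * u)" "\<not> M 1 u" using x by (auto simp: F2_def M_def)
          moreover have "1 \<in> ?S" by simp
          ultimately show ?thesis using k 3 unfolding A_def by blast
        next
          case 4
          then have "x = spin (F1 k u) (2 * pi * u)" "\<not> M k u" using x by (auto simp: F2_def M_def)
          moreover have "k \<in> ?S" using k by simp
          ultimately show ?thesis using k unfolding A_def by blast
        qed
      qed
    qed
    ultimately show ?thesis by simp
  qed
  have d: "ambient_isotopic (path_closure {2..Suc n} F2) (path_closure {2..Suc n} R)"
  proof (rule linear_path_homotopy[where f = "word_perm w"])
    have late: "F2 k u = R k u" if "1 / 2 \<le> u" "2 \<le> k" for k u
      using that F1_late[of u] F1_other[of k u] by (auto simp: F2_def)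
    have other: "F2 k u = R k u" if "3 \<le> k" for k u using F1_other[OF that] that by (simp add: F2_def)
    fix k assume k: "k \<in> {2..Suc n}"
    show pk: "word_perm w k \<in> {2..Suc n}"
      using word_perm_in[OF w, of k] perm2[of k] k by auto
    have s: "R j 0 = (real j, 0)" "2 \<le> j \<Longrightarrow> F2 j 0 = (real j, 0)" for j
      using other[of j 0] by (auto simp: Rstart F2_def F1_2 loop_path_ends F1_other)
    show "R k 1 = R (word_perm w k) 0" by (simp add: Rend s)
    show "F2 k 1 = F2 (word_perm w k) 0" using late[of 1 k] pk k by (simp add: Rend s)
    show "is_lipschitz_on {0..1} (R k)" by (rule Rlip)
    show "is_lipschitz_on {0..1} (F2 k)"
    proof (cases "k = 2")
      case True
      have sub: "is_lipschitz_on {0..1/8} (F1 2)" "is_lipschitz_on {3/8..1} (F1 1)"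
        using is_lipschitz_on_compose[OF F1_lip[of 2] is_lipschitz_on_id[of "{0..1/8}"]]
          is_lipschitz_on_compose[OF F1_lip[of 1] is_lipschitz_on_id[of "{3/8..1}"]] by auto
      have "is_lipschitz_on {0..1} (\<lambda>u. if u \<le> 1 / 8 then F1 2 u else if u \<le> 3 / 8 then mid u else F1 1 u)"
      proof (rule is_lipschitz_on_concat)
        show "is_lipschitz_on {1/8..1} (\<lambda>u. if u \<le> 3 / 8 then mid u else F1 1 u)"
        proof (rule is_lipschitz_on_concat)
          show "is_lipschitz_on {1/8..3/8} mid" unfolding mid_def by (intro is_lip_intros)
          show "mid (3 / 8) = F1 1 (3 / 8)"
            using F1_early[of "3 / 8"] by (simp add: mid_def loop_path_def loop_height_def max_def)
        qed (use sub in auto)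
        show "F1 2 (1 / 8) = (if (1 / 8 :: real) \<le> 3 / 8 then mid (1 / 8) else F1 1 (1 / 8))"
          by (simp add: F1_2 mid_def loop_path_def loop_height_def max_def)
      qed (use sub in auto)
      moreover have "F2 2 = (\<lambda>u. if u \<le> 1 / 8 then F1 2 u else if u \<le> 3 / 8 then mid u else F1 1 u)"
        by (intro ext) (simp add: F2_def)
      ultimately show ?thesis using True by metis
    next
      case False
      then have "F2 k = R k" using other[of k] k by (intro ext) auto
      then show ?thesis by (simp add: Rlip)
    qed
    have F2_le: "1 \<le> fst (F2 2 u) \<and> fst (F2 2 u) \<le> 2" if "0 \<le> u" "u \<le> 1 / 2" for u
      using loop_fst(1,2)[of u] loop_fst(1,2)[of "1 + u"] F1_early[of u] that
      by (auto simp: F2_def F1_2 mid_def abs_if)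
    fix u :: real assume u: "u \<in> {0..1}"
    show "0 < fst (F2 k u) \<and> 0 < fst (R k u)"
    proof (cases "k = 2 \<and> u \<le> 1 / 2")
      case True then show ?thesis using F2_le[of u] Rge[of k u] u by auto
    next
      case False
      then have "F2 k u = R k u" using late[of u k] other[of k u] k by auto
      then show ?thesis using Rge[of k u] k by auto
    qed
    fix s :: real and l assume s': "0 \<le> s" "s \<le> 1" and l: "l \<in> {2..Suc n}" "k \<noteq> l"
    let ?G = "\<lambda>k. (1 - s) *\<^sub>R F2 k u + s *\<^sub>R R k u"
    have same: "?G k = R k u" if "F2 k u = R k u" for k
      using that by (simp flip: scaleR_left_distrib)
    show "?G k \<noteq> ?G l"
    proof (cases "1 / 2 \<le> u")
      case True
      then show ?thesis using same[of k] same[of l] late[OF True] k l Rinj[of k u l] by auto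
    next
      case False
      then have e: "u \<le> 1 / 2" by simp
      have "fst (?G 2) = (1 - s) * fst (F2 2 u) + s * fst (R 2 u)" by simp
      also have "\<dots> \<le> 2"
        by (rule convex_bound_le) (use F2_le[of u] Rstart[OF e, of 2] u e s' in auto)
      finally have G2: "fst (?G 2) \<le> 2" .
      have G3: "?G j = (real j, 0)" if "3 \<le> j" for j
        using same[OF other[OF that]] Rstart[OF e] by simp
      consider "k = 2" "3 \<le> l" | "l = 2" "3 \<le> k" | "3 \<le> k" "3 \<le> l"
        using three[of k] three[of l] k l by auto
      then show ?thesis
      proof cases
        case 1
        have "fst (?G l) = real l" by (simp only: G3[OF 1(2)] fst_conv)
        then have "fst (?G k) < fst (?G l)" using G2 1 by simp
        then show ?thesis by (metis less_irrefl)
      next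
        case 2
        have "fst (?G k) = real k" by (simp only: G3[OF 2(2)] fst_conv)
        then have "fst (?G l) < fst (?G k)" using G2 2 by simp
        then show ?thesis by (metis less_irrefl)
      next
        case 3 then show ?thesis using G3[of k] G3[of l] l by simp
      qed
    qed
  qed simp
  have "path_closure {2..Suc n} R
      = path_closure {2..Suc n} (\<lambda>k u. word_path w k (real (length w) * (2 * u - 1)))"
    by (rule path_closure_cong) (simp add: R_def)
  with a b c d show ?thesis by (metis ambient_isotopic_trans)
qed

lemma closed_braid_destabilize_inner:
  assumes w: "w \<in> braid_words (Suc n)" and low: "\<And>a. a \<in> set w \<Longrightarrow> 2 \<le> gen_index a" and n: "1 \<le> n"
  shows "ambient_isotopic (closed_braid (Suc n) (Gen 1 # w))
    (closed_braid n (map (map_index (\<lambda>i. i - 1)) w))"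
proof -
  let ?m = "real (length w)" and ?w = "map (map_index (\<lambda>i. i - 1)) w"
  have "ambient_isotopic (path_closure {2..Suc n} (\<lambda>k u. word_path w k (?m * (2 * u - 1))))
      (path_closure {2..Suc n} (\<lambda>k u. word_path w k (?m * u) - (1, 0)))"
  proof (rule word_path_reparametrization)
    fix k assume k: "k \<in> {2..Suc n}"
    then show "word_perm w k \<in> {2..Suc n}"
      using word_perm_in[OF w, of k] word_perm_ge[of w 2 k] low by auto
    show "1 < fst (word_path w k t)" for t using word_path_fst_ge[of 2 k w t] low k by force
  qed (auto intro!: is_lip_intros)
  also have "path_closure {2..Suc n} (\<lambda>k u. word_path w k (?m * u) - (1, 0))
      = path_closure ((\<lambda>k. k - 1) ` {2..Suc n}) (\<lambda>k u. word_path ?w k (?m * u))"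
  proof (rule path_closure_reindex)
    fix k u assume "k \<in> {2..Suc n}"
    then show "word_path w k (?m * u) - (1, 0) = word_path ?w (k - 1) (?m * u)"
      by (subst word_path_shift) (use low in force)+
  qed
  also have "(\<lambda>k. k - 1) ` {2..Suc n} = {1..n}"
  proof (intro equalityI subsetI)
    fix x assume "x \<in> {1..n}"
    then show "x \<in> (\<lambda>k. k - 1) ` {2..Suc n}" by (intro image_eqI[of _ _ "Suc x"]) auto
  qed auto
  also have "path_closure {1..n} (\<lambda>k u. word_path ?w k (?m * u)) = closed_braid n ?w"
  proof -
    have "?w \<in> braid_words n" using w low by (force simp: braid_words_def)
    then show ?thesis by (simp add: closed_braid_path_closure)
  qed
  finally show ?thesis using closed_braid_loop[OF assms] ambient_isotopic_trans by blast
qed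

text \<open>Reversing the order of the strands turns \<open>\<sigma>\<^sub>n\<close> into \<open>\<sigma>\<^sub>1\<close>; the remaining strands are put back in
  their order afterwards.\<close>

lemma closed_braid_destabilize:
  assumes w: "w \<in> braid_words n" and n: "1 \<le> n"
  shows "ambient_isotopic (closed_braid (Suc n) (w @ [Gen n])) (closed_braid n w)"
proof -
  have w': "w \<in> braid_words (Suc n)" "Gen n # w \<in> braid_words (Suc n)"
    using w n by (auto simp: braid_words_def)
  have "ambient_isotopic (closed_braid (Suc n) (w @ [Gen n])) (closed_braid (Suc n) (Gen n # w))"
    by (rule ambient_isotopic_sym[OF closed_braid_rotate1])
  also have "ambient_isotopic (closed_braid (Suc n) (Gen n # w)) (closed_braid (Suc n) (flip_word (Suc n) (Gen n # w)))"
    by (rule closed_braid_flip[OF w'(2)])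
  also have "flip_word (Suc n) (Gen n # w) = Gen 1 # flip_word (Suc n) w"
    by (simp add: flip_word_def)
  also have "ambient_isotopic (closed_braid (Suc n) (Gen 1 # flip_word (Suc n) w))
      (closed_braid n (map (map_index (\<lambda>i. i - 1)) (flip_word (Suc n) w)))"
    by (rule closed_braid_destabilize_inner) (use w n in \<open>auto simp: braid_words_def flip_word_def\<close>)
  also have "map (map_index (\<lambda>i. i - 1)) (flip_word (Suc n) w) = flip_word n w"
    by (simp add: flip_word_def map_index_map_index)
  also have "ambient_isotopic (closed_braid n (flip_word n w)) (closed_braid n w)"
    by (rule ambient_isotopic_sym[OF closed_braid_flip[OF w]])
  finally show ?thesis .
qed

section \<open>Powers of the staircase in the positive braid monoid\<close>

lemma positive_words_Nil [simp]: "[] \<in> positive_words n"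
  and positive_words_append [simp]: "u @ v \<in> positive_words n \<longleftrightarrow> u \<in> positive_words n \<and> v \<in> positive_words n"
  and positive_words_Gen [simp]: "Gen i # v \<in> positive_words n \<longleftrightarrow> 1 \<le> i \<and> i < n \<and> v \<in> positive_words n"
  by (auto simp: positive_words_def)

lemma positive_words_braid_words: "w \<in> positive_words n \<Longrightarrow> w \<in> braid_words n"
  by (auto simp: positive_words_def braid_words_def)

lemma positive_words_mono: "w \<in> positive_words m \<Longrightarrow> m \<le> n \<Longrightarrow> w \<in> positive_words n"
  by (force simp: positive_words_def)

lemma positive_words_map_Gen: "map (\<lambda>x. Gen (g x)) xs \<in> positive_words n \<longleftrightarrow> (\<forall>x\<in>set xs. 1 \<le> g x \<and> g x < n)"
  by (auto simp: positive_words_def)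

lemma word_power_0 [simp]: "word_power w 0 = []"
  and word_power_Suc: "word_power w (Suc s) = w @ word_power w s"
  by (simp_all add: word_power_def)

lemma word_power_add: "word_power w (s + t) = word_power w s @ word_power w t"
  by (induction s) (simp_all add: word_power_Suc)

lemma word_power_positive: "w \<in> positive_words n \<Longrightarrow> word_power w s \<in> positive_words n"
  by (induction s) (simp_all add: word_power_Suc)

lemma staircase_positive: "r \<le> n \<Longrightarrow> staircase r \<in> positive_words n"
  by (auto simp: staircase_def positive_words_def)

lemma staircase_Suc: "1 \<le> r \<Longrightarrow> staircase (Suc r) = staircase r @ [Gen r]"
  by (simp add: staircase_def)

lemma positive_eq_words: "positive_eq n v w \<Longrightarrow> v \<in> braid_words n \<and> w \<in> braid_words n"
  by (induction rule: positive_eq.induct) (auto simp: braid_words_append braid_words_Cons)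

declare positive_eq.trans [trans]

lemma positive_eq_append:
  assumes "positive_eq n u u'" "positive_eq n v v'" shows "positive_eq n (u @ v) (u' @ v')"
proof -
  note w = positive_eq_words[OF assms(1)] positive_eq_words[OF assms(2)]
  have "positive_eq n ([] @ u @ v) ([] @ u' @ v)" by (rule positive_eq.cong[OF assms(1)]) (use w in auto)
  moreover have "positive_eq n (u' @ v @ []) (u' @ v' @ [])"
    by (rule positive_eq.cong[OF assms(2)]) (use w in auto)
  ultimately show ?thesis by (auto intro: positive_eq.trans)
qed

lemma positive_eq_refl: "w \<in> positive_words n \<Longrightarrow> positive_eq n w w"
  by (intro positive_eq.refl positive_words_braid_words)

lemma positive_eq_commute_far:
  assumes "\<And>j. j \<in> set js \<Longrightarrow> 1 \<le> j \<and> j < n \<and> (i + 2 \<le> j \<or> j + 2 \<le> i)" "1 \<le> i" "i < n"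
  shows "positive_eq n (Gen i # map Gen js) (map Gen js @ [Gen i])"
  using assms
proof (induction js)
  case Nil then show ?case by (simp add: positive_eq_refl)
next
  case (Cons j js)
  have pos: "map Gen js \<in> positive_words n"
    using Cons.prems(1) positive_words_map_Gen[of "\<lambda>j. j" js n] by simp
  have j: "1 \<le> j" "j < n" "i + 2 \<le> j \<or> j + 2 \<le> i" using Cons.prems(1)[of j] by auto
  have "positive_eq n [Gen i, Gen j] [Gen j, Gen i]"
    using j Cons.prems(2,3) positive_eq.far positive_eq.sym by metis
  from positive_eq_append[OF this positive_eq_refl[OF pos]]
  have "positive_eq n (Gen i # map Gen (j # js)) ([Gen j] @ (Gen i # map Gen js))" by simp
  also have "positive_eq n ([Gen j] @ (Gen i # map Gen js)) ([Gen j] @ (map Gen js @ [Gen i]))"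
    by (intro positive_eq_append Cons.IH positive_eq_refl) (use Cons.prems j in auto)
  finally show ?case by simp
qed

text \<open>The relation \<open>\<delta>\<^sub>n \<sigma>\<^sub>i = \<sigma>\<^bsub>i+1\<^esub> \<delta>\<^sub>n\<close>: the letter \<open>\<sigma>\<^sub>i\<close> commutes with the letters of the staircase down to
  \<open>\<sigma>\<^bsub>i+1\<^esub>\<close>, takes part in one braid relation and leaves as \<open>\<sigma>\<^bsub>i+1\<^esub>\<close>, which commutes with the rest.\<close>

lemma staircase_shift:
  assumes i: "1 \<le> i" "Suc i < n"
  shows "positive_eq n (staircase n @ [Gen i]) (Gen (Suc i) # staircase n)"
proof -
  let ?A = "map Gen [1..<i]" and ?B = "map Gen [i + 2..<n]"
  have split: "staircase n = ?A @ [Gen i, Gen (Suc i)] @ ?B"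
  proof -
    have "[1..<n] = [1..<i] @ [i..<n]" using i upt_add_eq_append[of 1 i "n - i"] by simp
    also have "[i..<n] = i # Suc i # [i + 2..<n]" using i by (simp add: upt_conv_Cons)
    finally show ?thesis by (simp add: staircase_def)
  qed
  have A: "?A \<in> positive_words n" and B: "?B \<in> positive_words n"
    using i by (auto simp: positive_words_def)
  have "positive_eq n (?A @ [Gen i, Gen (Suc i)] @ (?B @ [Gen i])) (?A @ [Gen i, Gen (Suc i)] @ (Gen i # ?B))"
    by (intro positive_eq_append positive_eq_refl A positive_eq.sym[OF positive_eq_commute_far]) (use i in auto)
  also have "\<dots> = ?A @ [Gen i, Gen (i + 1), Gen i] @ ?B" by simp
  also have "positive_eq n \<dots> (?A @ [Gen (i + 1), Gen i, Gen (i + 1)] @ ?B)"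
    by (intro positive_eq_append positive_eq_refl A B positive_eq.braid) (use i in auto)
  also have "\<dots> = (?A @ [Gen (Suc i)]) @ ([Gen i, Gen (Suc i)] @ ?B)" by simp
  also have "positive_eq n \<dots> ((Gen (Suc i) # ?A) @ ([Gen i, Gen (Suc i)] @ ?B))"
    by (intro positive_eq_append positive_eq_refl positive_eq.sym[OF positive_eq_commute_far])
       (use i B in auto)
  finally show ?thesis by (simp add: split)
qed

lemma staircase_power_shift1:
  assumes "1 \<le> i" "i + j < n"
  shows "positive_eq n (word_power (staircase n) j @ [Gen i]) (Gen (i + j) # word_power (staircase n) j)"
  using assms
proof (induction j)
  case 0 then show ?case by (simp add: positive_eq_refl)
next
  case (Suc j)
  let ?d = "staircase n"
  have d: "?d \<in> positive_words n" "word_power ?d j \<in> positive_words n"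
    by (simp_all add: staircase_positive word_power_positive)
  have "positive_eq n (?d @ (word_power ?d j @ [Gen i])) (?d @ (Gen (i + j) # word_power ?d j))"
    by (intro positive_eq_append positive_eq_refl d Suc.IH) (use Suc.prems in auto)
  also have "\<dots> = (?d @ [Gen (i + j)]) @ word_power ?d j" by simp
  also have "positive_eq n \<dots> ((Gen (Suc (i + j)) # ?d) @ word_power ?d j)"
    by (intro positive_eq_append positive_eq_refl d staircase_shift) (use Suc.prems in auto)
  finally show ?case by (simp add: word_power_Suc)
qed

lemma shift_positive:
  "w \<in> positive_words m \<Longrightarrow> map (map_index (\<lambda>i. i + j)) w \<in> positive_words (m + j)"
  by (fastforce simp: positive_words_def)

lemma staircase_power_shift:
  assumes "w \<in> positive_words m" "m + j \<le> n"
  shows "positive_eq n (word_power (staircase n) j @ w)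
    (map (map_index (\<lambda>i. i + j)) w @ word_power (staircase n) j)"
  using assms(1)
proof (induction w)
  case Nil
  show ?case by (simp add: positive_eq_refl staircase_positive word_power_positive)
next
  case (Cons a w)
  let ?d = "word_power (staircase n) j" and ?h = "map (map_index (\<lambda>i. i + j))"
  have w: "w \<in> positive_words m" and "\<exists>i. a = Gen i \<and> 1 \<le> i \<and> i < m"
    using Cons.prems by (auto simp: positive_words_def)
  then obtain i where i: "a = Gen i" "1 \<le> i" "i < m" by blast
  have wn: "w \<in> positive_words n" using positive_words_mono[OF w] assms(2) by simp
  have "positive_eq n ((?d @ [Gen i]) @ w) ((Gen (i + j) # ?d) @ w)"
    by (intro positive_eq_append positive_eq_refl wn staircase_power_shift1) (use i assms(2) in auto)
  also have "\<dots> = [Gen (i + j)] @ (?d @ w)" by simp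
  also have "positive_eq n \<dots> ([Gen (i + j)] @ (?h w @ ?d))"
    by (intro positive_eq_append positive_eq_refl Cons.IH[OF w]) (use i assms(2) in auto)
  finally show ?case by (simp add: i(1))
qed

text \<open>The shift of indices by the staircase is cyclic: with the index \<open>n\<close> missing, two staircases carry
  \<open>\<sigma>\<^bsub>n-1\<^esub>\<close> to \<open>\<sigma>\<^sub>1\<close>. Both sides equal \<open>\<sigma>\<^sub>1 (\<sigma>\<^sub>2 \<cdots> \<sigma>\<^bsub>n-1\<^esub>) \<delta>\<^sub>n \<sigma>\<^bsub>n-1\<^esub>\<close>.\<close>

lemma staircase_square_wrap:
  assumes "2 \<le> n"
  shows "positive_eq n (word_power (staircase n) 2 @ [Gen (n - 1)]) (Gen 1 # word_power (staircase n) 2)"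
proof -
  let ?d = "staircase n"
  obtain m where n: "n = Suc m" and m: "1 \<le> m" using assms by (cases n) auto
  have d: "?d = map Gen [1..<m] @ [Gen m]" "?d = Gen 1 # map Gen [2..<n]"
    using m by (simp_all add: n staircase_def upt_conv_Cons numeral_2_eq_2)
  have sh: "map (map_index (\<lambda>i. i + 1)) (map Gen [1..<m]) = map Gen [2..<n]"
  proof -
    have "map (map_index (\<lambda>i. i + 1)) (map Gen [1..<m]) = map Gen (map Suc [1..<m])" by simp
    also have "map Suc [1..<m] = [2..<n]" by (simp only: map_Suc_upt n numeral_2_eq_2 One_nat_def)
    finally show ?thesis .
  qed
  have slide: "positive_eq n (?d @ map Gen [1..<m]) (map Gen [2..<n] @ ?d)"
    using staircase_power_shift[of "map Gen [1..<m]" m 1 n] sh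
    by (simp add: positive_words_def n word_power_Suc)
  have "positive_eq n ([Gen 1] @ (?d @ map Gen [1..<m]) @ [Gen m])
      ([Gen 1] @ (map Gen [2..<n] @ ?d) @ [Gen m])"
    by (rule positive_eq_append[OF positive_eq_refl positive_eq_append[OF slide positive_eq_refl]])
       (use m n in auto)
  also have "[Gen 1] @ (?d @ map Gen [1..<m]) @ [Gen m] = Gen 1 # ?d @ ?d" 
    by (simp only: d(1) append.assoc append_Cons append_Nil)
  also have "[Gen 1] @ (map Gen [2..<n] @ ?d) @ [Gen m] = (?d @ ?d) @ [Gen m]"
    by (simp only: d(2) append.assoc append_Cons append_Nil)
  finally have "positive_eq n (Gen 1 # ?d @ ?d) ((?d @ ?d) @ [Gen m])" .
  then show ?thesis by (simp add: n positive_eq.sym numeral_2_eq_2 word_power_Suc)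
qed

text \<open>Of the \<open>s\<close> staircases, \<open>j - 1\<close> raise the index \<open>n - j\<close> to \<open>n - 1\<close>, two carry it to 1, and the remaining
  ones raise it to \<open>s - j\<close>.\<close>

lemma staircase_power_wrap1:
  assumes "1 \<le> j" "j < s" "s \<le> n"
  shows "positive_eq n (word_power (staircase n) s @ [Gen (n - j)]) (Gen (s - j) # word_power (staircase n) s)"
proof -
  let ?d = "word_power (staircase n)"
  have d: "?d k \<in> positive_words n" for k by (simp add: staircase_positive word_power_positive)
  have "s = (s - j - 1) + 2 + (j - 1)" using assms by simp
  then have split: "?d s = ?d (s - j - 1) @ ?d 2 @ ?d (j - 1)"
    by (metis word_power_add append.assoc)
  have "positive_eq n (?d (s - j - 1) @ ?d 2 @ (?d (j - 1) @ [Gen (n - j)]))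
      (?d (s - j - 1) @ ?d 2 @ (Gen (n - j + (j - 1)) # ?d (j - 1)))"
    by (intro positive_eq_append positive_eq_refl d staircase_power_shift1) (use assms in auto)
  also have "\<dots> = ?d (s - j - 1) @ (?d 2 @ [Gen (n - 1)]) @ ?d (j - 1)" using assms by simp
  also have "positive_eq n \<dots> (?d (s - j - 1) @ (Gen 1 # ?d 2) @ ?d (j - 1))"
    by (intro positive_eq_append positive_eq_refl d staircase_square_wrap) (use assms in auto)
  also have "\<dots> = (?d (s - j - 1) @ [Gen 1]) @ ?d 2 @ ?d (j - 1)" by simp
  also have "positive_eq n \<dots> ((Gen (1 + (s - j - 1)) # ?d (s - j - 1)) @ ?d 2 @ ?d (j - 1))"
    by (intro positive_eq_append positive_eq_refl d staircase_power_shift1) (use assms in auto)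
  also have "1 + (s - j - 1) = s - j" using assms by simp
  finally show ?thesis by (simp add: split)
qed

lemma staircase_power_wrap:
  assumes "s \<le> n" "k \<le> s"
  shows "positive_eq n (word_power (staircase n) s @ map (\<lambda>j. Gen (n - j)) [1..<k])
    (map (\<lambda>j. Gen (s - j)) [1..<k] @ word_power (staircase n) s)"
  using assms(2)
proof (induction k)
  case 0 then show ?case by (simp add: positive_eq_refl staircase_positive word_power_positive)
next
  case (Suc k)
  let ?d = "word_power (staircase n) s"
  let ?H = "\<lambda>s k. map (\<lambda>j. Gen (s - j)) [1..<k]"
  have d: "?d \<in> positive_words n" by (simp add: staircase_positive word_power_positive)
  show ?case
  proof (cases "k = 0")
    case True then show ?thesis using d by (simp add: positive_eq_refl)
  next
    case False
    have H: "?H s (Suc k) = ?H s k @ [Gen (s - k)]" for s using False by simp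
    have "positive_eq n ((?d @ ?H n k) @ [Gen (n - k)]) ((?H s k @ ?d) @ [Gen (n - k)])"
      by (intro positive_eq_append positive_eq_refl Suc.IH) (use Suc.prems assms False in auto)
    also have "\<dots> = ?H s k @ (?d @ [Gen (n - k)])" by simp
    also have "positive_eq n \<dots> (?H s k @ (Gen (s - k) # ?d))"
      by (intro positive_eq_append positive_eq_refl staircase_power_wrap1)
         (use Suc.prems assms False in \<open>auto simp: positive_words_map_Gen\<close>)
    finally show ?thesis by (simp only: H append.assoc append_Cons append_Nil)
  qed
qed

text \<open>In \<open>\<delta>\<^bsub>n+1\<^esub>\<^bsup>s+1\<^esup> = \<delta>\<^sub>n \<sigma>\<^sub>n \<delta>\<^bsub>n+1\<^esub>\<^sup>s\<close> the letter \<open>\<sigma>\<^sub>n\<close> moves to the right end, where it arrives with index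
  \<open>n - s\<close>.\<close>

lemma staircase_power_Suc:
  assumes "1 \<le> n" "s \<le> n"
  shows "positive_eq (Suc n) (word_power (staircase (Suc n)) s)
    (word_power (staircase n) s @ map (\<lambda>j. Gen (Suc n - j)) [1..<Suc s])"
  using assms(2)
proof (induction s)
  case 0 then show ?case by (simp add: positive_eq_refl)
next
  case (Suc s)
  let ?D = "word_power (staircase (Suc n))" and ?d = "word_power (staircase n)"
  let ?H = "map (\<lambda>j. Gen (Suc n - j)) [1..<Suc s]"
  have st: "staircase n \<in> positive_words (Suc n)" by (simp add: staircase_positive)
  have "?D (Suc s) = staircase n @ (Gen n # ?D s)"
    using assms(1) by (simp add: word_power_Suc staircase_Suc)
  also have "positive_eq (Suc n) \<dots> (staircase n @ (?D s @ [Gen (n - s)]))"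
  proof (rule positive_eq_append[OF positive_eq_refl[OF st] positive_eq.sym])
    show "positive_eq (Suc n) (?D s @ [Gen (n - s)]) (Gen n # ?D s)"
      using staircase_power_shift1[of "n - s" s "Suc n"] Suc.prems by simp
  qed
  also have "positive_eq (Suc n) \<dots> (staircase n @ (?d s @ ?H) @ [Gen (n - s)])"
    by (intro positive_eq_append positive_eq_refl st Suc.IH) (use Suc.prems in auto)
  finally show ?case by (simp add: word_power_Suc)
qed

section \<open>Reducing the number of strands\<close>

definition descent :: "nat \<Rightarrow> braid_word" where
  "descent s = map (\<lambda>j. Gen (s - j)) [1..<s]"

lemma descent_positive: "s \<le> n \<Longrightarrow> descent s \<in> positive_words n"
  by (auto simp: descent_def positive_words_map_Gen)

text \<open>After the equation \<open>\<delta>\<^bsub>n+1\<^esub>\<^sup>s = \<delta>\<^sub>n\<^sup>s \<sigma>\<^sub>n \<sigma>\<^bsub>n-1\<^esub> \<cdots> \<sigma>\<^bsub>n-s+1\<^esub>\<close> the letter \<open>\<sigma>\<^sub>n\<close> occurs once and is removed by a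
  destabilization; the letters behind it become \<open>descent s\<close> on their way to the left through
  \<open>\<delta>\<^sub>n\<^sup>s\<close>.\<close>

lemma closed_braid_reduce1:
  assumes n: "1 \<le> n" and s: "1 \<le> s" "s \<le> n" and b: "b \<in> positive_words n"
  shows "ambient_isotopic (closed_braid (Suc n) (b @ word_power (staircase (Suc n)) s))
    (closed_braid n (b @ descent s @ word_power (staircase n) s))"
proof -
  let ?d = "word_power (staircase n) s" and ?T = "map (\<lambda>j. Gen (n - j)) [1..<s]"
  have d: "?d \<in> positive_words n" by (simp add: staircase_positive word_power_positive)
  have T: "?T \<in> positive_words n" using s by (auto simp: positive_words_map_Gen)
  have split: "map (\<lambda>j. Gen (Suc n - j)) [1..<Suc s] = Gen n # ?T"
  proof -
    have "[1..<Suc s] = 1 # map Suc [1..<s]" using s by (simp add: upt_conv_Cons map_Suc_upt)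
    then show ?thesis by (simp del: upt_Suc)
  qed
  have bS: "b \<in> positive_words (Suc n)" using positive_words_mono[OF b] by simp
  have "ambient_isotopic (closed_braid (Suc n) (b @ word_power (staircase (Suc n)) s))
      (closed_braid (Suc n) (b @ (?d @ Gen n # ?T)))"
    using positive_eq_append[OF positive_eq_refl[OF bS] staircase_power_Suc[OF n s(2), unfolded split]]
    by (rule positive_eq_isotopic)
  also have "\<dots> = closed_braid (Suc n) ((b @ ?d @ [Gen n]) @ ?T)" by simp
  also have "ambient_isotopic \<dots> (closed_braid (Suc n) (?T @ (b @ ?d @ [Gen n])))"
    by (rule closed_braid_rotate)
  also have "\<dots> = closed_braid (Suc n) ((?T @ b @ ?d) @ [Gen n])" by simp
  also have "ambient_isotopic \<dots> (closed_braid n (?T @ b @ ?d))"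
    by (rule closed_braid_destabilize) (use n b d T in \<open>auto intro: positive_words_braid_words\<close>)
  also have "ambient_isotopic \<dots> (closed_braid n ((b @ ?d) @ ?T))"
    by (rule closed_braid_rotate)
  also have "\<dots> = closed_braid n (b @ (?d @ ?T))" by simp
  also have "ambient_isotopic \<dots> (closed_braid n (b @ (descent s @ ?d)))"
    unfolding descent_def
    by (intro positive_eq_isotopic positive_eq_append positive_eq_refl[OF b] staircase_power_wrap s order_refl)
  finally show ?thesis .
qed

lemma closed_braid_reduce:
  assumes "1 \<le> s" "s \<le> m" "b \<in> positive_words m"
  shows "ambient_isotopic (closed_braid (m + q) (b @ word_power (staircase (m + q)) s))
    (closed_braid m (b @ word_power (descent s) q @ word_power (staircase m) s))"
  using assms(3)
proof (induction q arbitrary: b)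
  case 0 then show ?case by (simp add: ambient_isotopic_refl)
next
  case (Suc q)
  have "ambient_isotopic (closed_braid (Suc (m + q)) (b @ word_power (staircase (Suc (m + q))) s))
      (closed_braid (m + q) (b @ descent s @ word_power (staircase (m + q)) s))"
    by (rule closed_braid_reduce1) (use assms Suc.prems positive_words_mono[of b m "m + q"] in auto)
  also have "\<dots> = closed_braid (m + q) ((b @ descent s) @ word_power (staircase (m + q)) s)" by simp
  also have "ambient_isotopic \<dots>
      (closed_braid m ((b @ descent s) @ word_power (descent s) q @ word_power (staircase m) s))"
    by (rule Suc.IH) (use Suc.prems descent_positive[OF assms(2)] in auto)
  finally show ?case by (simp add: word_power_Suc)
qed

section \<open>The full twist\<close>

definition fully_twisted :: "nat \<Rightarrow> braid_word \<Rightarrow> bool" where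
  "fully_twisted m v \<longleftrightarrow> (\<exists>n w. 1 \<le> n \<and> w \<in> positive_words n \<and> has_positive_full_twist n w
     \<and> ambient_isotopic (closed_braid m v) (closed_braid n w))"

lemma fully_twisted_isotopic:
  "ambient_isotopic (closed_braid m v) (closed_braid m' v') \<Longrightarrow> fully_twisted m' v' \<Longrightarrow> fully_twisted m v"
  unfolding fully_twisted_def by (blast intro: ambient_isotopic_trans)

lemma fully_twisted_context:
  assumes n: "1 \<le> n" and uv: "u \<in> positive_words n" "v \<in> positive_words n"
  shows "fully_twisted n (u @ full_twist n @ v)"
  unfolding fully_twisted_def
proof (intro exI conjI)
  have ft: "full_twist n \<in> positive_words n"
    by (simp add: full_twist_def staircase_positive word_power_positive)
  then show "full_twist n @ v @ u \<in> positive_words n" using uv by simp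
  then show "has_positive_full_twist n (full_twist n @ v @ u)"
    unfolding has_positive_full_twist_def using uv
    by (intro bexI[of _ "v @ u"] braid_eq.refl positive_words_braid_words) auto
  show "ambient_isotopic (closed_braid n (u @ full_twist n @ v)) (closed_braid n (full_twist n @ v @ u))"
    using closed_braid_rotate[of n u "full_twist n @ v"] by simp
qed (rule n)

lemma T_link_word_append: "T_link_word (ps @ qs) = T_link_word ps @ T_link_word qs"
  and T_link_word_single: "T_link_word [(r, s)] = word_power (staircase r) s"
  by (simp_all add: T_link_word_def)

lemma T_link_word_positive: "(\<And>r s. (r, s) \<in> set ps \<Longrightarrow> r \<le> n) \<Longrightarrow> T_link_word ps \<in> positive_words n"
  by (induction ps) (auto simp: T_link_word_def intro!: word_power_positive staircase_positive)

text \<open>For \<open>s \<ge> r\<close> the full twist is a factor of \<open>\<delta>\<^sub>r\<^sup>s\<close>. If everything in front of \<open>\<delta>\<^sub>r\<^sup>s\<close> uses at most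
  \<open>s < r\<close> strands, the number of strands can be reduced to \<open>s\<close>.\<close>

lemma T_link_fully_twisted_base:
  assumes sorted: "sorted_wrt (<) (map fst (ps @ [(r, s)]))"
    and rs: "1 \<le> r" "1 \<le> s" and g: "g \<in> positive_words (min r s)"
    and c: "r \<le> s \<or> (\<forall>(r', s')\<in>set ps. r' \<le> s)"
  shows "fully_twisted r (T_link_word ps @ g @ word_power (staircase r) s)"
proof (cases "r \<le> s")
  case True
  have "T_link_word ps \<in> positive_words r"
    using sorted by (intro T_link_word_positive) (force simp: sorted_wrt_append)
  moreover have "word_power (staircase r) s = full_twist r @ word_power (staircase r) (s - r)"
    using True by (simp add: full_twist_def flip: word_power_add)
  ultimately show ?thesis
    using fully_twisted_context[of r "T_link_word ps @ g" "word_power (staircase r) (s - r)"] g rs True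
    by (simp add: word_power_positive staircase_positive min_def)
next
  case False
  let ?b = "T_link_word ps @ g"
  have b: "?b \<in> positive_words s"
    using c g False by (auto intro!: T_link_word_positive simp: min_def)
  have "ambient_isotopic (closed_braid (s + (r - s)) (?b @ word_power (staircase (s + (r - s))) s))
      (closed_braid s (?b @ word_power (descent s) (r - s) @ word_power (staircase s) s))"
    by (rule closed_braid_reduce[OF rs(2) order_refl b])
  moreover have "fully_twisted s ((?b @ word_power (descent s) (r - s)) @ full_twist s @ [])"
    by (rule fully_twisted_context[OF rs(2)])
       (use b in \<open>auto simp: word_power_positive descent_positive\<close>)
  ultimately show ?thesis
    using False fully_twisted_isotopic by (simp add: full_twist_def)
qed

text \<open>Besides the factors of a T-link, the induction carries the positive braid \<open>g\<close> that the removed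
  factors leave behind. That it involves no more than \<open>s\<close> strands allows it to be moved past the next
  factor.\<close>

lemma T_link_fully_twisted:
  assumes "sorted_wrt (<) (map fst (ps @ [(r, s)]))"
    and "\<And>r' s'. (r', s') \<in> set (ps @ [(r, s)]) \<Longrightarrow> 1 \<le> r' \<and> 1 \<le> s'"
    and "g \<in> positive_words (min r s)"
  shows "fully_twisted r (T_link_word ps @ g @ word_power (staircase r) s)"
  using assms
proof (induction ps arbitrary: r s g rule: rev_induct)
  case Nil
  then show ?case using T_link_fully_twisted_base[of "[]" r s g] by simp
next
  case (snoc p ps)
  obtain r' s' where p: "p = (r', s')" by fastforce
  have rs: "1 \<le> r" "1 \<le> s" "1 \<le> r'" "1 \<le> s'" "r' < r"
    using snoc(3)[of r s] snoc(3)[of r' s'] snoc(2) by (auto simp: p sorted_wrt_append)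
  have below: "r'' < r'" if "(r'', s'') \<in> set ps" for r'' s''
    using snoc(2) that by (force simp: p sorted_wrt_append)
  show ?case
  proof (cases "r \<le> s \<or> r' \<le> s")
    case True
    then have "r \<le> s \<or> (\<forall>(r'', s'')\<in>set (ps @ [p]). r'' \<le> s)"
      using below by (force simp: p)
    then show ?thesis by (intro T_link_fully_twisted_base snoc rs)
  next
    case False
    then have s: "s < r'" "s < r" by auto
    let ?d = "word_power (staircase r')"
    define h where "h = g @ word_power (descent s) (r - r')"
    have h: "h \<in> positive_words s"
      using snoc(4) s by (simp add: h_def word_power_positive descent_positive min_def)
    have T: "T_link_word ps \<in> positive_words r'"
      using below by (intro T_link_word_positive) (force dest: less_imp_le)
    have d: "?d j \<in> positive_words r'" for j by (simp add: word_power_positive staircase_positive)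
    have "ambient_isotopic
        (closed_braid (r' + (r - r')) ((T_link_word ps @ ?d s' @ g) @ word_power (staircase (r' + (r - r'))) s))
        (closed_braid r' ((T_link_word ps @ ?d s' @ g) @ word_power (descent s) (r - r') @ ?d s))"
      by (rule closed_braid_reduce)
         (use rs s T d snoc(4) positive_words_mono[of g s r'] in \<open>auto simp: min_def\<close>)
    then have red: "ambient_isotopic
        (closed_braid r (T_link_word (ps @ [p]) @ g @ word_power (staircase r) s))
        (closed_braid r' (T_link_word ps @ ?d s' @ h @ ?d s))"
      using rs by (simp add: h_def p T_link_word_append T_link_word_single)
    \<comment> \<open>\<open>h\<close> can be moved to the left past \<open>i\<close> staircases on \<open>r'\<close> strands.\<close>
    define i where "i = min s' (r' - s)"
    define h' where "h' = map (map_index (\<lambda>k. k + i)) h"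
    have i: "i \<le> s'" "s + i \<le> r'" using s by (auto simp: i_def)
    have h': "h' \<in> positive_words (s + i)" "positive_eq r' (?d i @ h) (h' @ ?d i)"
      unfolding h'_def by (rule shift_positive[OF h] staircase_power_shift[OF h i(2)])+
    have "positive_eq r' (T_link_word ps @ ?d (s' - i) @ (?d i @ h) @ ?d s)
        (T_link_word ps @ ?d (s' - i) @ (h' @ ?d i) @ ?d s)"
      by (intro positive_eq_append positive_eq_refl T d h')
    then have "ambient_isotopic (closed_braid r' (T_link_word ps @ ?d s' @ h @ ?d s))
        (closed_braid r' (T_link_word ps @ ?d (s' - i) @ h' @ ?d (i + s)))"
      using i word_power_add[of "staircase r'" "s' - i" i] word_power_add[of "staircase r'" i s]
      by (auto dest!: positive_eq_isotopic)
    from ambient_isotopic_trans[OF red this]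
    have red': "ambient_isotopic
        (closed_braid r (T_link_word (ps @ [p]) @ g @ word_power (staircase r) s))
        (closed_braid r' (T_link_word ps @ ?d (s' - i) @ h' @ ?d (i + s)))" .
    have "fully_twisted r' (T_link_word ps @ ?d (s' - i) @ h' @ ?d (i + s))"
    proof (cases "r' - s \<le> s'")
      case True
      then have "i + s = r'" using s by (simp add: i_def)
      then show ?thesis
        using fully_twisted_context[of r' "T_link_word ps @ ?d (s' - i) @ h'" "[]"] rs T d
          positive_words_mono[OF h'(1) i(2)]
        by (simp add: full_twist_def)
    next
      case False
      then have "i = s'" "s + s' < r'" using s by (auto simp: i_def)
      then have "fully_twisted r' (T_link_word ps @ h' @ ?d (s' + s))"
        using h'(1) snoc(2,3) rs by (intro snoc(1)) (auto simp: p sorted_wrt_append min_def add.commute)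
      then show ?thesis using \<open>i = s'\<close> by simp
    qed
    then show ?thesis by (rule fully_twisted_isotopic[OF red'])
  qed
qed

theorem theorem3p5:
  fixes L :: "(real^3) set"
  assumes "is_T_link L"
  shows "\<exists>(n::nat) w. 1 \<le> n \<and> w \<in> positive_words n \<and> has_positive_full_twist n w \<and>
           is_closure_of L n w"
proof -
  obtain ps where ps: "T_link_params ps" and L: "is_closure_of L (fst (last ps)) (T_link_word ps)"
    using assms by (auto simp: is_T_link_def)
  obtain qs r s where split: "ps = qs @ [(r, s)]"
    using ps by (cases ps rule: rev_cases) (auto simp: T_link_params_def)
  have "fully_twisted r (T_link_word qs @ [] @ word_power (staircase r) s)"
    by (rule T_link_fully_twisted) (use ps in \<open>auto simp: T_link_params_def split\<close>)
  then have "fully_twisted (fst (last ps)) (T_link_word ps)"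
    by (simp add: split T_link_word_append T_link_word_single)
  then obtain n w where w: "1 \<le> n" "w \<in> positive_words n" "has_positive_full_twist n w"
    and iso: "ambient_isotopic (closed_braid (fst (last ps)) (T_link_word ps)) (closed_braid n w)"
    by (auto simp: fully_twisted_def)
  have "ambient_isotopic (closed_braid n w) L"
    using L ambient_isotopic_trans[OF ambient_isotopic_sym[OF iso]] by (simp add: is_closure_of_def)
  then show ?thesis
    using w positive_words_braid_words by (auto simp: is_closure_of_def)
qed

end
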